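(* Assume the following (the paper's Conjecture 6.3): for every positive integer $x$, the function $$f(x,r)=\frac1r\cdot\frac{\sum_{w=0}^r w\binom{x}{w}}{\sum_{w=0}^r\binom{x}{w}},\qquad r\le \frac x2,\ r\ge1,$$ is decreasing in $r$. Let $S\ge2$, $d\ge2$, $T\ge1$ be integers with $S$ dividing $d$, let $\alpha=1/S$, $\ell=d-d/S$, $\varphi=T\frac{\log d}{d}$ with $\varphi\le\alpha$, let $$p_1=(1-\alpha)\left[\Big(1-\frac{\alpha}{1-\alpha}\,2h^{\rm inv}\big(1-\frac{\varphi}{\alpha}\big)\Big)^2+\sqrt{\frac83}\cdot\frac{\sqrt{d-\ell}}{\ell}\right],$$ and assume $1-p_1>\alpha$. Let $\varepsilon_{\rm c},\varepsilon_{\rm f}\in(0,1)$. Consider the quantum signature scheme defined in the context, with parameters $\theta,N,z_{\rm acc},z_{\rm rej}$ set as $$\theta=\frac\alpha2(1+\nu)\quad\text{with }\nu\text{ a constant}>\alpha,$$ $$N=\frac1{\alpha^3}\left(\frac{\sqrt{3\ln\varepsilon_{\rm c}^{-1}}+\sqrt{1+4\theta}\,\sqrt{2\ln\varepsilon_{\rm f}^{-1}}}{\frac{1-p_1-\alpha}{\alpha}}\right)^2,$$ $$z_{\rm acc}=N\alpha+\sqrt{N\alpha}\,\sqrt{3\ln\varepsilon_{\rm c}^{-1}},$$ $$z_{\rm rej}=(1-2\theta)N\alpha+2\theta N(1-p_1)-\sqrt{(1-2\theta)N\alpha+2\theta N(1-p_1)}\,\sqrt{2\ln\varepsilon_{\rm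 f}^{-1}} .$$ Then the scheme is correct with error $\varepsilon_{\rm c}$ and is $\varepsilon_{\rm f}$-secure against forgery.
   Context: Notation: $\log$ is the base-2 logarithm; $h(p)=p\log\frac1p+(1-p)\log\frac1{1-p}$ is the binary entropy function and $h^{\rm inv}:[0,1]\to[0,\frac12]$ is the inverse of $h$ restricted to $[0,\frac12]$. $[d]=\{0,\ldots,d-1\}$. For $\mathcal J\subset[d]$ and $x\in\{0,1\}^d$, $x_{\mathcal J}$ is the substring $(x_i)_{i\in\mathcal J}$ with indices in increasing order. $\mathcal S=\{0,\ldots,S-1\}$ is the alphabet. For $s\in\mathcal S$, $\mathcal I(s)=\{s(d-\ell),\ldots,(s+1)(d-\ell)-1\}$; these are disjoint sets of size $d-\ell=d/S$. With $|0\rangle,\ldots,|d-1\rangle$ an orthonormal basis of a $d$-dimensional Hilbert space $\mathcal H_1$, the fingerprinting state of $x\in\{0,1\}^d$ is $|\mu(x)\rangle=\frac1{\sqrt d}\sum_{j=0}^{d-1}(-1)^{x_j}|j\rangle$. The scheme. Message space $\mathcal M=\mathcal S^K$. $\mathcal C$ is an error-correcting code over $\mathcal S$ encoding $\mathcal S^K$ into $\mathcal S^N$ that can correct symbol error rate $\theta$, meaning that the codewords of distinct messages differ in at least $2\theta N$ positions. (Keys) The private key is $k=(k^i)_{i=1}^N$ with $k^i\in\{0,1\}^d$; the public key is the state $|P_k\rangle=\bigotimes_{i=1}^N|\mu(k^i)\rangle\in\mathcal H_1^{\otimes N}$, of which $T$ copies are made for the $T$ verifiers. (Signing) ${\sf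 Sign}(k,x)$ for $x\in\mathcal S^K$: encode $x$ to $c\in\mathcal S^N$ and output $(\kappa_i)_{i=1}^N$ with $\kappa_i=k^i_{[d]\setminus\mathcal I(c_i)}\in\{0,1\}^\ell$. (Verification) ${\sf Verif}(|P\rangle,x',(\kappa'_i)_{i=1}^N)$: encode $x'$ to $c'\in\mathcal S^N$; for each $i$ let $|\psi_i\rangle$ be the normalized vector proportional to $\sum_{k'\in\{0,1\}^d:\,k'_{[d]\setminus\mathcal I(c'_i)}=\kappa'_i}|\mu(k')\rangle$, and apply the projective measurement $|\psi_i\rangle\langle\psi_i|$ to the $i$-th qudit (outcome `1' for projection onto $|\psi_i\rangle$, outcome `0' otherwise). Let $z\in\{0,\ldots,N\}$ be the number of `0' outcomes. If $z\le z_{\rm acc}$ the result is 1-ACC; if $z\ge z_{\rm rej}$ the result is REJ; in between the result is 0-ACC. Correct with error $\varepsilon$: for all private keys $k$ and all messages $m\in\mathcal M$, $\Pr[{\sf Verif}(|P_k\rangle,m,{\sf Sign}(k,m))=\text{1-ACC}]\ge1-\varepsilon$. $\varepsilon$-secure against forgery: let $k$ be generated uniformly at random. Consider any adversary (with unlimited quantum computing power and noiseless measurement and state preparation) who has access to $|P_k\rangle^{\otimes T}$, chooses one message $m\in\mathcal M$, receives the signature $r={\sf Sign}(k,m)$, and then outputs a pair $(m',r')$ with $m'\in\mathcal M$ and $r'$ in the signature space $(\{0,1\}^\ell)^N$. Then $\Pr[m'\ne m\ \wedge\ {\sf Verif}(|P_k\rangle,m',r')\ne\text{REJ}]\le\varepsilon$,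 the probability being over the random $k$, the adversary's random choices and the nondeterministic outcome of ${\sf Verif}$. The parameters are such that $N$ given by the formula is a positive integer; $z_{\rm acc},z_{\rm rej}$ are treated as real thresholds. *)

theory Defs
  imports "HOL-Analysis.Analysis" "Jordan_Normal_Form.Schur_Decomposition"
begin

section \<open>Entropy and the ratio of the conjecture\<close>

text \<open>At \<open>p = 0\<close> and \<open>p = 1\<close> the library conventions \<open>1 / 0 = 0\<close> and \<open>log 2 0 = 0\<close> give the
  usual value \<open>0\<close>.\<close>

definition bin_entropy :: "real \<Rightarrow> real" where
  "bin_entropy p = p * log 2 (1 / p) + (1 - p) * log 2 (1 / (1 - p))"

definition bin_entropy_inv :: "real \<Rightarrow> real" where
  "bin_entropy_inv = the_inv_into {0..1/2} bin_entropy"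

definition ball_ratio :: "nat \<Rightarrow> nat \<Rightarrow> real" where
  "ball_ratio x r = 1 / real r *
     ((\<Sum>w = 0..r. real w * real (x choose w)) / (\<Sum>w = 0..r. real (x choose w)))"


section \<open>Finite-dimensional quantum mechanics\<close>

text \<open>In \<open>u \<otimes> v\<close> the coordinates of \<open>u\<close> are the more significant ones; the same
  convention is used for matrices, so that \<open>(A \<otimes> B) (u \<otimes> v) = A u \<otimes> B v\<close>.\<close>

definition tensor_vec :: "complex vec \<Rightarrow> complex vec \<Rightarrow> complex vec" where
  "tensor_vec u v = vec (dim_vec u * dim_vec v)
     (\<lambda>i. u $ (i div dim_vec v) * v $ (i mod dim_vec v))"

definition tensor_mat :: "complex mat \<Rightarrow> complex mat \<Rightarrow> complex mat" where
  "tensor_mat A B = mat (dim_row A * dim_row B) (dim_col A * dim_col B)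
     (\<lambda>(i, j). A $$ (i div dim_row B, j div dim_col B) * B $$ (i mod dim_row B, j mod dim_col B))"

definition tensor_vecs :: "complex vec list \<Rightarrow> complex vec" where
  "tensor_vecs vs = foldr tensor_vec vs (vec 1 (\<lambda>_. 1))"

definition tensor_mats :: "complex mat list \<Rightarrow> complex mat" where
  "tensor_mats As = foldr tensor_mat As (1\<^sub>m 1)"

definition normalize_vec :: "complex vec \<Rightarrow> complex vec" where
  "normalize_vec v = complex_of_real (1 / sqrt (Re (v \<bullet>c v))) \<cdot>\<^sub>v v"

definition ket_bra :: "complex vec \<Rightarrow> complex mat" where
  "ket_bra v = mat (dim_vec v) (dim_vec v) (\<lambda>(i, j). v $ i * cnj (v $ j))"

text \<open>The order on \<^typ>\<open>complex\<close> is that of \<^theory>\<open>HOL-Library.Complex_Order\<close>: \<open>0 \<le> z\<close> says that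
  \<open>z\<close> is real and non-negative.\<close>

definition psd :: "nat \<Rightarrow> complex mat \<Rightarrow> bool" where
  "psd n E \<longleftrightarrow> E \<in> carrier_mat n n \<and> (\<forall>v \<in> carrier_vec n. 0 \<le> (E *\<^sub>v v) \<bullet>c v)"

text \<open>\<open>\<langle>v|E|v\<rangle>\<close>, the probability of the outcome with effect \<open>E\<close> in the pure state \<open>v\<close>. If \<open>v\<close> is
  subnormalized (the state left by an earlier measurement outcome, scaled such that its squared
  norm is the probability of that outcome), this is the joint probability of the two outcomes.\<close>

definition born :: "complex mat \<Rightarrow> complex vec \<Rightarrow> real" where
  "born E v = Re ((E *\<^sub>v v) \<bullet>c v)"

definition povm :: "nat \<Rightarrow> 'a set \<Rightarrow> ('a \<Rightarrow> complex mat) \<Rightarrow> bool" where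
  "povm n X E \<longleftrightarrow> (\<forall>x \<in> X. psd n (E x)) \<and>
     mat n n (\<lambda>ij. \<Sum>x\<in>X. E x $$ ij) = 1\<^sub>m n"

text \<open>A quantum instrument with outcomes in \<open>X\<close> from dimension \<open>n\<close> to dimension \<open>n'\<close>, in Kraus form:
  outcome \<open>x\<close> is described by the completely positive map \<open>\<rho> \<mapsto> \<Sum>A\<leftarrow>F x. A \<rho> A\<^sup>\<dagger>\<close>.\<close>

definition instrument ::
  "nat \<Rightarrow> nat \<Rightarrow> 'a set \<Rightarrow> ('a \<Rightarrow> complex mat list) \<Rightarrow> bool" where
  "instrument n n' X F \<longleftrightarrow> (\<forall>x \<in> X. set (F x) \<subseteq> carrier_mat n' n) \<and>
     mat n n (\<lambda>ij. \<Sum>x\<in>X. \<Sum>A\<leftarrow>F x. (mat_adjoint A * A) $$ ij) = 1\<^sub>m n"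


section \<open>The signature scheme\<close>

record qsig =
  qs_d :: nat
  qs_S :: nat
  qs_K :: nat
  qs_N :: nat
  qs_enc :: "nat list \<Rightarrow> nat list"
  qs_zacc :: real
  qs_zrej :: real

definition words :: "nat \<Rightarrow> nat \<Rightarrow> nat list set" where
  "words S n = {x. length x = n \<and> set x \<subseteq> {..<S}}"

definition corrects_rate ::
  "nat \<Rightarrow> nat \<Rightarrow> nat \<Rightarrow> (nat list \<Rightarrow> nat list) \<Rightarrow> real \<Rightarrow> bool" where
  "corrects_rate S K N enc \<theta> \<longleftrightarrow> enc ` words S K \<subseteq> words S N \<and>
     (\<forall>m \<in> words S K. \<forall>m' \<in> words S K. m \<noteq> m' \<longrightarrow>
        2 * \<theta> * real N \<le> real (card {i. i < N \<and> enc m ! i \<noteq> enc m' ! i}))"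

definition ell :: "qsig \<Rightarrow> nat" where
  "ell Q = qs_d Q - qs_d Q div qs_S Q"

definition messages :: "qsig \<Rightarrow> nat list set" where
  "messages Q = words (qs_S Q) (qs_K Q)"

definition private_keys :: "qsig \<Rightarrow> bool list list set" where
  "private_keys Q = {k. length k = qs_N Q \<and> (\<forall>x \<in> set k. length x = qs_d Q)}"

definition signatures :: "qsig \<Rightarrow> bool list list set" where
  "signatures Q = {r. length r = qs_N Q \<and> (\<forall>\<kappa> \<in> set r. length \<kappa> = ell Q)}"

definition hidden :: "qsig \<Rightarrow> nat \<Rightarrow> nat set" where
  "hidden Q s = {s * (qs_d Q - ell Q) ..< (s + 1) * (qs_d Q - ell Q)}"

definition revealed :: "qsig \<Rightarrow> nat \<Rightarrow> bool list \<Rightarrow> bool list" where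
  "revealed Q s x = nths x ({..<qs_d Q} - hidden Q s)"

definition fingerprint :: "bool list \<Rightarrow> complex vec" where
  "fingerprint x = vec (length x)
     (\<lambda>j. complex_of_real (1 / sqrt (real (length x))) * (if x ! j then -1 else 1))"

definition public_key :: "bool list list \<Rightarrow> complex vec" where
  "public_key k = tensor_vecs (map fingerprint k)"

definition public_key_copies :: "nat \<Rightarrow> bool list list \<Rightarrow> complex vec" where
  "public_key_copies T k = tensor_vecs (replicate T (public_key k))"

definition sign :: "qsig \<Rightarrow> bool list list \<Rightarrow> nat list \<Rightarrow> bool list list" where
  "sign Q k x = map (\<lambda>i. revealed Q (qs_enc Q x ! i) (k ! i)) [0..<qs_N Q]"

definition check_vec :: "qsig \<Rightarrow> nat \<Rightarrow> bool list \<Rightarrow> complex vec" where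
  "check_vec Q s \<kappa> = normalize_vec (vec (qs_d Q) (\<lambda>j.
     \<Sum>k' \<in> {k'. length k' = qs_d Q \<and> revealed Q s k' = \<kappa>}. fingerprint k' $ j))"

datatype verdict = ACC1 | ACC0 | REJ

text \<open>\<open>z \<le> z\<^sub>a\<^sub>c\<^sub>c\<close> is tested first; for the parameters of interest
  \<open>z\<^sub>a\<^sub>c\<^sub>c < z\<^sub>r\<^sub>e\<^sub>j\<close>, so the order is immaterial.\<close>

definition verdict_of :: "qsig \<Rightarrow> nat \<Rightarrow> verdict" where
  "verdict_of Q z =
     (if real z \<le> qs_zacc Q then ACC1 else if qs_zrej Q \<le> real z then REJ else ACC0)"

text \<open>Effect of the outcome string \<open>bs\<close> of the \<open>N\<close> single-qudit measurements; \<open>True\<close> stands for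
  outcome `1' (projection onto \<open>\<psi>\<^sub>i\<close>), \<open>False\<close> for outcome `0'.\<close>

definition verif_effect ::
  "qsig \<Rightarrow> nat list \<Rightarrow> bool list list \<Rightarrow> bool list \<Rightarrow> complex mat" where
  "verif_effect Q x r bs = tensor_mats (map (\<lambda>i.
     let P = ket_bra (check_vec Q (qs_enc Q x ! i) (r ! i))
     in if bs ! i then P else 1\<^sub>m (qs_d Q) - P) [0..<qs_N Q])"

text \<open>The probability that the verdict of the verification of \<open>(x, r)\<close> against the state \<open>P\<close> lies
  in \<open>V\<close>.\<close>

definition verif_prob ::
  "qsig \<Rightarrow> complex vec \<Rightarrow> nat list \<Rightarrow> bool list list \<Rightarrow> verdict set \<Rightarrow> real" where
  "verif_prob Q P x r V =
     (\<Sum>bs \<in> {bs. length bs = qs_N Q \<and> verdict_of Q (count_list bs False) \<in> V}.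
        born (verif_effect Q x r bs) P)"

definition correct :: "qsig \<Rightarrow> real \<Rightarrow> bool" where
  "correct Q \<epsilon> \<longleftrightarrow> (\<forall>k \<in> private_keys Q. \<forall>m \<in> messages Q.
     1 - \<epsilon> \<le> verif_prob Q (public_key k) m (sign Q k m) {ACC1})"

text \<open>An adversary first applies an instrument to the \<open>T\<close> copies of the public key; its classical
  outcome is the message to be signed, and the post-measurement state lives in a memory of
  dimension \<open>adv_dim\<close>. Having received the signature \<open>r\<close> of \<open>m\<close>, it applies a measurement
  \<open>adv_forge m r\<close> to the memory whose outcome is the forgery \<open>(m', r')\<close>. Ancillas and private
  randomness are absorbed in the instrument and in the measurement; since the initial
  state is finite-dimensional, finite-dimensional memories suffice.\<close>

record adversary =
  adv_dim :: nat
  adv_choose :: "nat list \<Rightarrow> complex mat list"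
  adv_forge :: "nat list \<Rightarrow> bool list list \<Rightarrow> nat list \<times> bool list list \<Rightarrow> complex mat"

definition valid_adversary :: "qsig \<Rightarrow> nat \<Rightarrow> adversary \<Rightarrow> bool" where
  "valid_adversary Q T A \<longleftrightarrow>
     instrument ((qs_d Q ^ qs_N Q) ^ T) (adv_dim A) (messages Q) (adv_choose A) \<and>
     (\<forall>m \<in> messages Q. \<forall>r \<in> signatures Q.
        povm (adv_dim A) (messages Q \<times> signatures Q) (adv_forge A m r))"

definition forge_prob :: "qsig \<Rightarrow> nat \<Rightarrow> adversary \<Rightarrow> bool list list \<Rightarrow> real" where
  "forge_prob Q T A k =
     (\<Sum>m \<in> messages Q. \<Sum>(m', r') \<in> {(m', r') \<in> messages Q \<times> signatures Q. m' \<noteq> m}.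
        (\<Sum>B\<leftarrow>adv_choose A m.
           born (adv_forge A m (sign Q k m) (m', r')) (B *\<^sub>v public_key_copies T k)) *
        verif_prob Q (public_key k) m' r' (- {REJ}))"

definition secure_forgery :: "qsig \<Rightarrow> nat \<Rightarrow> real \<Rightarrow> bool" where
  "secure_forgery Q T \<epsilon> \<longleftrightarrow> (\<forall>A. valid_adversary Q T A \<longrightarrow>
     (\<Sum>k \<in> private_keys Q. forge_prob Q T A k) / real (card (private_keys Q)) \<le> \<epsilon>)"

end

(* The public key is a vector whose coordinates are signs depending on the private key. As a
   function of the n = d / S bits hidden at position i, every coordinate of the T copies is a
   character of degree at most T, so at most (n + 1)^T characters occur; by Cauchy-Schwarz and
   orthogonality, the probability of any outcome of the adversary is nowhere more than (n + 1)^T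
   times its average over these bits. Weights on the hidden bits with small average are therefore
   nearly uncorrelated with the outcome, jointly over all positions. For the weights of the
   exponential moment method this average is estimated with sum_x z^dist = (1 + z)^n, which is
   2^(n h(p)) = 2^n / d^T up to normalization if z = p / (1 - p), where p is the value of the
   inverse entropy function in p1; the term sqrt (8 / 3) * ... of p1 absorbs the loss. Since the
   exponents are balanced between attacked and honest positions, the positions attacked may
   depend on everything the adversary has seen. *)

theory Submission
  imports Defs "HOL-Real_Asymp.Real_Asymp"
begin

section \<open>Binary entropy\<close>

text \<open>Comparing an outcome probability with its average at all \<open>N\<close> positions at
  once would cost \<open>(n + 1)^(T N)\<close>. The weight at an attacked position is therefore
  brought to the form \<open>exp (- u * (1 - q0)) * (1 + c)\<close> with \<open>c\<close>
  nonnegative and of small average over the hidden bits: the summand \<open>1\<close> is left alone,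
  and only \<open>c\<close> pays the factor. Flipping hidden bits does not change the signature of
  the signed message, so the adversary's second measurement stays fixed while these bits are
  averaged. The estimate is proportional to the probability of the individual output
  \<open>(m, m', r')\<close>, so summing over outputs needs no union bound. The cost of
  \<open>1 + c\<close> is charged to all \<open>N\<close> positions although only
  \<open>2 \<theta> N\<close> of them are sure to bring a gain; this is affordable because
  \<open>((n + 1) / d)^T\<close> is at most \<open>(n + 1) / d\<close>, about
  \<open>\<alpha>\<close>, and \<open>\<alpha> \<le> 2 \<theta>\<close>. The constant
  \<open>sqrt (8 / 3)\<close> then suffices only narrowly: the estimates need \<open>n >= 7\<close>,
  which follows from \<open>1 - p1 > \<alpha>\<close>, since in a tiny block the correction term of
  \<open>p1\<close> would eat up the gap.\<close>

lemma has_real_derivative_mult_ln: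
  assumes "(g has_real_derivative g') (at x)" "g x > 0"
  shows "((\<lambda>x. g x * ln (g x)) has_real_derivative g' * (ln (g x) + 1)) (at x)"
proof -
  have "((\<lambda>x. g x * ln (g x)) has_real_derivative g' * ln (g x) + 1 / g x * g' * g x) (at x)"
    by (rule DERIV_mult[OF assms(1) DERIV_chain2[OF DERIV_ln_divide[OF assms(2)] assms(1)]])
  then show ?thesis
    using assms(2) by (simp add: algebra_simps)
qed

lemma bin_entropy_ln:
  "0 < p \<Longrightarrow> p < 1 \<Longrightarrow> bin_entropy p = - (p * ln p + (1 - p) * ln (1 - p)) / ln 2"
  by (simp add: bin_entropy_def log_def ln_div field_simps)

lemma bin_entropy_0 [simp]: "bin_entropy 0 = 0"
  by (simp add: bin_entropy_def)

lemma bin_entropy_half [simp]: "bin_entropy (1 / 2) = 1"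
  by (simp add: bin_entropy_def)

lemma bin_entropy_has_derivative:
  assumes "0 < p" "p < 1"
  shows "(bin_entropy has_real_derivative ln ((1 - p) / p) / ln 2) (at p)"
proof -
  have "((\<lambda>p. - (p * ln p + (1 - p) * ln (1 - p)) / ln 2) has_real_derivative
      - (ln p + p * (1 / p) + (- ln (1 - p) + (1 - p) * (- 1 / (1 - p)))) / ln 2) (at p)"
    using assms by (auto intro!: derivative_eq_intros)
  moreover have "- (ln p + p * (1 / p) + (- ln (1 - p) + (1 - p) * (- 1 / (1 - p))))
      = ln ((1 - p) / p)"
    using assms by (simp add: ln_div)
  ultimately have "((\<lambda>p. - (p * ln p + (1 - p) * ln (1 - p)) / ln 2) has_real_derivative
      ln ((1 - p) / p) / ln 2) (at p)"
    by simp
  then show ?thesis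
    by (rule has_field_derivative_transform_within_open[where S = "{0<..<1}"])
       (use assms in \<open>auto simp: bin_entropy_ln\<close>)
qed

lemma continuous_on_bin_entropy: "continuous_on {0..1/2} bin_entropy"
proof -
  have "continuous (at p within {0..1/2}) bin_entropy" if "p \<in> {0..1/2}" for p
  proof (cases "p = 0")
    case False
    with that have "isCont bin_entropy p"
      by (intro DERIV_isCont[OF bin_entropy_has_derivative]) auto
    then show ?thesis
      by (rule continuous_at_imp_continuous_at_within)
  next
    case True
    \<comment> \<open>The derivative is unbounded near 0, so continuity there is taken from the
      limit of \<open>p * ln p\<close>.\<close>
    have "((\<lambda>p::real. - (p * ln p + (1 - p) * ln (1 - p)) / ln 2) \<longlongrightarrow> 0) (at_right 0)"
      by real_asymp
    moreover have "\<forall>\<^sub>F p in at_right 0.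
        - (p * ln p + (1 - p) * ln (1 - p)) / ln 2 = bin_entropy p"
      unfolding eventually_at_right_field using bin_entropy_ln by (intro exI[of _ 1]) auto
    ultimately have "(bin_entropy \<longlongrightarrow> 0) (at_right 0)"
      by (rule Lim_transform_eventually)
    then show ?thesis
      unfolding True continuous_within
      by (simp add: at_within_Icc_at_right)
  qed
  then show ?thesis
    by (simp add: continuous_on_eq_continuous_within)
qed

lemma strict_mono_on_bin_entropy: "strict_mono_on {0..1/2} bin_entropy"
proof (rule strict_mono_onI)
  fix a b :: real
  assume ab: "a \<in> {0..1/2}" "b \<in> {0..1/2}" "a < b"
  show "bin_entropy a < bin_entropy b"
  proof (rule DERIV_pos_imp_increasing_open[OF \<open>a < b\<close>])
    fix x assume x: "a < x" "x < b"
    have "ln ((1 - x) / x) > 0"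
      using x ab by (auto intro!: ln_gt_zero simp: field_simps)
    then show "\<exists>y. (bin_entropy has_real_derivative y) (at x) \<and> 0 < y"
      using bin_entropy_has_derivative[of x] x ab
      by (intro exI[of _ "ln ((1 - x) / x) / ln 2"]) auto
  next
    show "continuous_on {a..b} bin_entropy"
      by (rule continuous_on_subset[OF continuous_on_bin_entropy]) (use ab in auto)
  qed
qed

lemma bin_entropy_inv_properties:
  assumes "0 \<le> y" "y \<le> 1"
  shows "bin_entropy (bin_entropy_inv y) = y" "bin_entropy_inv y \<in> {0..1/2}"
proof -
  have inj: "inj_on bin_entropy {0..1/2}"
    by (rule strict_mono_on_imp_inj_on[OF strict_mono_on_bin_entropy])
  have "\<exists>x. 0 \<le> x \<and> x \<le> 1/2 \<and> bin_entropy x = y"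
    by (rule IVT') (use assms continuous_on_bin_entropy in auto)
  then have y: "y \<in> bin_entropy ` {0..1/2}"
    by auto
  show "bin_entropy (bin_entropy_inv y) = y"
    unfolding bin_entropy_inv_def by (rule f_the_inv_into_f[OF inj y])
  show "bin_entropy_inv y \<in> {0..1/2}"
    unfolding bin_entropy_inv_def by (rule the_inv_into_into[OF inj y order_refl])
qed

text \<open>The first term of the power series of the log-odds. Besides the entropy estimates it
  also yields the bound on \<open>ln (1 + t)\<close> behind the upper Chernoff exponent.\<close>

lemma log_odds_ge:
  fixes x :: real
  assumes "0 \<le> x" "x < 1"
  shows "2 * x \<le> ln ((1 + x) / (1 - x))"
proof -
  define f where "f = (\<lambda>x::real. ln (1 + x) - ln (1 - x) - 2 * x)"
  have "f 0 \<le> f x"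
  proof (rule DERIV_nonneg_imp_nondecreasing[OF assms(1)])
    fix t :: real assume t: "0 \<le> t" "t \<le> x"
    have "(f has_real_derivative (1 / (1 + t) + 1 / (1 - t) - 2)) (at t)"
      unfolding f_def using t assms by (auto intro!: derivative_eq_intros)
    moreover have "1 / (1 + t) + 1 / (1 - t) - 2 = 2 * t\<^sup>2 / ((1 + t) * (1 - t))"
      using t assms by (simp add: divide_simps) (simp add: algebra_simps power2_eq_square)
    ultimately show "\<exists>y. (f has_real_derivative y) (at t) \<and> 0 \<le> y"
      using t assms by (intro exI[of _ "1 / (1 + t) + 1 / (1 - t) - 2"]) simp
  qed
  then show ?thesis
    using assms by (simp add: f_def ln_div)
qed

text \<open>The difference of the two sides has derivative
  \<open>4 * t\<^sup>2 / (1 - t\<^sup>2)\<^sup>2\<close>. The inequality is the sign of the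
  derivative of \<open>\<omega>\<close> in the parabola bound that follows.\<close>

lemma log_odds_le:
  fixes x :: real
  assumes "0 \<le> x" "x < 1"
  shows "ln ((1 + x) / (1 - x)) \<le> 2 * x / (1 - x\<^sup>2)"
proof -
  have sq: "t\<^sup>2 < 1" if "0 \<le> t" "t \<le> x" for t
    using that assms by (simp add: abs_square_less_1)
  define f where "f = (\<lambda>x::real. 2 * x / (1 - x\<^sup>2) - ln (1 + x) + ln (1 - x))"
  have "f 0 \<le> f x"
  proof (rule DERIV_nonneg_imp_nondecreasing[OF assms(1)])
    fix t :: real assume t: "0 \<le> t" "t \<le> x"
    have pos: "1 - t\<^sup>2 > 0" "1 + t > 0" "1 - t > 0"
      using sq[OF t] t assms by auto
    have factor: "1 - t\<^sup>2 = (1 + t) * (1 - t)"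
      by (simp add: algebra_simps power2_eq_square)
    have eq: "1 / (1 + t) + 1 / (1 - t) = 2 / (1 - t\<^sup>2)"
      unfolding factor using pos by (simp add: divide_simps)
    have "(f has_real_derivative
        (2 * (1 - t\<^sup>2) + 4 * t\<^sup>2) / (1 - t\<^sup>2)\<^sup>2 - (1 / (1 + t) + 1 / (1 - t))) (at t)"
      unfolding f_def using pos
      by (auto intro!: derivative_eq_intros simp: power2_eq_square)
    moreover have "(2 * (1 - t\<^sup>2) + 4 * t\<^sup>2) / (1 - t\<^sup>2)\<^sup>2 - 2 / (1 - t\<^sup>2) = 4 * t\<^sup>2 / (1 - t\<^sup>2)\<^sup>2"
    proof -
      have gen: "(2 * w + c) / w\<^sup>2 - 2 / w = c / w\<^sup>2" if "w \<noteq> 0" for w c :: real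
        using that by (simp add: field_simps power2_eq_square)
      show ?thesis
        by (rule gen) (use pos(1) in simp)
    qed
    ultimately show "\<exists>y. (f has_real_derivative y) (at t) \<and> 0 \<le> y"
      unfolding eq by (intro exI conjI) (assumption, simp)
  qed
  then show ?thesis
    using assms by (simp add: f_def ln_div)
qed

text \<open>With \<open>p = (1 - x) / 2\<close> the claim is \<open>\<psi> x / x\<^sup>2 \<le> \<psi> 1\<close> for \<open>\<psi> = (1 - h) ln 2\<close>; the quotient
  is increasing because \<open>x \<psi>' - 2 \<psi>\<close> has derivative \<open>x / (1 - x\<^sup>2) - artanh x \<ge> 0\<close>.\<close>

lemma bin_entropy_ge_parabola:
  assumes "0 < p" "p \<le> 1 / 2"
  shows "1 - bin_entropy p \<le> (1 - 2 * p)\<^sup>2"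
proof -
  define \<psi> where "\<psi> = (\<lambda>x::real. ((1 + x) * ln (1 + x) + (1 - x) * ln (1 - x)) / 2)"
  define \<omega> where "\<omega> = (\<lambda>x::real. x * ln ((1 + x) / (1 - x)) / 2 - 2 * \<psi> x)"
  have \<psi>: "(\<psi> has_real_derivative ln ((1 + x) / (1 - x)) / 2) (at x)" if "0 \<le> x" "x < 1" for x
  proof -
    have "((\<lambda>x. (1 + x) * ln (1 + x)) has_real_derivative 1 * (ln (1 + x) + 1)) (at x)"
      by (rule has_real_derivative_mult_ln) (use that in \<open>auto intro!: derivative_eq_intros\<close>)
    moreover have "((\<lambda>x. (1 - x) * ln (1 - x)) has_real_derivative - 1 * (ln (1 - x) + 1)) (at x)"
      by (rule has_real_derivative_mult_ln) (use that in \<open>auto intro!: derivative_eq_intros\<close>)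
    ultimately have "(\<psi> has_real_derivative
        (1 * (ln (1 + x) + 1) + - 1 * (ln (1 - x) + 1)) / 2) (at x)"
      unfolding \<psi>_def by (intro DERIV_cdivide DERIV_add)
    then show ?thesis
      using that by (simp add: ln_div)
  qed
  have \<omega>_nonneg: "0 \<le> \<omega> x" if x: "0 \<le> x" "x < 1" for x
  proof -
    have "\<omega> 0 \<le> \<omega> x"
    proof (rule DERIV_nonneg_imp_nondecreasing[OF x(1)])
      fix t :: real assume t: "0 \<le> t" "t \<le> x"
      have t1: "t < 1" using t x by simp
      have sq: "1 - t\<^sup>2 > 0"
        using t t1 by (simp add: abs_square_less_1)
      have "((\<lambda>x. x * (ln (1 + x) - ln (1 - x)) / 2 - 2 * \<psi> x) has_real_derivative
          (ln (1 + t) - ln (1 - t) + t * (1 / (1 + t) + 1 / (1 - t))) / 2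
          - 2 * (ln ((1 + t) / (1 - t)) / 2)) (at t)"
        using t t1 by (auto intro!: derivative_eq_intros \<psi>)
      then have deriv: "(\<omega> has_real_derivative
          (ln (1 + t) - ln (1 - t) + t * (1 / (1 + t) + 1 / (1 - t))) / 2
          - 2 * (ln ((1 + t) / (1 - t)) / 2)) (at t)"
        by (rule has_field_derivative_transform_within_open[where S = "{-1<..<1}"])
           (use t t1 in \<open>auto simp: \<omega>_def ln_div\<close>)
      have eq: "(ln (1 + t) - ln (1 - t) + t * (1 / (1 + t) + 1 / (1 - t))) / 2
          - 2 * (ln ((1 + t) / (1 - t)) / 2)
          = (2 * t / (1 - t\<^sup>2) - ln ((1 + t) / (1 - t))) / 2"
      proof -
        have "1 - t\<^sup>2 = (1 + t) * (1 - t)"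
          by (simp add: algebra_simps power2_eq_square)
        then have "t * (1 / (1 + t) + 1 / (1 - t)) = 2 * t / (1 - t\<^sup>2)"
          using t t1 by (simp add: divide_simps)
        then show ?thesis
          using t t1 by (simp add: ln_div field_simps)
      qed
      show "\<exists>y. (\<omega> has_real_derivative y) (at t) \<and> 0 \<le> y"
        using deriv[unfolded eq] log_odds_le[OF t(1) t1] by (intro exI conjI) (assumption, simp)
    qed
    then show ?thesis
      by (simp add: \<omega>_def \<psi>_def)
  qed
  define x where "x = 1 - 2 * p"
  have x: "0 \<le> x" "x < 1"
    using assms by (auto simp: x_def)
  have "\<psi> x \<le> x\<^sup>2 * ln 2"
  proof (cases "x = 0")
    case True
    then show ?thesis by (simp add: \<psi>_def)
  next
    case False
    have mono: "\<psi> x / x\<^sup>2 \<le> \<psi> y / y\<^sup>2" if y: "x \<le> y" "y < 1" for y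
    proof (rule DERIV_nonneg_imp_nondecreasing[OF y(1)])
      fix t :: real assume t: "x \<le> t" "t \<le> y"
      have t0: "0 < t" "t < 1" using t x False y by auto
      have "((\<lambda>x. \<psi> x / x\<^sup>2) has_real_derivative
          (ln ((1 + t) / (1 - t)) / 2 * t\<^sup>2 - \<psi> t * (2 * t)) / (t\<^sup>2)\<^sup>2) (at t)"
        using t0 by (auto intro!: derivative_eq_intros \<psi> simp: power2_eq_square)
      moreover have "ln ((1 + t) / (1 - t)) / 2 * t\<^sup>2 - \<psi> t * (2 * t) = t * \<omega> t"
        by (simp add: \<omega>_def power2_eq_square algebra_simps)
      ultimately show "\<exists>y. ((\<lambda>x. \<psi> x / x\<^sup>2) has_real_derivative y) (at t) \<and> 0 \<le> y"
        using \<omega>_nonneg[of t] t0 by (intro exI conjI) (assumption, simp)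
    qed
    \<comment> \<open>The formula for the derivative of \<open>\<psi>\<close> stops short of 1,
      where \<open>ln (1 - x)\<close> is singular; so \<open>x\<close> is compared with
      \<open>y < 1\<close>, and \<open>y\<close> is sent to 1.\<close>
    have lim: "((\<lambda>y. \<psi> y / y\<^sup>2) \<longlongrightarrow> ln 2) (at_left 1)"
      unfolding \<psi>_def by real_asymp
    have "\<forall>\<^sub>F y in at_left 1. \<psi> x / x\<^sup>2 \<le> \<psi> y / y\<^sup>2"
      unfolding eventually_at_left_field using mono x by (intro exI[of _ x]) auto
    then have "\<psi> x / x\<^sup>2 \<le> ln 2"
      using lim by (intro tendsto_lowerbound[OF lim]) auto
    then show ?thesis
      using False by (simp add: field_simps)
  qed
  moreover have "\<psi> x = (1 - bin_entropy p) * ln 2"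
  proof -
    have eqs: "1 + x = 2 * (1 - p)" "1 - x = 2 * p"
      by (auto simp: x_def)
    have lns: "ln (2 * (1 - p)) = ln 2 + ln (1 - p)" "ln (2 * p) = ln 2 + ln p"
      by (rule ln_mult_pos; use assms in simp)+
    have "\<psi> x = (1 - p) * (ln 2 + ln (1 - p)) + p * (ln 2 + ln p)"
      unfolding \<psi>_def eqs lns by (simp add: field_simps)
    moreover have "bin_entropy p * ln 2 = - (p * ln p + (1 - p) * ln (1 - p))"
      using assms by (simp add: bin_entropy_ln)
    ultimately show ?thesis
      by (simp add: algebra_simps)
  qed
  ultimately show ?thesis
    by (simp add: x_def)
qed

text \<open>Both sides are compared with \<open>2 * (1 - 2 * p)\<close>. This bounds
  \<open>ln Z\<close>, which stands in the denominator of the attack advantage, from below by the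
  entropy deficit alone.\<close>

lemma log_odds_ge_bin_entropy:
  assumes "0 < p" "p \<le> 1 / 2"
  shows "2 * sqrt (1 - bin_entropy p) \<le> ln ((1 - p) / p)"
proof -
  have "sqrt (1 - bin_entropy p) \<le> sqrt ((1 - 2 * p)\<^sup>2)"
    using bin_entropy_ge_parabola[OF assms] by (rule real_sqrt_le_mono)
  also have "\<dots> = 1 - 2 * p"
    using assms by simp
  finally have "2 * sqrt (1 - bin_entropy p) \<le> 2 * (1 - 2 * p)"
    by simp
  also have "\<dots> \<le> ln ((1 + (1 - 2 * p)) / (1 - (1 - 2 * p)))"
    using assms by (intro log_odds_ge) auto
  also have "(1 + (1 - 2 * p)) / (1 - (1 - 2 * p)) = (1 - p) / p"
    using assms by (simp add: field_simps)
  finally show ?thesis .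
qed

text \<open>\<open>1 + 1 / Z\<close> is \<open>1 / (1 - p)\<close>, so the two factors merge into
  the entropy. The right-hand side is the sum of \<open>Z powr (n * p - card H)\<close> over all
  subsets \<open>H\<close> of an \<open>n\<close>-set: at this tilt the generating function bound
  for a Hamming ball of radius \<open>n * p\<close> is the entropy bound.\<close>

lemma two_powr_bin_entropy:
  fixes n :: nat
  assumes "0 < p" "p < 1"
  defines "Z \<equiv> (1 - p) / p"
  shows "2 powr (real n * bin_entropy p) = Z powr (real n * p) * (1 + 1 / Z) ^ n"
proof -
  have Z: "Z > 0" "1 + 1 / Z = 1 / (1 - p)"
    using assms by (auto simp: field_simps)
  have "2 powr (real n * bin_entropy p) = exp (- real n * (p * ln p + (1 - p) * ln (1 - p)))"
    using assms(1,2) by (simp add: powr_def bin_entropy_ln field_simps)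
  also have "\<dots> = exp (real n * p * ln Z) * exp (real n * ln (1 / (1 - p)))"
    unfolding exp_add[symmetric] Z_def using assms by (simp add: ln_div algebra_simps)
  also have "exp (real n * ln (1 / (1 - p))) = (1 / (1 - p)) ^ n"
    using assms by (subst exp_of_nat_mult) simp
  also have "exp (real n * p * ln Z) = Z powr (real n * p)"
    using Z by (simp add: powr_def)
  finally show ?thesis
    by (simp add: Z)
qed

section \<open>Chernoff exponents\<close>

text \<open>The source of the constant 3 in \<open>zacc\<close>. Differentiating reduces the claim
  to \<open>ln (1 + t) >= 2 * t / 3\<close> on the unit interval.\<close>

lemma chernoff_upper_exponent:
  fixes \<delta> :: real
  assumes "0 \<le> \<delta>" "\<delta> \<le> 1"
  shows "\<delta> - (1 + \<delta>) * ln (1 + \<delta>) \<le> - \<delta>\<^sup>2 / 3"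
proof -
  define f where "f = (\<lambda>x::real. (1 + x) * ln (1 + x) - x - x\<^sup>2 / 3)"
  have "ln (1 + t) \<ge> 2 * t / 3" if t: "0 \<le> t" "t \<le> 1" for t :: real
  proof -
    have "ln (1 + t) \<ge> 2 * t / (2 + t)"
    proof -
      \<comment> \<open>For \<open>x = t / (2 + t)\<close> the quotient
        \<open>(1 + x) / (1 - x)\<close> is \<open>1 + t\<close>.\<close>
      have "2 * (t / (2 + t)) \<le> ln ((1 + t / (2 + t)) / (1 - t / (2 + t)))"
        using t by (intro log_odds_ge) (auto simp: field_simps)
      also have "(1 + t / (2 + t)) / (1 - t / (2 + t)) = 1 + t"
        using t by (simp add: field_simps)
      finally show ?thesis by simp
    qed
    moreover have "2 * t / 3 \<le> 2 * t / (2 + t)"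
      using t by (intro divide_left_mono) auto
    ultimately show ?thesis by linarith
  qed
  note ln_ge = this
  have "f 0 \<le> f \<delta>"
  proof (rule DERIV_nonneg_imp_nondecreasing[OF assms(1)])
    fix t assume t: "0 \<le> t" "t \<le> \<delta>"
    have "((\<lambda>x. (1 + x) * ln (1 + x)) has_real_derivative 1 * (ln (1 + t) + 1)) (at t)"
      by (rule has_real_derivative_mult_ln) (use t in \<open>auto intro!: derivative_eq_intros\<close>)
    then have "(f has_real_derivative 1 * (ln (1 + t) + 1) - 1 - 2 * t / 3) (at t)"
      unfolding f_def by (rule DERIV_diff[OF DERIV_diff])
        (auto intro!: derivative_eq_intros)
    then have "(f has_real_derivative ln (1 + t) - 2 * t / 3) (at t)"
      by simp
    then show "\<exists>y. (f has_real_derivative y) (at t) \<and> 0 \<le> y"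
      using ln_ge[of t] t assms by (intro exI conjI) (assumption, simp)
  qed
  then show ?thesis
    by (simp add: f_def)
qed

text \<open>The source of the constant 2 in \<open>zrej\<close>. Differentiating reduces the claim
  to \<open>ln (1 - t) \<le> - t\<close>.\<close>

lemma chernoff_lower_exponent:
  fixes \<delta> :: real
  assumes "0 \<le> \<delta>" "\<delta> < 1"
  shows "- \<delta> - (1 - \<delta>) * ln (1 - \<delta>) \<le> - \<delta>\<^sup>2 / 2"
proof -
  define f where "f = (\<lambda>x::real. (1 - x) * ln (1 - x) + x - x\<^sup>2 / 2)"
  have "f 0 \<le> f \<delta>"
  proof (rule DERIV_nonneg_imp_nondecreasing[OF assms(1)])
    fix t assume t: "0 \<le> t" "t \<le> \<delta>"
    have "((\<lambda>x. (1 - x) * ln (1 - x)) has_real_derivative - 1 * (ln (1 - t) + 1)) (at t)"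
      by (rule has_real_derivative_mult_ln) (use t assms in \<open>auto intro!: derivative_eq_intros\<close>)
    then have "(f has_real_derivative - 1 * (ln (1 - t) + 1) + 1 - t) (at t)"
      unfolding f_def by (rule DERIV_diff[OF DERIV_add])
        (auto intro!: derivative_eq_intros)
    then have "(f has_real_derivative - ln (1 - t) - t) (at t)"
      by simp
    moreover have "ln (1 - t) \<le> - t"
      using ln_le_minus_one[of "1 - t"] t assms by simp
    ultimately show "\<exists>y. (f has_real_derivative y) (at t) \<and> 0 \<le> y"
      by (intro exI conjI) (assumption, simp)
  qed
  then show ?thesis
    by (simp add: f_def)
qed

no_notation Finite_Cartesian_Product.vec.vec_nth (infixl \<open>$\<close> 90)

section \<open>Tensor products\<close>

lemma sum_lessThan_mult:
  fixes f :: "nat \<Rightarrow> 'a::comm_monoid_add"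
  shows "(\<Sum>i<m * n. f i) = (\<Sum>a<m. \<Sum>b<n. f (a * n + b))"
proof (induction m)
  case (Suc m)
  have "(\<Sum>i<Suc m * n. f i) = (\<Sum>i<m * n. f i) + (\<Sum>i=m * n..<m * n + n. f i)"
    unfolding lessThan_atLeast0 by (subst sum.atLeastLessThan_concat) (auto simp: add.commute)
  also have "(\<Sum>i=m * n..<m * n + n. f i) = (\<Sum>b<n. f (m * n + b))"
    using sum.shift_bounds_nat_ivl[of f 0 "m * n" n]
    by (simp add: lessThan_atLeast0 add.commute)
  finally show ?case
    using Suc by simp
qed simp

lemma div_mod_mult_add:
  fixes a b n :: nat
  assumes "b < n"
  shows "(a * n + b) div n = a" "(a * n + b) mod n = b"
  using assms by auto

lemma mult_add_less:
  fixes a b m n :: nat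
  assumes "a < m" "b < n"
  shows "a * n + b < m * n"
proof -
  have "a * n + b < Suc a * n"
    using assms by simp
  also have "\<dots> \<le> m * n"
    using assms by (intro mult_le_mono1) simp
  finally show ?thesis .
qed

lemma dim_tensor_vec [simp]: "dim_vec (tensor_vec u v) = dim_vec u * dim_vec v"
  by (simp add: tensor_vec_def)

lemma dim_tensor_mat [simp]:
  "dim_row (tensor_mat A B) = dim_row A * dim_row B"
  "dim_col (tensor_mat A B) = dim_col A * dim_col B"
  by (simp_all add: tensor_mat_def)

lemma tensor_vec_index:
  "i < dim_vec u * dim_vec v \<Longrightarrow>
    tensor_vec u v $ i = u $ (i div dim_vec v) * v $ (i mod dim_vec v)"
  by (simp add: tensor_vec_def)

lemma tensor_mat_mult_tensor_vec:
  assumes "dim_col A = dim_vec u" "dim_col B = dim_vec v"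
  shows "tensor_mat A B *\<^sub>v tensor_vec u v = tensor_vec (A *\<^sub>v u) (B *\<^sub>v v)"
proof (rule eq_vecI)
  fix i assume "i < dim_vec (tensor_vec (A *\<^sub>v u) (B *\<^sub>v v))"
  then have i: "i < dim_row A * dim_row B"
    by simp
  then have pos: "0 < dim_row B"
    by (cases "dim_row B") auto
  have i': "i div dim_row B < dim_row A" "i mod dim_row B < dim_row B"
    using i pos by (auto simp: less_mult_imp_div_less)
  have "(tensor_mat A B *\<^sub>v tensor_vec u v) $ i =
      (\<Sum>j<dim_vec u * dim_vec v. tensor_mat A B $$ (i, j) * tensor_vec u v $ j)"
    using i assms by (simp add: scalar_prod_def lessThan_atLeast0)
  also have "\<dots> = (\<Sum>a<dim_vec u. \<Sum>b<dim_vec v.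
      (A $$ (i div dim_row B, a) * u $ a) * (B $$ (i mod dim_row B, b) * v $ b))"
    unfolding sum_lessThan_mult
  proof (intro sum.cong refl)
    fix a b assume ab: "a \<in> {..<dim_vec u}" "b \<in> {..<dim_vec v}"
    then have "a * dim_vec v + b < dim_vec u * dim_vec v"
      by (intro mult_add_less) auto
    then show "tensor_mat A B $$ (i, a * dim_vec v + b) * tensor_vec u v $ (a * dim_vec v + b) =
        (A $$ (i div dim_row B, a) * u $ a) * (B $$ (i mod dim_row B, b) * v $ b)"
      using i ab assms by (simp add: tensor_mat_def tensor_vec_def div_mod_mult_add)
  qed
  also have "\<dots> = (A *\<^sub>v u) $ (i div dim_row B) * (B *\<^sub>v v) $ (i mod dim_row B)"
    using i' assms by (simp add: scalar_prod_def lessThan_atLeast0 sum_product)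
  also have "\<dots> = tensor_vec (A *\<^sub>v u) (B *\<^sub>v v) $ i"
    using i by (simp add: tensor_vec_index)
  finally show "(tensor_mat A B *\<^sub>v tensor_vec u v) $ i = tensor_vec (A *\<^sub>v u) (B *\<^sub>v v) $ i" .
qed simp

lemma tensor_vec_inner:
  assumes "dim_vec u = dim_vec u'" "dim_vec v = dim_vec v'"
  shows "tensor_vec u v \<bullet>c tensor_vec u' v' = (u \<bullet>c u') * (v \<bullet>c v')"
proof -
  have "tensor_vec u v \<bullet>c tensor_vec u' v' =
      (\<Sum>j<dim_vec u' * dim_vec v'. tensor_vec u v $ j * cnj (tensor_vec u' v' $ j))"
    by (simp add: scalar_prod_def lessThan_atLeast0)
  also have "\<dots> = (\<Sum>a<dim_vec u'. \<Sum>b<dim_vec v'.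
      (u $ a * cnj (u' $ a)) * (v $ b * cnj (v' $ b)))"
    unfolding sum_lessThan_mult
  proof (intro sum.cong refl)
    fix a b assume ab: "a \<in> {..<dim_vec u'}" "b \<in> {..<dim_vec v'}"
    then have "a * dim_vec v' + b < dim_vec u' * dim_vec v'"
      by (intro mult_add_less) auto
    then show "tensor_vec u v $ (a * dim_vec v' + b) * cnj (tensor_vec u' v' $ (a * dim_vec v' + b)) =
        (u $ a * cnj (u' $ a)) * (v $ b * cnj (v' $ b))"
      using ab assms by (simp add: tensor_vec_def div_mod_mult_add)
  qed
  also have "\<dots> = (u \<bullet>c u') * (v \<bullet>c v')"
    by (simp add: scalar_prod_def lessThan_atLeast0 sum_product)
  finally show ?thesis .
qed

lemma tensor_vecs_simps [simp]:
  "tensor_vecs [] = Matrix.vec 1 (\<lambda>_. 1)"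
  "tensor_vecs (v # vs) = tensor_vec v (tensor_vecs vs)"
  by (simp_all add: tensor_vecs_def)

lemma tensor_mats_simps [simp]:
  "tensor_mats [] = 1\<^sub>m 1"
  "tensor_mats (A # As) = tensor_mat A (tensor_mats As)"
  by (simp_all add: tensor_mats_def)

lemma dim_tensor_vecs: "dim_vec (tensor_vecs vs) = prod_list (map dim_vec vs)"
  by (induction vs) auto

text \<open>This factorization is what makes the \<open>N\<close> verification measurements
  independent. The carrier claim travels along because the induction step needs the dimensions of
  the tail.\<close>

lemma tensor_mats_mult_tensor_vecs:
  assumes "list_all2 (\<lambda>A v. A \<in> carrier_mat (dim_vec v) (dim_vec v)) As vs"
  shows "tensor_mats As \<in> carrier_mat (dim_vec (tensor_vecs vs)) (dim_vec (tensor_vecs vs)) \<and>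
    (tensor_mats As *\<^sub>v tensor_vecs vs) \<bullet>c tensor_vecs vs =
      prod_list (map2 (\<lambda>A v. (A *\<^sub>v v) \<bullet>c v) As vs)"
  using assms
proof (induction rule: list_all2_induct)
  case Nil
  show ?case by (simp add: scalar_prod_def)
next
  case (Cons A As v vs)
  then show ?case
    by (auto simp: tensor_mat_mult_tensor_vec tensor_vec_inner)
qed

lemma cinner_self_real: "v \<bullet>c v = complex_of_real (\<Sum>i<dim_vec v. (cmod (v $ i))\<^sup>2)"
  by (simp add: scalar_prod_def lessThan_atLeast0 complex_norm_square del: of_real_power)

lemma tensor_vecs_self_inner:
  "tensor_vecs vs \<bullet>c tensor_vecs vs = (\<Prod>v\<leftarrow>vs. v \<bullet>c v)"
  by (induction vs) (simp_all add: tensor_vec_inner, simp add: scalar_prod_def)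

lemma ket_bra_carrier [simp]: "ket_bra v \<in> carrier_mat (dim_vec v) (dim_vec v)"
  by (simp add: ket_bra_def)

lemma ket_bra_born:
  assumes "dim_vec \<psi> = dim_vec v"
  shows "(ket_bra \<psi> *\<^sub>v v) \<bullet>c v = complex_of_real ((cmod (v \<bullet>c \<psi>))\<^sup>2)"
proof -
  have "ket_bra \<psi> *\<^sub>v v = (v \<bullet>c \<psi>) \<cdot>\<^sub>v \<psi>"
    by (rule eq_vecI)
       (use assms in \<open>simp_all add: ket_bra_def scalar_prod_def sum_distrib_left mult_ac\<close>)
  moreover have "\<psi> \<bullet>c v = cnj (v \<bullet>c \<psi>)"
    using assms by (simp add: scalar_prod_def mult_ac)
  moreover have "((v \<bullet>c \<psi>) \<cdot>\<^sub>v \<psi>) \<bullet>c v = (v \<bullet>c \<psi>) * (\<psi> \<bullet>c v)"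
    using assms by (intro smult_scalar_prod_distrib[of _ "dim_vec v"] carrier_vecI) auto
  ultimately show ?thesis
    by (simp add: complex_norm_square del: of_real_power)
qed

lemma one_minus_ket_bra_born:
  assumes "dim_vec \<psi> = dim_vec v" "v \<bullet>c v = 1"
  shows "((1\<^sub>m (dim_vec v) - ket_bra \<psi>) *\<^sub>v v) \<bullet>c v = complex_of_real (1 - (cmod (v \<bullet>c \<psi>))\<^sup>2)"
proof -
  have K: "ket_bra \<psi> \<in> carrier_mat (dim_vec v) (dim_vec v)"
    using ket_bra_carrier[of \<psi>] unfolding assms(1) .
  have "(1\<^sub>m (dim_vec v) - ket_bra \<psi>) *\<^sub>v v = v - ket_bra \<psi> *\<^sub>v v"
    by (subst minus_mult_distrib_mat_vec[OF one_carrier_mat K carrier_vec_dim_vec]) simp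
  moreover have "(v - ket_bra \<psi> *\<^sub>v v) \<bullet>c v = v \<bullet>c v - (ket_bra \<psi> *\<^sub>v v) \<bullet>c v"
    by (rule minus_scalar_prod_distrib[of _ "dim_vec v"])
       (use mult_mat_vec_carrier[OF K carrier_vec_dim_vec] in simp_all)
  ultimately show ?thesis
    using ket_bra_born[OF assms(1)] assms(2) by simp
qed

section \<open>Sign characters and positive semidefinite forms\<close>

text \<open>A Walsh character of the group of subsets under symmetric difference: \<open>H\<close>
  will be the set of flipped bits, \<open>U\<close> the frequency, and \<open>card U\<close> its
  degree.\<close>

definition character :: "nat set \<Rightarrow> nat set \<Rightarrow> real" where
  "character U H = (-1) ^ card (U \<inter> H)"

lemma minus_one_power_card_sym_diff:
  assumes "finite A" "finite B"
  shows "(-1::real) ^ card (sym_diff A B) = (-1) ^ card A * (-1) ^ card B"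
proof -
  have "card A = card (A - B) + card (A \<inter> B)" "card B = card (B - A) + card (A \<inter> B)"
    using card_Int_Diff[OF assms(1), of B] card_Int_Diff[OF assms(2), of A]
    by (simp_all add: Int_commute)
  moreover have "card (sym_diff A B) = card (A - B) + card (B - A)"
    using assms by (intro card_Un_disjoint) auto
  ultimately show ?thesis
    by (simp add: power_add flip: power_mult_distrib)
qed

lemma character_empty [simp]: "character {} H = 1" "character U {} = 1"
  by (simp_all add: character_def)

lemma character_sym_diff_left:
  assumes "finite U" "finite V"
  shows "character (sym_diff U V) H = character U H * character V H"
proof -
  have "sym_diff U V \<inter> H = sym_diff (U \<inter> H) (V \<inter> H)"
    by auto
  then show ?thesis
    using assms minus_one_power_card_sym_diff[of "U \<inter> H" "V \<inter> H"] by (simp add: character_def)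
qed

lemma character_sym_diff_right:
  assumes "finite H" "finite H'"
  shows "character U (sym_diff H H') = character U H * character U H'"
  using character_sym_diff_left[OF assms, of U] by (simp add: character_def Int_commute)

lemma bij_betw_sym_diff_Pow:
  assumes "M \<subseteq> I"
  shows "bij_betw (\<lambda>H. sym_diff H M) (Pow I) (Pow I)"
  by (rule bij_betwI[where g = "\<lambda>H. sym_diff H M"]) (use assms in auto)

text \<open>Toggling one element \<open>j\<close> of \<open>U\<close> in \<open>H\<close> permutes
  the subsets and reverses every sign.\<close>

lemma sum_character_eq_0:
  assumes "finite I" "U \<subseteq> I" "U \<noteq> {}"
  shows "(\<Sum>H\<in>Pow I. character U H) = 0"
proof -
  obtain j where j: "j \<in> U" "j \<in> I"
    using assms by auto
  have "(\<Sum>H\<in>Pow I. character U H) = (\<Sum>H\<in>Pow I. character U (sym_diff H {j}))"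
    by (rule sum.reindex_bij_betw[OF bij_betw_sym_diff_Pow, symmetric]) (use j in auto)
  also have "\<dots> = (\<Sum>H\<in>Pow I. - character U H)"
  proof (rule sum.cong[OF refl])
    fix H assume "H \<in> Pow I"
    then have "finite H"
      using assms finite_subset by auto
    then show "character U (sym_diff H {j}) = - character U H"
      using j by (subst character_sym_diff_right) (auto simp: character_def)
  qed
  finally show ?thesis
    by (simp add: sum_negf)
qed

lemma character_orthogonal:
  assumes "finite I" "U \<subseteq> I" "V \<subseteq> I"
  shows "(\<Sum>H\<in>Pow I. character U H * character V H) = (if U = V then 2 ^ card I else 0)"
proof -
  have fin: "finite U" "finite V"
    using assms finite_subset by auto
  have "(\<Sum>H\<in>Pow I. character U H * character V H) = (\<Sum>H\<in>Pow I. character (sym_diff U V) H)"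
    using fin by (simp add: character_sym_diff_left)
  also have "\<dots> = (if U = V then 2 ^ card I else 0)"
  proof (cases "U = V")
    case False
    then have "sym_diff U V \<noteq> {}" by auto
    then show ?thesis
      using sum_character_eq_0[OF assms(1), of "sym_diff U V"] assms False by auto
  qed (use assms in \<open>simp add: card_Pow\<close>)
  finally show ?thesis .
qed

lemma sum_swap3:
  "(\<Sum>b\<in>B. \<Sum>x\<in>X. \<Sum>y\<in>Y. f b x y) = (\<Sum>x\<in>X. \<Sum>y\<in>Y. \<Sum>b\<in>B. f b x y)"
  by (rule trans[OF sum.swap]) (intro sum.cong refl sum.swap)

lemma sum_swap4:
  "(\<Sum>a\<in>A. \<Sum>b\<in>B. \<Sum>x\<in>X. \<Sum>y\<in>Y. f a b x y) = (\<Sum>x\<in>X. \<Sum>y\<in>Y. \<Sum>a\<in>A. \<Sum>b\<in>B. f a b x y)"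
  by (rule trans[OF _ sum_swap3]) (intro sum.cong refl sum_swap3)

text \<open>Vectors enter as plain functions, so that they can be cut into pieces by classes of
  coordinates and recombined without dimension conditions.\<close>

definition sesqui :: "nat \<Rightarrow> (nat \<Rightarrow> nat \<Rightarrow> complex) \<Rightarrow> (nat \<Rightarrow> complex) \<Rightarrow> (nat \<Rightarrow> complex) \<Rightarrow> complex"
  where "sesqui n M f g = (\<Sum>x<n. \<Sum>y<n. M x y * f y * cnj (g x))"

lemma sesqui_sum:
  assumes "finite A" "finite B"
  shows "sesqui n M (\<lambda>x. \<Sum>a\<in>A. F a x) (\<lambda>x. \<Sum>b\<in>B. G b x) =
    (\<Sum>a\<in>A. \<Sum>b\<in>B. sesqui n M (F a) (G b))"
proof -
  have "M x y * (\<Sum>a\<in>A. F a y) * cnj (\<Sum>b\<in>B. G b x) =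
      (\<Sum>a\<in>A. \<Sum>b\<in>B. M x y * F a y * cnj (G b x))" for x y
    by (simp only: cnj_sum sum_distrib_left sum_distrib_right mult.assoc) (rule sum.swap)
  then show ?thesis
    unfolding sesqui_def by (simp only:) (rule sum_swap4)
qed

lemma sesqui_diff:
  "sesqui n M (\<lambda>x. f x - g x) (\<lambda>x. f x - g x) =
    sesqui n M f f - sesqui n M f g - sesqui n M g f + sesqui n M g g"
  by (simp add: sesqui_def algebra_simps sum.distrib sum_subtractf)

lemma sesqui_scale:
  "sesqui n M (\<lambda>x. complex_of_real a * f x) (\<lambda>x. complex_of_real b * g x) =
    complex_of_real (a * b) * sesqui n M f g"
  by (simp add: sesqui_def sum_distrib_left mult_ac)

text \<open>Cut \<open>f\<close> into pieces \<open>g V\<close> supported on the coordinates with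
  character \<open>V\<close>. Orthogonality leaves only the diagonal terms, with sum
  \<open>D\<close>, in the average over \<open>H\<close>, while the form at \<open>f\<close> is at
  most \<open>card \<U> * D\<close>.\<close>

lemma psd_form_le_average:
  assumes psd: "\<And>f. 0 \<le> Re (sesqui n M f f)"
    and I: "finite I" and \<U>: "finite \<U>" "\<U> \<subseteq> Pow I"
    and U: "\<And>x. x < n \<Longrightarrow> U x \<in> \<U>"
  shows "2 ^ card I * Re (sesqui n M f f) \<le> real (card \<U>) *
    (\<Sum>H\<in>Pow I. Re (sesqui n M (\<lambda>x. complex_of_real (character (U x) H) * f x)
                               (\<lambda>x. complex_of_real (character (U x) H) * f x)))"
proof -
  define g where "g = (\<lambda>V x. if U x = V then f x else 0)"
  have cong: "sesqui n M F F = sesqui n M G G" if "\<And>x. x < n \<Longrightarrow> F x = G x" for F G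
    unfolding sesqui_def using that by (intro sum.cong refl) auto
  have split: "sesqui n M (\<lambda>x. complex_of_real (character (U x) H) * f x)
        (\<lambda>x. complex_of_real (character (U x) H) * f x) =
      (\<Sum>V\<in>\<U>. \<Sum>W\<in>\<U>. complex_of_real (character V H * character W H) * sesqui n M (g V) (g W))" for H
  proof -
    have "complex_of_real (character (U x) H) * f x =
        (\<Sum>V\<in>\<U>. complex_of_real (character V H) * g V x)" if "x < n" for x
      using U[OF that] \<U> by (simp add: g_def if_distrib[of "times _"] sum.delta' cong: if_cong)
    from cong[OF this] show ?thesis
      by (simp add: sesqui_sum \<U> sesqui_scale)
  qed
  define D where "D = (\<Sum>V\<in>\<U>. Re (sesqui n M (g V) (g V)))"
  have average: "(\<Sum>H\<in>Pow I. Re (sesqui n M (\<lambda>x. complex_of_real (character (U x) H) * f x)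
        (\<lambda>x. complex_of_real (character (U x) H) * f x))) = 2 ^ card I * D"
  proof -
    have "(\<Sum>H\<in>Pow I. Re (sesqui n M (\<lambda>x. complex_of_real (character (U x) H) * f x)
          (\<lambda>x. complex_of_real (character (U x) H) * f x))) =
        (\<Sum>H\<in>Pow I. \<Sum>V\<in>\<U>. \<Sum>W\<in>\<U>. (character V H * character W H) * Re (sesqui n M (g V) (g W)))"
      unfolding split by (simp del: of_real_mult)
    also have "\<dots> = (\<Sum>V\<in>\<U>. \<Sum>W\<in>\<U>. (\<Sum>H\<in>Pow I. character V H * character W H)
        * Re (sesqui n M (g V) (g W)))"
      unfolding sum_distrib_right by (rule sum_swap3)
    also have "\<dots> = (\<Sum>V\<in>\<U>. \<Sum>W\<in>\<U>. if V = W then 2 ^ card I * Re (sesqui n M (g V) (g W)) else 0)"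
    proof (intro sum.cong refl)
      fix V W assume "V \<in> \<U>" "W \<in> \<U>"
      then have "V \<subseteq> I" "W \<subseteq> I"
        using \<U> by auto
      then show "(\<Sum>H\<in>Pow I. character V H * character W H) * Re (sesqui n M (g V) (g W)) =
          (if V = W then 2 ^ card I * Re (sesqui n M (g V) (g W)) else 0)"
        by (simp only: character_orthogonal[OF I]) simp
    qed
    also have "\<dots> = 2 ^ card I * D"
      using \<U> by (simp add: D_def sum.delta sum_distrib_left)
    finally show ?thesis .
  qed
  have "sesqui n M f f = (\<Sum>V\<in>\<U>. \<Sum>W\<in>\<U>. sesqui n M (g V) (g W))"
    using split[of "{}"] by simp
  then have whole: "Re (sesqui n M f f) = (\<Sum>V\<in>\<U>. \<Sum>W\<in>\<U>. Re (sesqui n M (g V) (g W)))"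
    by simp
  \<comment> \<open>Cauchy-Schwarz as positivity at all differences \<open>g V - g W\<close>: the
    diagonal terms sum to \<open>2 * card \<U> * D\<close>, and each of the two kinds of mixed terms
    sums to the form at \<open>f\<close>.\<close>
  have "0 \<le> (\<Sum>V\<in>\<U>. \<Sum>W\<in>\<U>. Re (sesqui n M (\<lambda>x. g V x - g W x) (\<lambda>x. g V x - g W x)))"
    by (intro sum_nonneg psd)
  also have "\<dots> = 2 * (real (card \<U>) * D) - 2 * Re (sesqui n M f f)"
    unfolding sesqui_diff whole D_def
    by (simp add: sum.distrib sum_subtractf sum_distrib_left sum_negf
        sum.swap[of "\<lambda>V W. Re (sesqui n M (g W) (g V))" \<U> \<U>])
  finally have "Re (sesqui n M f f) \<le> real (card \<U>) * D"
    by simp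
  then have "2 ^ card I * Re (sesqui n M f f) \<le> 2 ^ card I * (real (card \<U>) * D)"
    by (intro mult_left_mono) auto
  then show ?thesis
    unfolding average by (simp add: mult_ac)
qed

text \<open>The kernel is the effect \<open>E\<close> pulled back along the Kraus operator
  \<open>B\<close>, so that sign changes of the key state act directly on the argument of the
  form.\<close>

lemma born_eq_sesqui:
  assumes "E \<in> carrier_mat m m" "B \<in> carrier_mat m n" "v \<in> carrier_vec n"
  shows "(E *\<^sub>v (B *\<^sub>v v)) \<bullet>c (B *\<^sub>v v) =
    sesqui n (\<lambda>x y. \<Sum>a<m. \<Sum>b<m. cnj (B $$ (a, x)) * E $$ (a, b) * B $$ (b, y)) (($) v) (($) v)"
proof -
  have Bv: "(B *\<^sub>v v) $ b = (\<Sum>y<n. B $$ (b, y) * v $ y)" if "b < m" for b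
    using that assms by (simp add: scalar_prod_def lessThan_atLeast0)
  have "(E *\<^sub>v (B *\<^sub>v v)) \<bullet>c (B *\<^sub>v v) =
      (\<Sum>a<m. (\<Sum>b<m. E $$ (a, b) * (B *\<^sub>v v) $ b) * cnj ((B *\<^sub>v v) $ a))"
    using assms by (simp add: scalar_prod_def lessThan_atLeast0)
  also have "\<dots> = (\<Sum>a<m. \<Sum>b<m. \<Sum>x<n. \<Sum>y<n.
      cnj (B $$ (a, x)) * E $$ (a, b) * B $$ (b, y) * v $ y * cnj (v $ x))"
  proof -
    have "E $$ (a, b) * (B *\<^sub>v v) $ b * cnj ((B *\<^sub>v v) $ a) = (\<Sum>x<n. \<Sum>y<n.
        cnj (B $$ (a, x)) * E $$ (a, b) * B $$ (b, y) * v $ y * cnj (v $ x))"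
      if "a < m" "b < m" for a b
      unfolding Bv[OF that(1)] Bv[OF that(2)]
      by (simp add: sum_distrib_left sum_distrib_right mult_ac) (rule sum.swap)
    then show ?thesis
      by (simp add: sum_distrib_right)
  qed
  also have "\<dots> = (\<Sum>x<n. \<Sum>y<n. \<Sum>a<m. \<Sum>b<m.
      cnj (B $$ (a, x)) * E $$ (a, b) * B $$ (b, y) * v $ y * cnj (v $ x))"
    by (rule sum_swap4)
  finally show ?thesis
    by (simp add: sesqui_def sum_distrib_right)
qed

text \<open>\<open>w H\<close> is the state for the key with the bits \<open>H\<close> flipped.
  Positivity of \<open>E\<close> makes the pulled-back form nonnegative on arbitrary functions,
  hence also on the pieces into which the state is cut.\<close>

lemma born_le_average:
  assumes E: "psd m E" and B: "B \<in> carrier_mat m n" and v: "v \<in> carrier_vec n"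
    and I: "finite I" and \<U>: "finite \<U>" "\<U> \<subseteq> Pow I"
    and U: "\<And>x. x < n \<Longrightarrow> U x \<in> \<U>"
    and w: "\<And>H. H \<subseteq> I \<Longrightarrow> w H \<in> carrier_vec n"
    and character: "\<And>H x. H \<subseteq> I \<Longrightarrow> x < n \<Longrightarrow> w H $ x = complex_of_real (character (U x) H) * v $ x"
  shows "2 ^ card I * born E (B *\<^sub>v v) \<le> real (card \<U>) * (\<Sum>H\<in>Pow I. born E (B *\<^sub>v w H))"
proof -
  define M where "M = (\<lambda>x y. \<Sum>a<m. \<Sum>b<m. cnj (B $$ (a, x)) * E $$ (a, b) * B $$ (b, y))"
  have E': "E \<in> carrier_mat m m"
    using E by (simp add: psd_def)
  have M: "born E (B *\<^sub>v v) = Re (sesqui n M (($) v) (($) v))" if "v \<in> carrier_vec n" for v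
    using born_eq_sesqui[OF E' B that] by (simp add: born_def M_def)
  have psd: "0 \<le> Re (sesqui n M f f)" for f
  proof -
    have "born E (B *\<^sub>v Matrix.vec n f) \<ge> 0"
      using E B unfolding psd_def born_def by (auto simp: less_eq_complex_def)
    also have "born E (B *\<^sub>v Matrix.vec n f) = Re (sesqui n M f f)"
      by (subst M) (auto simp: sesqui_def)
    finally show ?thesis .
  qed
  have "born E (B *\<^sub>v w H) = Re (sesqui n M (\<lambda>x. complex_of_real (character (U x) H) * v $ x)
      (\<lambda>x. complex_of_real (character (U x) H) * v $ x))" if "H \<in> Pow I" for H
    using that by (subst M) (auto simp: sesqui_def w character)
  then show ?thesis
    using psd_form_le_average[OF psd I \<U> U, where f = "($) v"] by (simp add: M[OF v])
qed

text \<open>Positions are split off one at a time. In \<open>1 + c j k\<close> only the second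
  summand invokes \<open>F_le\<close>; a change of variables then moves the flip from
  \<open>F\<close> to \<open>c j\<close>, where it is summed up to \<open>C\<close>, and the weights
  of the other positions do not notice it. In the application \<open>F\<close> is the probability of
  a fixed output, \<open>b = 2^n\<close> and \<open>D = (n + 1)^T\<close>.\<close>

lemma sum_prod_flip_bound:
  fixes F :: "'k \<Rightarrow> real" and c :: "'i \<Rightarrow> 'k \<Rightarrow> real"
  assumes "finite A" and "b > 0" "D \<ge> 0"
    and closed: "\<And>i h k. i \<in> A \<Longrightarrow> h \<in> G i \<Longrightarrow> k \<in> X \<Longrightarrow> f i h k \<in> X"
    and invol: "\<And>i h k. i \<in> A \<Longrightarrow> h \<in> G i \<Longrightarrow> k \<in> X \<Longrightarrow> f i h (f i h k) = k"
    and F: "\<And>k. k \<in> X \<Longrightarrow> 0 \<le> F k"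
    and F_le: "\<And>i k. i \<in> A \<Longrightarrow> k \<in> X \<Longrightarrow> b * F k \<le> D * (\<Sum>h\<in>G i. F (f i h k))"
    and c: "\<And>i k. i \<in> A \<Longrightarrow> k \<in> X \<Longrightarrow> 0 \<le> c i k"
    and c_inv: "\<And>i j h k. i \<in> A \<Longrightarrow> j \<in> A \<Longrightarrow> i \<noteq> j \<Longrightarrow> h \<in> G j \<Longrightarrow> k \<in> X \<Longrightarrow> c i (f j h k) = c i k"
    and c_le: "\<And>i k. i \<in> A \<Longrightarrow> k \<in> X \<Longrightarrow> (\<Sum>h\<in>G i. c i (f i h k)) \<le> C"
  shows "(\<Sum>k\<in>X. F k * (\<Prod>i\<in>A. 1 + c i k)) \<le> (1 + D * C / b) ^ card A * (\<Sum>k\<in>X. F k)"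
  using assms(1) closed invol F_le c c_inv c_le
proof (induction A rule: finite_induct)
  case (insert j A)
  define W where "W = (\<lambda>k. \<Prod>i\<in>A. 1 + c i k)"
  have W: "0 \<le> W k" if "k \<in> X" for k
    unfolding W_def using insert.prems(4) that by (intro prod_nonneg) (auto intro: add_nonneg_nonneg)
  have W_inv: "W (f j h k) = W k" if "h \<in> G j" "k \<in> X" for h k
    unfolding W_def using insert.prems(5) insert.hyps that
    by (intro prod.cong refl) (metis insertCI)
  have IH: "(\<Sum>k\<in>X. F k * W k) \<le> (1 + D * C / b) ^ card A * (\<Sum>k\<in>X. F k)"
    unfolding W_def by (rule insert.IH) (use insert.prems in auto)
  have "b * (\<Sum>k\<in>X. F k * W k * c j k) = (\<Sum>k\<in>X. b * F k * (W k * c j k))"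
    by (simp add: sum_distrib_left mult_ac)
  also have "\<dots> \<le> (\<Sum>k\<in>X. D * (\<Sum>h\<in>G j. F (f j h k)) * (W k * c j k))"
    using insert.prems W by (intro sum_mono mult_right_mono) auto
  also have "\<dots> = D * (\<Sum>h\<in>G j. \<Sum>k\<in>X. F (f j h k) * W k * c j k)"
    by (simp add: sum_distrib_left sum_distrib_right mult_ac sum.swap[of _ "G j" X])
  also have "(\<Sum>h\<in>G j. \<Sum>k\<in>X. F (f j h k) * W k * c j k) = (\<Sum>h\<in>G j. \<Sum>k\<in>X. F k * W k * c j (f j h k))"
  proof (rule sum.cong[OF refl])
    fix h assume h: "h \<in> G j"
    have "bij_betw (f j h) X X"
      by (rule bij_betwI[where g = "f j h"]) (use insert.prems(1,2) h in auto)
    then have "(\<Sum>k\<in>X. F k * W k * c j (f j h k)) =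
        (\<Sum>k\<in>X. F (f j h k) * W (f j h k) * c j (f j h (f j h k)))"
      by (rule sum.reindex_bij_betw[symmetric])
    also have "\<dots> = (\<Sum>k\<in>X. F (f j h k) * W k * c j k)"
      using insert.prems(2) W_inv h by (intro sum.cong refl) auto
    finally show "(\<Sum>k\<in>X. F (f j h k) * W k * c j k) = (\<Sum>k\<in>X. F k * W k * c j (f j h k))"
      by simp
  qed
  also have "\<dots> = (\<Sum>k\<in>X. F k * W k * (\<Sum>h\<in>G j. c j (f j h k)))"
    by (simp add: sum_distrib_left sum.swap[of _ X "G j"])
  also have "D * \<dots> \<le> D * (\<Sum>k\<in>X. F k * W k * C)"
    using insert.prems(6) F W \<open>D \<ge> 0\<close> by (intro mult_left_mono sum_mono) auto
  also have "D * (\<Sum>k\<in>X. F k * W k * C) = D * C * (\<Sum>k\<in>X. F k * W k)"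
    by (simp add: sum_distrib_left mult_ac)
  finally have "(\<Sum>k\<in>X. F k * W k * c j k) \<le> D * C / b * (\<Sum>k\<in>X. F k * W k)"
    using \<open>b > 0\<close> by (simp add: pos_le_divide_eq mult.commute)
  then have "(\<Sum>k\<in>X. F k * W k * (1 + c j k)) \<le> (1 + D * C / b) * (\<Sum>k\<in>X. F k * W k)"
    by (simp add: distrib_left distrib_right sum.distrib)
  also have "\<dots> \<le> (1 + D * C / b) * ((1 + D * C / b) ^ card A * (\<Sum>k\<in>X. F k))"
  \<comment> \<open>Multiplying the induction hypothesis needs \<open>C\<close> to be nonnegative,
    which any element of \<open>X\<close> shows; without elements both sums vanish.\<close>
  proof (cases "X = {}")
    case False
    then obtain k where k: "k \<in> X"
      by auto
    have "0 \<le> (\<Sum>h\<in>G j. c j (f j h k))"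
      using insert.prems(1,4) k by (intro sum_nonneg) auto
    also have "\<dots> \<le> C"
      using insert.prems(6) k by auto
    finally show ?thesis
      using IH \<open>b > 0\<close> \<open>D \<ge> 0\<close> by (intro mult_left_mono) auto
  qed simp
  finally show ?case
    using insert.hyps by (simp add: W_def mult_ac)
qed simp

section \<open>Flipping bits of the private key and its effect on the public key\<close>

definition flip :: "nat set \<Rightarrow> bool list \<Rightarrow> bool list" where
  "flip H x = map (\<lambda>j. if j \<in> H then \<not> x ! j else x ! j) [0..<length x]"

definition flip_key :: "nat \<Rightarrow> nat set \<Rightarrow> bool list list \<Rightarrow> bool list list" where
  "flip_key i H k = k[i := flip H (k ! i)]"

lemma length_flip [simp]: "length (flip H x) = length x"
  by (simp add: flip_def)

lemma nth_flip: "j < length x \<Longrightarrow> flip H x ! j \<longleftrightarrow> (if j \<in> H then \<not> x ! j else x ! j)"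
  by (simp add: flip_def)

lemma flip_flip [simp]: "flip H (flip H x) = x"
  by (rule nth_equalityI) (auto simp: nth_flip)

lemma length_flip_key [simp]: "length (flip_key i H k) = length k"
  by (simp add: flip_key_def)

lemma nth_flip_key:
  "j < length k \<Longrightarrow> flip_key i H k ! j = (if i = j then flip H (k ! j) else k ! j)"
  by (simp add: flip_key_def)

lemma flip_key_flip_key [simp]: "flip_key i H (flip_key i H k) = k"
  by (rule nth_equalityI) (auto simp: nth_flip_key)

lemma map_length_flip_key [simp]: "map length (flip_key i H k) = map length k"
  by (rule nth_equalityI) (auto simp: nth_flip_key)

lemma dim_fingerprint [simp]: "dim_vec (fingerprint x) = length x"
  by (simp add: fingerprint_def)

lemma fingerprint_flip:
  "j < length x \<Longrightarrow> fingerprint (flip H x) $ j = (if j \<in> H then -1 else 1) * fingerprint x $ j"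
  by (simp add: fingerprint_def nth_flip)

lemma fingerprint_norm:
  assumes "x \<noteq> []"
  shows "fingerprint x \<bullet>c fingerprint x = 1"
proof -
  have "fingerprint x $ j * cnj (fingerprint x $ j) = complex_of_real (1 / real (length x))"
    if "j < length x" for j
  proof -
    have "complex_of_real (1 / sqrt (real (length x))) * complex_of_real (1 / sqrt (real (length x)))
        = complex_of_real (1 / real (length x))"
      unfolding of_real_mult[symmetric] by simp
    then show ?thesis
      using that by (simp add: fingerprint_def)
  qed
  then have "fingerprint x \<bullet>c fingerprint x = (\<Sum>j<length x. complex_of_real (1 / real (length x)))"
    by (simp add: scalar_prod_def lessThan_atLeast0)
  then show ?thesis
    using assms by simp
qed

lemma div_mod_less_mult:
  fixes x m n :: nat
  assumes "x < m * n"
  shows "x div n < m" "x mod n < n"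
proof -
  have "0 < n"
    using assms by (cases n) auto
  then show "x div n < m" "x mod n < n"
    using assms by (simp_all add: less_mult_imp_div_less)
qed

lemma dim_public_key: "dim_vec (public_key k) = prod_list (map length k)"
  by (simp add: public_key_def dim_tensor_vecs comp_def)

text \<open>A coordinate \<open>x\<close> of the tensor product is a string of digits, and
  \<open>dg x\<close> is its digit at position \<open>i\<close>. It is chosen before
  \<open>H\<close>, so one classification of the coordinates serves all flips.\<close>

lemma public_key_flip:
  "i < length k \<Longrightarrow> \<exists>dg. \<forall>H x. x < dim_vec (public_key k) \<longrightarrow>
    public_key (flip_key i H k) $ x = (if dg x \<in> H then -1 else 1) * public_key k $ x"
proof (induction k arbitrary: i)
  case (Cons a k)
  let ?D = "dim_vec (public_key k)"
  have Cons_key: "public_key (a # k) = tensor_vec (fingerprint a) (public_key k)" for a k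
    by (simp add: public_key_def)
  have bounds: "x div ?D < length a" "x mod ?D < ?D" if "x < length a * ?D" for x
    using div_mod_less_mult[OF that] .
  show ?case
  proof (cases i)
    case 0
    have "public_key (flip_key 0 H (a # k)) $ x =
        (if x div ?D \<in> H then -1 else 1) * public_key (a # k) $ x"
      if "x < dim_vec (public_key (a # k))" for H x
      using that bounds[of x]
      by (simp add: Cons_key flip_key_def tensor_vec_index fingerprint_flip)
    then show ?thesis
      unfolding 0 by (intro exI[of _ "\<lambda>x. x div ?D"]) blast
  next
    case (Suc i')
    then have "i' < length k"
      using Cons.prems by simp
    then obtain dg where dg: "\<And>H x. x < ?D \<Longrightarrow>
        public_key (flip_key i' H k) $ x = (if dg x \<in> H then -1 else 1) * public_key k $ x"
      using Cons.IH by blast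
    have dim: "dim_vec (public_key (flip_key i' H k)) = ?D" for H
      by (simp add: dim_public_key)
    have "public_key (flip_key i H (a # k)) $ x =
        (if dg (x mod ?D) \<in> H then -1 else 1) * public_key (a # k) $ x"
      if "x < dim_vec (public_key (a # k))" for H x
    proof -
      have "flip_key i H (a # k) = a # flip_key i' H k"
        by (simp add: flip_key_def Suc)
      then show ?thesis
        using that bounds[of x] by (simp add: Cons_key tensor_vec_index dim dg)
    qed
    then show ?thesis
      by (intro exI[of _ "\<lambda>x. dg (x mod ?D)"]) blast
  qed
qed simp

text \<open>A coordinate of the tensor power is a product of \<open>T\<close> coordinates, so its
  character belongs to the symmetric difference of \<open>T\<close> members of
  \<open>\<V>\<close>.\<close>

lemma tensor_power_character:
  fixes w :: "nat set \<Rightarrow> complex Matrix.vec"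
  assumes dim: "\<And>H. H \<subseteq> I \<Longrightarrow> dim_vec (w H) = dim_vec u"
    and I: "finite I" and \<V>: "finite \<V>" "\<V> \<subseteq> Pow I"
    and V: "\<And>x. x < dim_vec u \<Longrightarrow> V x \<in> \<V>"
    and w: "\<And>H x. H \<subseteq> I \<Longrightarrow> x < dim_vec u \<Longrightarrow> w H $ x = complex_of_real (character (V x) H) * u $ x"
  shows "\<exists>\<U> U. finite \<U> \<and> \<U> \<subseteq> Pow I \<and> card \<U> \<le> card \<V> ^ T \<and>
    (\<forall>x < dim_vec (tensor_vecs (replicate T u)). U x \<in> \<U> \<and> (\<forall>H \<subseteq> I.
      tensor_vecs (replicate T (w H)) $ x =
        complex_of_real (character (U x) H) * tensor_vecs (replicate T u) $ x))"
proof (induction T)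
  case 0
  show ?case
    by (rule exI[of _ "{{}}"], rule exI[of _ "\<lambda>_. {}"]) simp
next
  case (Suc T)
  let ?D = "dim_vec (tensor_vecs (replicate T u))"
  from Suc obtain \<U> U where \<U>: "finite \<U>" "\<U> \<subseteq> Pow I" "card \<U> \<le> card \<V> ^ T"
    and all: "\<forall>x < ?D. U x \<in> \<U> \<and> (\<forall>H \<subseteq> I. tensor_vecs (replicate T (w H)) $ x =
        complex_of_real (character (U x) H) * tensor_vecs (replicate T u) $ x)"
    by (elim exE conjE) (rule that)
  have U: "U x \<in> \<U>" if "x < ?D" for x
    using all[rule_format, OF that] by (rule conjunct1)
  have character: "tensor_vecs (replicate T (w H)) $ x =
        complex_of_real (character (U x) H) * tensor_vecs (replicate T u) $ x"
    if "x < ?D" "H \<subseteq> I" for x H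
    using all[rule_format, OF that(1), THEN conjunct2, rule_format, OF that(2)] .
  define \<U>' where "\<U>' = (\<lambda>(a, b). sym_diff a b) ` (\<V> \<times> \<U>)"
  define U' where "U' = (\<lambda>x. sym_diff (V (x div ?D)) (U (x mod ?D)))"
  have "card \<U>' \<le> card (\<V> \<times> \<U>)"
    unfolding \<U>'_def using \<V> \<U> by (intro card_image_le) auto
  also have "\<dots> \<le> card \<V> ^ Suc T"
    using \<U> by (simp add: card_cartesian_product)
  finally have card: "card \<U>' \<le> card \<V> ^ Suc T" .
  have dim': "dim_vec (tensor_vecs (replicate T (w H))) = ?D" if "H \<subseteq> I" for H
    by (simp add: dim_tensor_vecs dim that)
  have "U' x \<in> \<U>' \<and> (\<forall>H \<subseteq> I. tensor_vecs (replicate (Suc T) (w H)) $ x =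
      complex_of_real (character (U' x) H) * tensor_vecs (replicate (Suc T) u) $ x)"
    if x: "x < dim_vec (tensor_vecs (replicate (Suc T) u))" for x
  proof -
    from x have x: "x < dim_vec u * ?D"
      by simp
    then have x': "x div ?D < dim_vec u" "x mod ?D < ?D"
      by (rule div_mod_less_mult)+
    have fin: "finite (V (x div ?D))" "finite (U (x mod ?D))"
      using V[OF x'(1)] U[OF x'(2)] \<V> \<U> I by (auto intro: finite_subset)
    show ?thesis
    proof (intro conjI allI impI)
      show "U' x \<in> \<U>'"
        unfolding \<U>'_def U'_def using V[OF x'(1)] U[OF x'(2)]
        by (intro image_eqI[of _ _ "(V (x div ?D), U (x mod ?D))"]) simp_all
      fix H assume "H \<subseteq> I"
      then show "tensor_vecs (replicate (Suc T) (w H)) $ x =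
          complex_of_real (character (U' x) H) * tensor_vecs (replicate (Suc T) u) $ x"
        using x x' fin
        by (simp add: U'_def tensor_vec_index dim dim' w character character_sym_diff_left)
    qed
  qed
  moreover have "finite \<U>'"
    unfolding \<U>'_def using \<V> \<U> by (intro finite_imageI finite_cartesian_product)
  moreover have "\<U>' \<subseteq> Pow I"
    using \<V> \<U> by (auto simp: \<U>'_def)
  ultimately show ?case
    using card by (intro exI[of _ \<U>'] exI[of _ U'] conjI allI impI) simp_all
qed

lemma dim_public_key_copies: "dim_vec (public_key_copies T k) = prod_list (map length k) ^ T"
  by (simp add: public_key_copies_def dim_tensor_vecs dim_public_key)

lemma born_public_key_le_average:
  assumes i: "i < length k" and I: "finite I"
    and E: "psd m E" and B: "B \<in> carrier_mat m (prod_list (map length k) ^ T)"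
  shows "2 ^ card I * born E (B *\<^sub>v public_key_copies T k) \<le>
    (1 + real (card I)) ^ T * (\<Sum>H\<in>Pow I. born E (B *\<^sub>v public_key_copies T (flip_key i H k)))"
proof -
  obtain dg where dg: "\<And>H x. x < dim_vec (public_key k) \<Longrightarrow>
      public_key (flip_key i H k) $ x = (if dg x \<in> H then -1 else 1) * public_key k $ x"
    using public_key_flip[OF i] by blast
  \<comment> \<open>One copy feels a flip only through the digit \<open>dg x\<close>: a digit in
    \<open>I\<close> gives a singleton, every other digit the trivial character. Hence
    \<open>1 + card I\<close> classes.\<close>
  define \<V> where "\<V> = insert {} ((\<lambda>j. {j}) ` I)"
  define V where "V = (\<lambda>x. {dg x} \<inter> I)"
  let ?n = "prod_list (map length k) ^ T"
  have "\<exists>\<U> U. finite \<U> \<and> \<U> \<subseteq> Pow I \<and> card \<U> \<le> card \<V> ^ T \<and>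
      (\<forall>x < dim_vec (tensor_vecs (replicate T (public_key k))). U x \<in> \<U> \<and> (\<forall>H \<subseteq> I.
        tensor_vecs (replicate T (public_key (flip_key i H k))) $ x =
          complex_of_real (character (U x) H) * tensor_vecs (replicate T (public_key k)) $ x))"
  proof (rule tensor_power_character[where V = V])
    show "public_key (flip_key i H k) $ x = complex_of_real (character (V x) H) * public_key k $ x"
      if "H \<subseteq> I" "x < dim_vec (public_key k)" for H x
    proof -
      have "{dg x} \<inter> I \<inter> H = (if dg x \<in> H then {dg x} else {})"
        using that by auto
      then show ?thesis
        using that by (simp add: dg V_def character_def)
    qed
  qed (use I in \<open>auto simp: dim_public_key \<V>_def V_def\<close>)
  then obtain \<U> U where \<U>: "finite \<U>" "\<U> \<subseteq> Pow I" "card \<U> \<le> card \<V> ^ T"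
    and all: "\<forall>x < ?n. U x \<in> \<U> \<and> (\<forall>H \<subseteq> I. public_key_copies T (flip_key i H k) $ x =
        complex_of_real (character (U x) H) * public_key_copies T k $ x)"
    unfolding public_key_copies_def[symmetric] dim_public_key_copies
    by (elim exE conjE) (rule that)
  have U: "U x \<in> \<U>" if "x < ?n" for x
    using all[rule_format, OF that] by (rule conjunct1)
  have character: "public_key_copies T (flip_key i H k) $ x =
        complex_of_real (character (U x) H) * public_key_copies T k $ x"
    if "H \<subseteq> I" "x < ?n" for H x
    using all[rule_format, OF that(2), THEN conjunct2, rule_format, OF that(1)] .
  have "card \<V> \<le> 1 + card I"
    unfolding \<V>_def using I by (subst card_insert_disjoint) (auto simp: card_image)
  then have "card \<V> ^ T \<le> (1 + card I) ^ T"
    by (intro power_mono) auto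
  with \<U> have "card \<U> \<le> (1 + card I) ^ T"
    by linarith
  then have card: "real (card \<U>) \<le> (1 + real (card I)) ^ T"
    by (metis of_nat_1 of_nat_add of_nat_le_iff of_nat_power)
  have carrier: "public_key_copies T (flip_key i H k) \<in> carrier_vec ?n" for H
    by (rule carrier_vecI) (simp add: dim_public_key_copies)
  have "2 ^ card I * born E (B *\<^sub>v public_key_copies T k) \<le>
      real (card \<U>) * (\<Sum>H\<in>Pow I. born E (B *\<^sub>v public_key_copies T (flip_key i H k)))"
    using E B carrier_vecI[OF dim_public_key_copies] I \<U>(1,2) U carrier character
    by (rule born_le_average)
  also have "\<dots> \<le> (1 + real (card I)) ^ T * (\<Sum>H\<in>Pow I. born E (B *\<^sub>v public_key_copies T (flip_key i H k)))"
  proof (intro mult_right_mono card sum_nonneg)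
    fix H
    have "B *\<^sub>v public_key_copies T (flip_key i H k) \<in> carrier_vec m"
      using B carrier by (rule mult_mat_vec_carrier)
    then show "0 \<le> born E (B *\<^sub>v public_key_copies T (flip_key i H k))"
      using E unfolding psd_def born_def by (auto simp: less_eq_complex_def)
  qed
  finally show ?thesis .
qed

section \<open>The verification test\<close>

lemma nths_eq_iff:
  assumes "length x = length y"
  shows "nths x A = nths y A \<longleftrightarrow> (\<forall>j<length x. j \<in> A \<longrightarrow> x ! j = y ! j)"
  using assms
proof (induction x y arbitrary: A rule: list_induct2)
  case (Cons a x b y)
  have "nths x A = nths y A \<Longrightarrow> length (nths x A) = length (nths y A)" for A
    by simp
  then show ?case
    using Cons.IH[of "{j. Suc j \<in> A}"] by (auto simp: nths_Cons All_less_Suc2)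
qed simp

lemma nths_surj:
  fixes x \<kappa> :: "'a list"
  assumes "length (nths x A) = length \<kappa>"
  shows "\<exists>y. length y = length x \<and> nths y A = \<kappa>"
  using assms
proof (induction x arbitrary: A \<kappa>)
  case (Cons a x)
  let ?A = "{j. Suc j \<in> A}"
  show ?case
  proof (cases "0 \<in> A")
    case True
    then obtain b \<kappa>' where \<kappa>: "\<kappa> = b # \<kappa>'"
      using Cons.prems by (cases \<kappa>) (auto simp: nths_Cons)
    then obtain y where "length y = length x" "nths y ?A = \<kappa>'"
      using Cons.IH[of ?A \<kappa>'] Cons.prems True by (auto simp: nths_Cons)
    then show ?thesis
      using True \<kappa> by (intro exI[of _ "b # y"]) (simp add: nths_Cons)
  next
    case False
    then obtain y where "length y = length x" "nths y ?A = \<kappa>"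
      using Cons.IH[of ?A \<kappa>] Cons.prems by (auto simp: nths_Cons)
    then show ?thesis
      using False by (intro exI[of _ "a # y"]) (simp add: nths_Cons)
  qed
qed simp

text \<open>The generating function of the number of failures in independent trials,
  \<open>q i\<close> being the chance to pass trial \<open>i\<close>; splitting off the first trial
  factors it.\<close>

lemma sum_lists_prod_power:
  fixes q :: "nat \<Rightarrow> real"
  shows "(\<Sum>bs\<in>{bs. length bs = N}. z ^ count_list bs False *
      (\<Prod>i<N. if bs ! i then q i else 1 - q i)) = (\<Prod>i<N. q i + z * (1 - q i))"
proof (induction N arbitrary: q)
  case 0
  have "{bs::bool list. length bs = 0} = {[]}"
    by auto
  then show ?case by simp
next
  case (Suc N)
  let ?L = "{bs::bool list. length bs = N}"
  let ?h = "\<lambda>bs. z ^ count_list bs False * (\<Prod>i<N. if bs ! i then q (Suc i) else 1 - q (Suc i))"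
  have "{bs::bool list. length bs = Suc N} = (\<lambda>x. fst x # snd x) ` (UNIV \<times> ?L)"
  proof -
    have "{bs::bool list. length bs = Suc N} = (\<lambda>(b, bs). b # bs) ` (UNIV \<times> ?L)"
      by (auto simp: length_Suc_conv)
    then show ?thesis
      by (simp add: case_prod_beta')
  qed
  moreover have "inj_on (\<lambda>x. fst x # snd x) (UNIV \<times> ?L)"
    by (auto simp: inj_on_def)
  ultimately have "(\<Sum>bs\<in>{bs. length bs = Suc N}. z ^ count_list bs False *
      (\<Prod>i<Suc N. if bs ! i then q i else 1 - q i)) =
      (\<Sum>(b, bs)\<in>UNIV \<times> ?L. (if b then q 0 else z * (1 - q 0)) * ?h bs)"
    by (simp add: sum.reindex prod.lessThan_Suc_shift case_prod_beta mult_ac del: prod.lessThan_Suc)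
       (auto intro!: sum.cong simp: mult_ac)
  also have "\<dots> = (\<Sum>b\<in>UNIV. \<Sum>bs\<in>?L. (if b then q 0 else z * (1 - q 0)) * ?h bs)"
    by (simp add: sum.cartesian_product)
  also have "\<dots> = (q 0 + z * (1 - q 0)) * (\<Sum>bs\<in>?L. ?h bs)"
    by (simp add: UNIV_bool sum_distrib_left distrib_right)
  also have "\<dots> = (\<Prod>i<Suc N. q i + z * (1 - q i))"
    unfolding Suc.IH by (simp add: prod.lessThan_Suc_shift del: prod.lessThan_Suc)
  finally show ?case .
qed

lemma sum_lists_prod:
  fixes q :: "nat \<Rightarrow> real"
  shows "(\<Sum>bs\<in>{bs. length bs = N}. \<Prod>i<N. if bs ! i then q i else 1 - q i) = 1"
  using sum_lists_prod_power[where z = 1] by simp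

definition pass_prob :: "qsig \<Rightarrow> nat \<Rightarrow> bool list \<Rightarrow> bool list \<Rightarrow> real" where
  "pass_prob Q s \<kappa> x = (cmod (fingerprint x \<bullet>c check_vec Q s \<kappa>))\<^sup>2"

lemma dim_check_vec [simp]: "dim_vec (check_vec Q s \<kappa>) = qs_d Q"
  by (simp add: check_vec_def normalize_vec_def)

lemma born_verif_effect:
  assumes k: "length k = qs_N Q" "\<And>x. x \<in> set k \<Longrightarrow> length x = qs_d Q" and "qs_d Q > 0"
  shows "born (verif_effect Q m r bs) (public_key k) =
    (\<Prod>i<qs_N Q. let q = pass_prob Q (qs_enc Q m ! i) (r ! i) (k ! i) in if bs ! i then q else 1 - q)"
proof -
  define E where "E = (\<lambda>i. let P = ket_bra (check_vec Q (qs_enc Q m ! i) (r ! i))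
     in if bs ! i then P else 1\<^sub>m (qs_d Q) - P)"
  have len: "length (k ! i) = qs_d Q" if "i < qs_N Q" for i
    using that k by simp
  have pk: "public_key k = tensor_vecs (map (\<lambda>i. fingerprint (k ! i)) [0..<qs_N Q])"
    unfolding public_key_def k(1)[symmetric] by (simp add: map_nth flip: map_map[unfolded comp_def])
  have "ket_bra (check_vec Q s \<kappa>) \<in> carrier_mat (qs_d Q) (qs_d Q)" for s \<kappa>
    using ket_bra_carrier[of "check_vec Q s \<kappa>"] by simp
  then have "E i \<in> carrier_mat (qs_d Q) (qs_d Q)" for i
    unfolding E_def Let_def using minus_carrier_mat by (metis)
  then have all: "list_all2 (\<lambda>A v. A \<in> carrier_mat (dim_vec v) (dim_vec v)) (map E [0..<qs_N Q])
      (map (\<lambda>i. fingerprint (k ! i)) [0..<qs_N Q])"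
    by (simp add: list_all2_conv_all_nth len)
  have one: "(E i *\<^sub>v fingerprint (k ! i)) \<bullet>c fingerprint (k ! i) = complex_of_real
      (let q = pass_prob Q (qs_enc Q m ! i) (r ! i) (k ! i) in if bs ! i then q else 1 - q)"
    if i: "i < qs_N Q" for i
  proof -
    have d: "dim_vec (check_vec Q (qs_enc Q m ! i) (r ! i)) = dim_vec (fingerprint (k ! i))"
      by (simp add: len i)
    have "k ! i \<noteq> []"
      using len[OF i] \<open>qs_d Q > 0\<close> by auto
    then show ?thesis
      using ket_bra_born[OF d] one_minus_ket_bra_born[OF d fingerprint_norm]
      by (simp add: E_def pass_prob_def len i Let_def)
  qed
  have "(tensor_mats (map E [0..<qs_N Q]) *\<^sub>v public_key k) \<bullet>c public_key k =
      prod_list (map (\<lambda>i. (E i *\<^sub>v fingerprint (k ! i)) \<bullet>c fingerprint (k ! i)) [0..<qs_N Q])"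
    unfolding pk using tensor_mats_mult_tensor_vecs[OF all] by (simp add: map2_map_map)
  also have "\<dots> = (\<Prod>i<qs_N Q. (E i *\<^sub>v fingerprint (k ! i)) \<bullet>c fingerprint (k ! i))"
    by (simp add: prod.list_conv_set_nth lessThan_atLeast0)
  also have "\<dots> = complex_of_real (\<Prod>i<qs_N Q.
      let q = pass_prob Q (qs_enc Q m ! i) (r ! i) (k ! i) in if bs ! i then q else 1 - q)"
    by (simp add: one)
  finally show ?thesis
    unfolding born_def verif_effect_def E_def by (simp only: Re_complex_of_real)
qed

lemma verif_prob_eq:
  assumes "length k = qs_N Q" "\<And>x. x \<in> set k \<Longrightarrow> length x = qs_d Q" and "qs_d Q > 0"
  shows "verif_prob Q (public_key k) m r V =
    (\<Sum>bs \<in> {bs. length bs = qs_N Q \<and> verdict_of Q (count_list bs False) \<in> V}. \<Prod>i<qs_N Q.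
      if bs ! i then pass_prob Q (qs_enc Q m ! i) (r ! i) (k ! i)
      else 1 - pass_prob Q (qs_enc Q m ! i) (r ! i) (k ! i))"
  unfolding verif_prob_def by (simp add: born_verif_effect[OF assms] Let_def)

text \<open>Markov's inequality for \<open>z\<close> raised to the number of failures. It serves
  both tails: \<open>z \<le> 1\<close> for forgeries with too few failures, \<open>z >= 1\<close>
  for honest signatures with too many.\<close>

lemma sum_restricted_le:
  fixes q :: "nat \<Rightarrow> real"
  assumes q: "\<And>i. i < N \<Longrightarrow> 0 \<le> q i \<and> q i \<le> 1" and z: "0 < z"
    and A: "A \<subseteq> {bs. length bs = N}"
    and large: "\<And>bs. bs \<in> A \<Longrightarrow> z powr a \<le> z ^ count_list bs False"
  shows "(\<Sum>bs\<in>A. \<Prod>i<N. if bs ! i then q i else 1 - q i) \<le>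
    z powr (- a) * (\<Prod>i<N. q i + z * (1 - q i))"
proof -
  let ?p = "\<lambda>bs. \<Prod>i<N. if bs ! i then q i else 1 - q i"
  have fin: "finite {bs :: bool list. length bs = N}"
    using finite_lists_length_eq[of "UNIV :: bool set" N] by simp
  have p: "0 \<le> ?p bs" for bs
    using q by (intro prod_nonneg) auto
  have "(\<Sum>bs\<in>A. ?p bs) \<le> (\<Sum>bs\<in>A. z powr (- a) * (z ^ count_list bs False * ?p bs))"
  proof (rule sum_mono)
    fix bs assume "bs \<in> A"
    then have "1 \<le> z powr (- a) * z ^ count_list bs False"
      using large[of bs] z by (simp add: powr_minus field_simps)
    from mult_right_mono[OF this p[of bs]]
    show "?p bs \<le> z powr (- a) * (z ^ count_list bs False * ?p bs)"
      by (simp add: mult.assoc)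
  qed
  also have "\<dots> \<le> (\<Sum>bs\<in>{bs. length bs = N}. z powr (- a) * (z ^ count_list bs False * ?p bs))"
    using z p by (intro sum_mono2 fin A) auto
  also have "\<dots> = z powr (- a) * (\<Prod>i<N. q i + z * (1 - q i))"
    by (simp add: sum_lists_prod_power flip: sum_distrib_left)
  finally show ?thesis .
qed

section \<open>Hidden blocks and the pass probability at a single position\<close>

locale signature_scheme =
  fixes Q :: qsig
  assumes S_ge_2: "2 \<le> qs_S Q" and d_pos: "0 < qs_d Q" and S_dvd_d: "qs_S Q dvd qs_d Q"
begin

abbreviation (input) d where "d \<equiv> qs_d Q"
abbreviation (input) n where "n \<equiv> qs_d Q div qs_S Q"

lemma n_mult_S: "n * qs_S Q = d"
  using S_dvd_d by simp

lemma n_pos: "0 < n"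
  using n_mult_S d_pos by (metis gr0I mult_0)

lemma n_less_d: "n < d"
proof -
  have "n * 1 < n * qs_S Q"
    using n_pos S_ge_2 by (intro mult_strict_left_mono) auto
  then show ?thesis
    by (simp add: n_mult_S)
qed

lemma ell_eq: "ell Q = d - n"
  by (simp add: ell_def)

lemma ell_pos: "0 < ell Q"
  using n_less_d by (simp add: ell_def)

lemma hidden_eq: "hidden Q s = {s * n..<s * n + n}"
  using n_less_d by (simp add: hidden_def ell_eq algebra_simps)

lemma hidden_subset: "s < qs_S Q \<Longrightarrow> hidden Q s \<subseteq> {..<d}"
proof -
  assume "s < qs_S Q"
  then have "(s + 1) * n \<le> qs_S Q * n"
    by (intro mult_le_mono1) simp
  then show ?thesis
    using n_mult_S by (auto simp: hidden_eq algebra_simps)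
qed

lemma card_hidden [simp]: "card (hidden Q s) = n"
  by (simp add: hidden_eq)

lemma finite_hidden [simp]: "finite (hidden Q s)"
  by (simp add: hidden_eq)

lemma hidden_disjoint: "s \<noteq> s' \<Longrightarrow> hidden Q s \<inter> hidden Q s' = {}"
proof -
  have "hidden Q s \<inter> hidden Q s' = {}" if "s < s'" for s s'
  proof -
    have "s * n + n \<le> s' * n"
      using that mult_le_mono1[of "Suc s" s' n] by simp
    then show ?thesis
      by (auto simp: hidden_eq)
  qed
  then show "s \<noteq> s' \<Longrightarrow> hidden Q s \<inter> hidden Q s' = {}"
    by (metis Int_commute linorder_neqE_nat)
qed

lemma card_visible:
  assumes "s < qs_S Q"
  shows "card ({..<d} - hidden Q s) = ell Q"
  using hidden_subset[OF assms] by (simp add: card_Diff_subset ell_eq)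

lemma length_revealed:
  assumes "length x = d" "s < qs_S Q"
  shows "length (revealed Q s x) = ell Q"
proof -
  have "{i. i < d \<and> i \<in> {..<d} - hidden Q s} = {..<d} - hidden Q s"
    by auto
  then show ?thesis
    using assms card_visible by (simp add: revealed_def length_nths)
qed

lemma revealed_eq_iff:
  assumes "length x = d" "length y = d"
  shows "revealed Q s x = revealed Q s y \<longleftrightarrow> (\<forall>j<d. j \<notin> hidden Q s \<longrightarrow> x ! j = y ! j)"
  using assms by (auto simp: revealed_def nths_eq_iff)

lemma ex_revealed:
  assumes "length \<kappa> = ell Q" "s < qs_S Q"
  obtains y where "length y = d" "revealed Q s y = \<kappa>"
proof -
  have "length (nths (replicate d False) ({..<d} - hidden Q s)) = length \<kappa>"
    using length_revealed[of "replicate d False"] assms by (simp add: revealed_def)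
  from nths_surj[OF this] show ?thesis
    using that by (auto simp: revealed_def)
qed

lemma revealed_flip:
  assumes "length x = d" "H \<subseteq> hidden Q s"
  shows "revealed Q s (flip H x) = revealed Q s x"
  using assms by (subst revealed_eq_iff) (auto simp: nth_flip)

text \<open>Parametrizes the keys summed in \<open>check_vec\<close> by subsets of the hidden block,
  which turns that sum into a sum of characters.\<close>

lemma consistent_keys:
  assumes y: "length y = d" and s: "s < qs_S Q"
  shows "bij_betw (\<lambda>H. flip H y) (Pow (hidden Q s)) {x. length x = d \<and> revealed Q s x = revealed Q s y}"
proof (rule bij_betwI[where g = "\<lambda>x. {j. j < d \<and> x ! j \<noteq> y ! j}"])
  show "(\<lambda>H. flip H y) \<in> Pow (hidden Q s) \<rightarrow> {x. length x = d \<and> revealed Q s x = revealed Q s y}"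
    using y revealed_flip by auto
  show "(\<lambda>x. {j. j < d \<and> x ! j \<noteq> y ! j}) \<in>
      {x. length x = d \<and> revealed Q s x = revealed Q s y} \<rightarrow> Pow (hidden Q s)"
    using y by (auto simp: revealed_eq_iff)
  show "{j. j < d \<and> flip H y ! j \<noteq> y ! j} = H" if "H \<in> Pow (hidden Q s)" for H
    using that hidden_subset[OF s] y by (auto simp: nth_flip split: if_splits)
  show "flip {j. j < d \<and> x ! j \<noteq> y ! j} y = x"
    if "x \<in> {x. length x = d \<and> revealed Q s x = revealed Q s y}" for x
    by (rule nth_equalityI) (use that y in \<open>auto simp: nth_flip\<close>)
qed

text \<open>At a hidden coordinate the signs of the consistent keys cancel; elsewhere all
  \<open>2 ^ n\<close> of them agree. What remains is a sign vector on \<open>ell Q\<close>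
  coordinates, and normalization removes the common factor.\<close>

lemma check_vec_eq:
  assumes y: "length y = d" and s: "s < qs_S Q"
  shows "check_vec Q s (revealed Q s y) = Matrix.vec d (\<lambda>j. if j \<in> hidden Q s then 0
    else complex_of_real ((if y ! j then -1 else 1) / sqrt (real (ell Q))))"
proof -
  define w where "w = Matrix.vec d (\<lambda>j. if j \<in> hidden Q s then 0 else
    complex_of_real (2 ^ n * (if y ! j then -1 else 1) / sqrt (real d)))"
  have "Matrix.vec d (\<lambda>j. \<Sum>k'\<in>{k'. length k' = d \<and> revealed Q s k' = revealed Q s y}.
      fingerprint k' $ j) = w"
  proof (rule eq_vecI)
    fix j assume "j < dim_vec w"
    then have j: "j < d"
      by (simp add: w_def)
    have "(\<Sum>k'\<in>{k'. length k' = d \<and> revealed Q s k' = revealed Q s y}. fingerprint k' $ j) =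
        (\<Sum>H\<in>Pow (hidden Q s). fingerprint (flip H y) $ j)"
      by (rule sum.reindex_bij_betw[OF consistent_keys[OF y s], symmetric])
    also have "\<dots> = (\<Sum>H\<in>Pow (hidden Q s). complex_of_real (character ({j} \<inter> hidden Q s) H) *
        fingerprint y $ j)"
    proof (rule sum.cong[OF refl])
      fix H assume "H \<in> Pow (hidden Q s)"
      then have "{j} \<inter> hidden Q s \<inter> H = (if j \<in> H then {j} else {})"
        by auto
      then show "fingerprint (flip H y) $ j =
          complex_of_real (character ({j} \<inter> hidden Q s) H) * fingerprint y $ j"
        using j y by (simp add: fingerprint_flip character_def)
    qed
    also have "\<dots> = complex_of_real (\<Sum>H\<in>Pow (hidden Q s). character ({j} \<inter> hidden Q s) H) *
        fingerprint y $ j"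
      by (simp add: sum_distrib_right)
    also have "(\<Sum>H\<in>Pow (hidden Q s). character ({j} \<inter> hidden Q s) H) =
        (if j \<in> hidden Q s then 0 else 2 ^ n)"
      using sum_character_eq_0[of "hidden Q s" "{j} \<inter> hidden Q s"]
      by (simp add: card_Pow)
    finally show "Matrix.vec d (\<lambda>j. \<Sum>k'\<in>{k'. length k' = d \<and> revealed Q s k' = revealed Q s y}.
        fingerprint k' $ j) $ j = w $ j"
      using j y by (simp add: w_def fingerprint_def)
  qed (simp add: w_def)
  moreover have "w \<bullet>c w = complex_of_real ((2 ^ n)\<^sup>2 * real (ell Q) / real d)"
  proof -
    have "w \<bullet>c w = complex_of_real (\<Sum>j<d. (cmod (w $ j))\<^sup>2)"
      unfolding cinner_self_real by (simp add: w_def)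
    also have "(\<Sum>j<d. (cmod (w $ j))\<^sup>2) = (\<Sum>j\<in>{..<d} - hidden Q s. (2 ^ n)\<^sup>2 / real d)"
      using d_pos by (intro sum.mono_neutral_cong_right)
        (auto simp: w_def norm_mult norm_divide norm_power power_divide power_mult_distrib
          simp del: of_real_mult of_real_divide)
    finally show ?thesis
      by (simp add: card_visible[OF s])
  qed
  ultimately have "check_vec Q s (revealed Q s y) =
      complex_of_real (1 / sqrt ((2 ^ n)\<^sup>2 * real (ell Q) / real d)) \<cdot>\<^sub>v w"
    by (simp add: check_vec_def normalize_vec_def)
  also have "sqrt ((2 ^ n)\<^sup>2 * real (ell Q) / real d) = 2 ^ n * sqrt (real (ell Q)) / sqrt (real d)"
    by (simp add: real_sqrt_mult real_sqrt_divide)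
  finally have check: "check_vec Q s (revealed Q s y) =
      complex_of_real (1 / (2 ^ n * sqrt (real (ell Q)) / sqrt (real d))) \<cdot>\<^sub>v w" .
  have scale: "1 / (2 ^ n * sqrt (real (ell Q)) / sqrt (real d)) * (2 ^ n * a / sqrt (real d)) =
      a / sqrt (real (ell Q))" for a
    using d_pos ell_pos by (simp add: field_simps)
  show ?thesis
    unfolding check
  proof (rule eq_vecI)
    fix j assume "j < dim_vec (Matrix.vec d (\<lambda>j. if j \<in> hidden Q s then 0
        else complex_of_real ((if y ! j then -1 else 1) / sqrt (real (ell Q)))))"
    then have j: "j < d"
      by simp
    then show "(complex_of_real (1 / (2 ^ n * sqrt (real (ell Q)) / sqrt (real d))) \<cdot>\<^sub>v w) $ j =
        Matrix.vec d (\<lambda>j. if j \<in> hidden Q s then 0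
          else complex_of_real ((if y ! j then -1 else 1) / sqrt (real (ell Q)))) $ j"
      by (cases "j \<in> hidden Q s") (simp_all only: w_def dim_vec index_smult_vec index_vec
          if_True if_False mult_zero_right of_real_mult[symmetric] scale)
  qed (simp add: w_def)
qed

text \<open>The overlap is a sum of \<open>ell Q\<close> signs, negative at the mismatches, divided
  by \<open>sqrt (ell Q * d)\<close>. Without mismatches it leaves \<open>ell Q / d\<close>, so even
  an honest signature fails at a position with probability \<open>1 / S\<close>.\<close>

lemma pass_prob_eq:
  assumes x: "length x = d" and y: "length y = d" and s: "s < qs_S Q"
  shows "pass_prob Q s (revealed Q s y) x =
    (real (ell Q) - 2 * real (card {j. j < d \<and> j \<notin> hidden Q s \<and> y ! j \<noteq> x ! j}))\<^sup>2
      / (real (ell Q) * real d)"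
proof -
  let ?V = "{..<d} - hidden Q s"
  let ?M = "{j. j < d \<and> j \<notin> hidden Q s \<and> y ! j \<noteq> x ! j}"
  have "fingerprint x \<bullet>c check_vec Q s (revealed Q s y) =
      (\<Sum>j<d. complex_of_real (if j \<in> hidden Q s then 0 else
        (if y ! j \<noteq> x ! j then -1 else 1) / (sqrt (real d) * sqrt (real (ell Q)))))"
    using x by (auto simp: check_vec_eq[OF y s] scalar_prod_def fingerprint_def lessThan_atLeast0
        intro!: sum.cong)
  also have "\<dots> = complex_of_real (\<Sum>j<d. if j \<in> hidden Q s then 0 else
        (if y ! j \<noteq> x ! j then -1 else 1) / (sqrt (real d) * sqrt (real (ell Q))))"
    by (rule of_real_sum[symmetric])
  also have "(\<Sum>j<d. if j \<in> hidden Q s then 0 else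
        (if y ! j \<noteq> x ! j then -1 else 1) / (sqrt (real d) * sqrt (real (ell Q)))) =
      (\<Sum>j\<in>?V. (if y ! j \<noteq> x ! j then -1 else 1) / (sqrt (real d) * sqrt (real (ell Q))))"
    by (intro sum.mono_neutral_cong_right) auto
  also have "\<dots> = (\<Sum>j\<in>?V. 1 - 2 * (if y ! j \<noteq> x ! j then 1 else 0)) / (sqrt (real d) * sqrt (real (ell Q)))"
    unfolding sum_divide_distrib by (intro sum.cong) auto
  also have "(\<Sum>j\<in>?V. 1 - 2 * (if y ! j \<noteq> x ! j then 1 else 0)) = real (ell Q) - 2 * real (card ?M)"
  proof -
    have "(\<Sum>j\<in>?V. if y ! j \<noteq> x ! j then 1 else 0 :: real) = real (card {j \<in> ?V. y ! j \<noteq> x ! j})"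
      by (simp add: sum.If_cases Int_def)
    also have "{j \<in> ?V. y ! j \<noteq> x ! j} = ?M"
      by auto
    finally show ?thesis
      by (simp add: sum_subtractf card_visible[OF s] flip: sum_distrib_left)
  qed
  finally show ?thesis
    by (simp add: pass_prob_def norm_of_real power_divide power_mult_distrib mult.commute
        del: of_real_divide)
qed

text \<open>Every string of length \<open>ell Q\<close> is the revealed part of some
  \<open>y\<close>, so the mismatch formula covers arbitrary forged strings.\<close>

lemma pass_prob_bounds:
  assumes x: "length x = d" and \<kappa>: "length \<kappa> = ell Q" and s: "s < qs_S Q"
  shows "0 \<le> pass_prob Q s \<kappa> x" "pass_prob Q s \<kappa> x \<le> real (ell Q) / real d"
    "pass_prob Q s \<kappa> x \<le> 1"
proof -
  show "0 \<le> pass_prob Q s \<kappa> x"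
    by (simp add: pass_prob_def)
  obtain y where y: "length y = d" "revealed Q s y = \<kappa>"
    using ex_revealed[OF \<kappa> s] .
  let ?M = "{j. j < d \<and> j \<notin> hidden Q s \<and> y ! j \<noteq> x ! j}"
  have "card ?M \<le> card ({..<d} - hidden Q s)"
    by (intro card_mono) auto
  then have M: "card ?M \<le> ell Q"
    by (simp add: card_visible[OF s])
  have "(real (ell Q) - 2 * real (card ?M))\<^sup>2 \<le> (real (ell Q))\<^sup>2"
    using M by (intro abs_le_square_iff[THEN iffD1]) auto
  then show *: "pass_prob Q s \<kappa> x \<le> real (ell Q) / real d"
    unfolding y(2)[symmetric] pass_prob_eq[OF x y(1) s]
    using ell_pos d_pos by (simp add: field_simps power2_eq_square)
  have "real (ell Q) / real d \<le> 1"
    using d_pos by (simp add: ell_eq)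
  with * show "pass_prob Q s \<kappa> x \<le> 1"
    by linarith
qed

lemma pass_prob_honest:
  assumes x: "length x = d" and s: "s < qs_S Q"
  shows "pass_prob Q s (revealed Q s x) x = real (ell Q) / real d"
  using pass_prob_eq[OF x x s] ell_pos by (simp add: power2_eq_square)

end

section \<open>Normalization of the adversary\<close>

lemma cinner_mat_eq_sesqui:
  assumes "M \<in> carrier_mat n n" "v \<in> carrier_vec n"
  shows "(M *\<^sub>v v) \<bullet>c v = sesqui n (\<lambda>x y. M $$ (x, y)) (($) v) (($) v)"
  using assms by (simp add: sesqui_def scalar_prod_def lessThan_atLeast0 sum_distrib_right)

lemma mat_adjoint_index:
  assumes "B \<in> carrier_mat m n" "x < n" "a < m"
  shows "mat_adjoint B $$ (x, a) = cnj (B $$ (a, x))"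
  using assms by (simp add: mat_adjoint_def mat_of_rows_index)

text \<open>The pullback formula for the effect \<open>1\<close>, in the shape in which the
  completeness relation of an instrument can be summed.\<close>

lemma cinner_image_eq_sesqui:
  assumes B: "B \<in> carrier_mat m n" and v: "v \<in> carrier_vec n"
  shows "(B *\<^sub>v v) \<bullet>c (B *\<^sub>v v) = sesqui n (\<lambda>x y. (mat_adjoint B * B) $$ (x, y)) (($) v) (($) v)"
proof -
  have dims: "mat_adjoint B \<in> carrier_mat n m"
    using B by (intro carrier_matI) (auto simp: mat_adjoint_def)
  have prod: "(mat_adjoint B * B) $$ (x, y) = (\<Sum>a<m. cnj (B $$ (a, x)) * B $$ (a, y))"
    if "x < n" "y < n" for x y
    using that B dims by (simp add: scalar_prod_def lessThan_atLeast0 mat_adjoint_index)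
  have "(1\<^sub>m m *\<^sub>v (B *\<^sub>v v)) \<bullet>c (B *\<^sub>v v) =
      sesqui n (\<lambda>x y. \<Sum>a<m. \<Sum>b<m. cnj (B $$ (a, x)) * 1\<^sub>m m $$ (a, b) * B $$ (b, y)) (($) v) (($) v)"
    by (rule born_eq_sesqui[OF one_carrier_mat B v])
  also have "\<dots> = sesqui n (\<lambda>x y. (mat_adjoint B * B) $$ (x, y)) (($) v) (($) v)"
    unfolding sesqui_def
  proof (intro sum.cong refl)
    fix x y assume xy: "x \<in> {..<n}" "y \<in> {..<n}"
    have "(\<Sum>b<m. cnj (B $$ (a, x)) * 1\<^sub>m m $$ (a, b) * B $$ (b, y)) = cnj (B $$ (a, x)) * B $$ (a, y)"
      if "a < m" for a
    proof -
      have "(\<Sum>b<m. cnj (B $$ (a, x)) * 1\<^sub>m m $$ (a, b) * B $$ (b, y)) =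
          (\<Sum>b<m. if a = b then cnj (B $$ (a, x)) * B $$ (b, y) else 0)"
        using that by (intro sum.cong refl) auto
      then show ?thesis
        using that by simp
    qed
    then show "(\<Sum>a<m. \<Sum>b<m. cnj (B $$ (a, x)) * 1\<^sub>m m $$ (a, b) * B $$ (b, y)) * v $ y * cnj (v $ x) =
        (mat_adjoint B * B) $$ (x, y) * v $ y * cnj (v $ x)"
      using xy by (simp add: prod)
  qed
  also have "1\<^sub>m m *\<^sub>v (B *\<^sub>v v) = B *\<^sub>v v"
    using mult_mat_vec_carrier[OF B v] by simp
  finally show ?thesis .
qed

lemma sesqui_sum_kernel: "(\<Sum>a\<in>A. sesqui n (M a) f g) = sesqui n (\<lambda>x y. \<Sum>a\<in>A. M a x y) f g"
  unfolding sesqui_def sum_distrib_right by (rule sum_swap3)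

lemma sesqui_sum_list_kernel:
  "(\<Sum>a\<leftarrow>xs. sesqui n (M a) f g) = sesqui n (\<lambda>x y. \<Sum>a\<leftarrow>xs. M a x y) f g"
  by (induction xs) (simp_all add: sesqui_def sum.distrib distrib_right)

lemma sesqui_one:
  assumes "mat n n M = 1\<^sub>m n" "v \<in> carrier_vec n"
  shows "sesqui n (\<lambda>x y. M (x, y)) (($) v) (($) v) = v \<bullet>c v"
proof -
  have "M (x, y) = 1\<^sub>m n $$ (x, y)" if "x < n" "y < n" for x y
    using that assms(1)[symmetric] by simp
  then have "sesqui n (\<lambda>x y. M (x, y)) (($) v) (($) v) = sesqui n (\<lambda>x y. 1\<^sub>m n $$ (x, y)) (($) v) (($) v)"
    unfolding sesqui_def by (intro sum.cong refl) auto
  also have "\<dots> = (1\<^sub>m n *\<^sub>v v) \<bullet>c v"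
    using assms(2) by (intro cinner_mat_eq_sesqui[symmetric]) auto
  finally show ?thesis
    using assms(2) by simp
qed

lemma sum_born_povm:
  assumes povm: "povm n X E" and v: "v \<in> carrier_vec n"
  shows "(\<Sum>x\<in>X. born (E x) v) = Re (v \<bullet>c v)"
proof -
  have "E x \<in> carrier_mat n n" if "x \<in> X" for x
    using povm that by (auto simp: povm_def psd_def)
  then have "(\<Sum>x\<in>X. (E x *\<^sub>v v) \<bullet>c v) = (\<Sum>x\<in>X. sesqui n (\<lambda>i j. E x $$ (i, j)) (($) v) (($) v))"
    using v by (intro sum.cong refl cinner_mat_eq_sesqui)
  also have "\<dots> = v \<bullet>c v"
    unfolding sesqui_sum_kernel using povm v by (intro sesqui_one) (auto simp: povm_def)
  finally show ?thesis
    unfolding born_def by (metis Re_sum)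
qed

lemma sum_instrument:
  assumes inst: "instrument n n' X F" and v: "v \<in> carrier_vec n"
  shows "(\<Sum>x\<in>X. \<Sum>B\<leftarrow>F x. Re ((B *\<^sub>v v) \<bullet>c (B *\<^sub>v v))) = Re (v \<bullet>c v)"
proof -
  have "(\<Sum>B\<leftarrow>F x. (B *\<^sub>v v) \<bullet>c (B *\<^sub>v v)) =
      (\<Sum>B\<leftarrow>F x. sesqui n (\<lambda>i j. (mat_adjoint B * B) $$ (i, j)) (($) v) (($) v))" if "x \<in> X" for x
    using inst that v unfolding instrument_def
    by (intro arg_cong[of _ _ sum_list] map_cong refl cinner_image_eq_sesqui) auto
  then have "(\<Sum>x\<in>X. \<Sum>B\<leftarrow>F x. (B *\<^sub>v v) \<bullet>c (B *\<^sub>v v)) =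
      sesqui n (\<lambda>i j. \<Sum>x\<in>X. \<Sum>B\<leftarrow>F x. (mat_adjoint B * B) $$ (i, j)) (($) v) (($) v)"
    by (simp add: sesqui_sum_list_kernel sesqui_sum_kernel)
  also have "\<dots> = v \<bullet>c v"
    using inst v by (intro sesqui_one) (auto simp: instrument_def)
  finally have "Re (\<Sum>x\<in>X. \<Sum>B\<leftarrow>F x. (B *\<^sub>v v) \<bullet>c (B *\<^sub>v v)) = Re (v \<bullet>c v)"
    by simp
  moreover have "Re (\<Sum>B\<leftarrow>xs. f B) = (\<Sum>B\<leftarrow>xs. Re (f B))" for xs :: "complex mat list" and f
    by (induction xs) auto
  ultimately show ?thesis
    by simp
qed

lemma prod_list_const: "(\<And>x. x \<in> set xs \<Longrightarrow> f x = c) \<Longrightarrow> prod_list (map f xs) = c ^ length xs"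
  for c :: "'a::comm_monoid_mult"
  by (induction xs) auto

lemma public_key_copies_norm:
  assumes "\<And>x. x \<in> set k \<Longrightarrow> x \<noteq> []"
  shows "public_key_copies T k \<bullet>c public_key_copies T k = 1"
proof -
  have "public_key k \<bullet>c public_key k = 1"
    unfolding public_key_def tensor_vecs_self_inner map_map comp_def
    using assms by (subst prod_list_const[where c = 1]) (auto simp: fingerprint_norm)
  then show ?thesis
    unfolding public_key_copies_def tensor_vecs_self_inner
    by (subst prod_list_const[where c = 1]) auto
qed

section \<open>A single attacked position\<close>

text \<open>This is \<open>1 + s \<le> exp s\<close> at \<open>s = t * ln Z - 1\<close>. The two
  sides touch at \<open>t = 1 / ln Z\<close>, so the constant cannot be improved.\<close>

lemma linear_le_powr:
  fixes Z t :: real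
  assumes "Z > 1"
  shows "t \<le> Z powr t / (exp 1 * ln Z)"
proof -
  have "t * ln Z \<le> exp (t * ln Z - 1)"
    using exp_ge_add_one_self[of "t * ln Z - 1"] by simp
  then have "t * ln Z * exp 1 \<le> Z powr t"
    using assms by (simp add: powr_def exp_diff field_simps)
  moreover have "0 < ln Z"
    using assms by simp
  ultimately show ?thesis
    by (simp add: field_simps)
qed

text \<open>The second summand is needed because flipping all guessed bits leaves the squared
  overlap unchanged when \<open>S = 2\<close>.\<close>

lemma squared_overlap_diff_le:
  fixes n l R X Y Z :: real
  assumes "0 < R" "R \<le> n / 2" "n \<le> l" "Z > 1" "0 \<le> X" "X \<le> n" "0 \<le> Y" "Y \<le> l - n"
  shows "(1 - 2 * (X + Y) / l)\<^sup>2 - (1 - 2 * R / l)\<^sup>2 \<le>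
    4 / (exp 1 * l * ln Z) * (Z powr (R - X) + Z powr (R - (n - X)))"
proof -
  have l: "l > 0" and lnZ: "ln Z > 0"
    using assms by auto
  have diff: "(1 - 2 * t / l)\<^sup>2 - (1 - 2 * R / l)\<^sup>2 = 4 / l * (R - t) * (1 - (R + t) / l)" for t
    using l by (simp add: field_simps power2_eq_square)
  have low: "(1 - 2 * t / l)\<^sup>2 - (1 - 2 * R / l)\<^sup>2 \<le> 4 / (exp 1 * l * ln Z) * Z powr (R - x)"
    if t: "x \<le> t" "0 \<le> t" "t < R" for t x
  proof -
    have "4 / l * (R - t) * (1 - (R + t) / l) \<le> 4 / l * (R - t) * 1"
      using t l assms by (intro mult_left_mono) auto
    also have "\<dots> \<le> 4 / l * (Z powr (R - t) / (exp 1 * ln Z)) * 1"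
      using l linear_le_powr[OF \<open>Z > 1\<close>, of "R - t"] by (intro mult_right_mono mult_left_mono) auto
    also have "\<dots> \<le> 4 / l * (Z powr (R - x) / (exp 1 * ln Z)) * 1"
      using l lnZ t \<open>Z > 1\<close>
      by (intro mult_right_mono mult_left_mono divide_right_mono powr_mono) auto
    finally show ?thesis
      unfolding diff by (simp add: mult_ac)
  qed
  define t where "t = X + Y"
  define c where "c = 4 / (exp 1 * l * ln Z)"
  have c: "c > 0"
    using l lnZ by (simp add: c_def)
  have "(1 - 2 * t / l)\<^sup>2 - (1 - 2 * R / l)\<^sup>2 \<le> c * Z powr (R - X) + c * Z powr (R - (n - X))"
  proof -
    have nonneg: "0 \<le> c * Z powr (R - X)" "0 \<le> c * Z powr (R - (n - X))"
      using c by auto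
    \<comment> \<open>The squared overlap is symmetric in \<open>t\<close> about
      \<open>l / 2\<close>. Between \<open>R\<close> and \<open>l - R\<close> the difference is not
      positive; beyond, \<open>t\<close> is reflected to \<open>l - t\<close>, which is at least
      \<open>n - X\<close> because \<open>Y \<le> l - n\<close>.\<close>
    consider "t < R" | "R \<le> t" "t \<le> l - R" | "l - t < R"
      by linarith
    then show ?thesis
    proof cases
      case 1
      then have "(1 - 2 * t / l)\<^sup>2 - (1 - 2 * R / l)\<^sup>2 \<le> c * Z powr (R - X)"
        unfolding c_def using assms by (intro low) (auto simp: t_def)
      then show ?thesis
        using nonneg by linarith
    next
      case 2
      have "4 / l * (R - t) \<le> 0" "0 \<le> 1 - (R + t) / l"
        using 2 l by (auto simp: field_simps mult_nonneg_nonpos)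
      then have "4 / l * (R - t) * (1 - (R + t) / l) \<le> 0"
        by (rule mult_nonpos_nonneg)
      then show ?thesis
        unfolding diff using nonneg by linarith
    next
      case 3
      have "(1 - 2 * (l - t) / l)\<^sup>2 - (1 - 2 * R / l)\<^sup>2 \<le> c * Z powr (R - (n - X))"
        unfolding c_def using assms 3 by (intro low) (auto simp: t_def)
      moreover have "(1 - 2 * (l - t) / l)\<^sup>2 = (1 - 2 * t / l)\<^sup>2"
        using l by (simp add: field_simps power2_eq_square)
      ultimately show ?thesis
        using nonneg by linarith
    qed
  qed
  then show ?thesis
    by (simp add: c_def t_def distrib_left)
qed

lemma sum_Pow_powr_card:
  fixes Z :: real
  assumes I: "finite I" and Z: "Z > 0"
  shows "(\<Sum>H\<in>Pow I. Z powr (R - real (card H))) = Z powr R * (1 + 1 / Z) ^ card I"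
proof -
  have "(\<Sum>H\<in>Pow I. Z powr (R - real (card H))) = Z powr R * (\<Sum>H\<in>Pow I. (1 / Z) ^ card H)"
    unfolding sum_distrib_left using Z
    by (intro sum.cong refl) (simp add: powr_diff powr_realpow power_one_over)
  also have "(\<Sum>H\<in>Pow I. (1 / Z) ^ card H) = (1 + 1 / Z) ^ card I"
    using prod_add[OF I, of "\<lambda>_. 1 / Z" "\<lambda>_. 1"] by (simp add: add.commute)
  finally show ?thesis .
qed

context signature_scheme
begin

text \<open>\<open>s\<close> is the signed symbol, whose block stayed hidden, and \<open>s'\<close>
  the symbol of the forgery, which demands that block. The excess over the reference value is
  dominated by a function of \<open>M x\<close>, the wrong guesses within the block. A flip replaces
  \<open>M x\<close> by a symmetric difference, so the sum over all flips runs through all subsets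
  and does not depend on \<open>x\<close>.\<close>

lemma pass_prob_attacked:
  assumes s: "s < qs_S Q" "s' < qs_S Q" "s \<noteq> s'" and \<kappa>: "length \<kappa> = ell Q"
    and R: "0 < R" "R \<le> real n / 2" and Z: "Z > 1"
  obtains c where
    "\<And>x. length x = d \<Longrightarrow> 0 \<le> c x"
    "\<And>x. length x = d \<Longrightarrow> pass_prob Q s' \<kappa> x - real (ell Q) / real d * (1 - 2 * R / real (ell Q))\<^sup>2 \<le> c x"
    "\<And>x. length x = d \<Longrightarrow> (\<Sum>H\<in>Pow (hidden Q s). c (flip H x)) =
      real (ell Q) / real d * (4 / (exp 1 * real (ell Q) * ln Z)) * (2 * (Z powr R * (1 + 1 / Z) ^ n))"
proof -
  obtain y where y: "length y = d" "revealed Q s' y = \<kappa>"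
    using ex_revealed[OF \<kappa> s(2)] .
  let ?I = "hidden Q s"
  define M where "M = (\<lambda>x. {j \<in> ?I. y ! j \<noteq> x ! j})"
  define a where "a = real (ell Q) / real d * (4 / (exp 1 * real (ell Q) * ln Z))"
  define c where "c = (\<lambda>x. a * (Z powr (R - real (card (M x))) +
      Z powr (R - (real n - real (card (M x))))))"
  have lnZ: "ln Z > 0"
    using Z by simp
  have a: "a \<ge> 0"
    unfolding a_def using lnZ by simp
  have I: "?I \<subseteq> {..<d} - hidden Q s'" "?I \<subseteq> {..<d}"
    using hidden_subset[OF s(1)] hidden_disjoint[OF s(3)] by auto
  have M: "card (M x) \<le> n" for x
    using card_mono[OF finite_hidden[of s], of "M x"] by (auto simp: M_def)
  have nonneg: "0 \<le> c x" for x
    unfolding c_def using a by (intro mult_nonneg_nonneg add_nonneg_nonneg) auto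
  have le: "pass_prob Q s' \<kappa> x - real (ell Q) / real d * (1 - 2 * R / real (ell Q))\<^sup>2 \<le> c x"
    if x: "length x = d" for x
  proof -
    let ?M' = "{j. j < d \<and> j \<notin> hidden Q s' \<and> y ! j \<noteq> x ! j}"
    define Y where "Y = card (?M' - ?I)"
    have M_sub: "M x \<subseteq> ?M'"
      using I by (auto simp: M_def)
    have "?M' - ?I = ?M' - M x"
      by (auto simp: M_def)
    then have "Y = card (?M' - M x)"
      unfolding Y_def by (rule arg_cong)
    moreover have "finite ?M'"
      by simp
    ultimately have card: "card ?M' = card (M x) + Y"
      using card_Diff_subset[OF finite_subset[OF M_sub] M_sub] card_mono[OF _ M_sub] by simp
    have "Y \<le> card (({..<d} - hidden Q s') - ?I)"
      unfolding Y_def by (intro card_mono) auto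
    also have "\<dots> = ell Q - n"
      using I by (subst card_Diff_subset) (auto simp: card_visible[OF s(2)])
    finally have Y: "Y \<le> ell Q - n" .
    have n_le: "n \<le> ell Q"
      using card_mono[OF _ I(1)] by (simp add: card_visible[OF s(2)])
    have l: "real (ell Q) > 0"
      using ell_pos by simp
    have "pass_prob Q s' \<kappa> x = (real (ell Q) - 2 * real (card ?M'))\<^sup>2 / (real (ell Q) * real d)"
      using pass_prob_eq[OF x y(1) s(2)] y(2) by simp
    also have "\<dots> = real (ell Q) / real d * (1 - 2 * (real (card (M x)) + real Y) / real (ell Q))\<^sup>2"
      unfolding card using l d_pos by (simp add: field_simps power2_eq_square)
    finally have "pass_prob Q s' \<kappa> x - real (ell Q) / real d * (1 - 2 * R / real (ell Q))\<^sup>2 =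
        real (ell Q) / real d * ((1 - 2 * (real (card (M x)) + real Y) / real (ell Q))\<^sup>2
          - (1 - 2 * R / real (ell Q))\<^sup>2)"
      by (simp add: right_diff_distrib)
    also have "\<dots> \<le> real (ell Q) / real d * (4 / (exp 1 * real (ell Q) * ln Z) *
        (Z powr (R - real (card (M x))) + Z powr (R - (real n - real (card (M x))))))"
      using R Z Y n_le M[of x] by (intro mult_left_mono squared_overlap_diff_le) auto
    finally show ?thesis
      unfolding c_def a_def by (simp only: mult.assoc)
  qed
  have sum: "(\<Sum>H\<in>Pow ?I. c (flip H x)) = a * (2 * (Z powr R * (1 + 1 / Z) ^ n))"
    if x: "length x = d" for x
  proof -
    have M_flip: "M (flip H x) = sym_diff H (M x)" if "H \<in> Pow ?I" for H
      using that I x by (auto simp: M_def nth_flip split: if_splits)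
    have Mx: "M x \<subseteq> ?I"
      by (auto simp: M_def)
    have bij: "bij_betw (\<lambda>H. sym_diff H (M x)) (Pow ?I) (Pow ?I)"
      by (rule bij_betw_sym_diff_Pow[OF Mx])
    have "(\<Sum>H\<in>Pow ?I. Z powr (R - real (card (M (flip H x))))) =
        (\<Sum>H\<in>Pow ?I. Z powr (R - real (card (sym_diff H (M x)))))"
      by (intro sum.cong refl) (simp add: M_flip)
    also have "\<dots> = (\<Sum>H\<in>Pow ?I. Z powr (R - real (card H)))"
      by (rule sum.reindex_bij_betw[OF bij])
    finally have 1: "(\<Sum>H\<in>Pow ?I. Z powr (R - real (card (M (flip H x))))) = Z powr R * (1 + 1 / Z) ^ n"
      using sum_Pow_powr_card[of ?I Z R] Z by simp
    have "(\<Sum>H\<in>Pow ?I. Z powr (R - (real n - real (card (M (flip H x)))))) =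
        (\<Sum>H\<in>Pow ?I. Z powr (R - (real n - real (card (sym_diff H (M x))))))"
      by (intro sum.cong refl) (simp add: M_flip)
    also have "\<dots> = (\<Sum>H\<in>Pow ?I. Z powr (R - (real n - real (card H))))"
      by (rule sum.reindex_bij_betw[OF bij])
    \<comment> \<open>Complements within the block turn the reflected weight into the first one,
      whence the factor 2.\<close>
    also have "\<dots> = (\<Sum>H\<in>Pow ?I. Z powr (R - (real n - real (card (?I - H)))))"
      by (rule sum.reindex_bij_witness[of _ "\<lambda>H. ?I - H" "\<lambda>H. ?I - H"]) (auto simp: double_diff)
    also have "\<dots> = (\<Sum>H\<in>Pow ?I. Z powr (R - real (card H)))"
    proof (intro sum.cong refl)
      fix H assume H: "H \<in> Pow ?I"
      then have "card (?I - H) = n - card H" "card H \<le> n"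
        using card_mono[OF finite_hidden[of s], of H] finite_subset[OF _ finite_hidden[of s]]
        by (auto simp: card_Diff_subset)
      then show "Z powr (R - (real n - real (card (?I - H)))) = Z powr (R - real (card H))"
        by (simp add: of_nat_diff)
    qed
    finally have 2: "(\<Sum>H\<in>Pow ?I. Z powr (R - (real n - real (card (M (flip H x)))))) =
        Z powr R * (1 + 1 / Z) ^ n"
      using sum_Pow_powr_card[of ?I Z R] Z by simp
    show ?thesis
      unfolding c_def sum_distrib_left[symmetric] sum.distrib 1 2 by simp
  qed
  show ?thesis
    by (rule that[of c]) (use nonneg le sum in \<open>auto simp: a_def\<close>)
qed

end

section \<open>Forgery\<close>

lemma sum_list_sum_swap:
  "(\<Sum>B\<leftarrow>xs. \<Sum>h\<in>A. f B h) = (\<Sum>h\<in>A. \<Sum>B\<leftarrow>xs. f B h :: real)"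
  by (induction xs) (simp_all add: sum.distrib)

lemma finite_words [simp]: "finite (words S K)"
  using finite_lists_length_eq[of "{..<S}" K] by (simp add: words_def conj_commute)

lemma words_nth: "x \<in> words S n \<Longrightarrow> i < n \<Longrightarrow> x ! i < S"
proof -
  assume "x \<in> words S n" "i < n"
  then have "x ! i \<in> set x" "set x \<subseteq> {..<S}"
    by (auto simp: words_def)
  then show "x ! i < S"
    by blast
qed

lemma born_nonneg: "psd m E \<Longrightarrow> v \<in> carrier_vec m \<Longrightarrow> 0 \<le> born E v"
  unfolding psd_def born_def by (auto simp: less_eq_complex_def)

text \<open>Linearizing at \<open>q0\<close> with \<open>1 + s \<le> exp s\<close> leaves the
  additive error \<open>u * c\<close>. Factoring out the exponential multiplies this error by
  \<open>exp (u * (1 - q0))\<close>, which \<open>K\<close> bounds, and produces the form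
  \<open>1 + c\<close> needed for averaging.\<close>

lemma failure_weight_le:
  fixes u q q0 c K :: real
  assumes "0 \<le> u" "q - q0 \<le> c" "0 \<le> c" "exp (u * (1 - q0)) \<le> K"
  shows "1 - u * (1 - q) \<le> exp (- u * (1 - q0)) * (1 + K * u * c)"
proof -
  have "1 - u * (1 - q) = 1 + (- u * (1 - q0)) + u * (q - q0)"
    by (simp add: algebra_simps)
  also have "\<dots> \<le> exp (- u * (1 - q0)) + u * c"
    using assms by (intro add_mono exp_ge_add_one_self mult_left_mono) auto
  also have "u * c = exp (- u * (1 - q0)) * (exp (u * (1 - q0)) * (u * c))"
    by (simp add: exp_minus)
  also have "exp (- u * (1 - q0)) + \<dots> \<le> exp (- u * (1 - q0)) + exp (- u * (1 - q0)) * (K * (u * c))"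
    using assms by (intro add_left_mono mult_left_mono mult_right_mono) auto
  finally show ?thesis
    by (simp add: distrib_left mult.assoc)
qed

context signature_scheme
begin

lemma finite_private_keys [simp]: "finite (private_keys Q)"
proof -
  have "finite {x :: bool list. length x = d}"
    using finite_lists_length_eq[of "UNIV :: bool set" d] by simp
  from finite_lists_length_eq[OF this, of "qs_N Q"] show ?thesis
    by (simp add: private_keys_def subset_iff conj_commute Ball_def)
qed

lemma finite_signatures [simp]: "finite (signatures Q)"
proof -
  have "finite {x :: bool list. length x = ell Q}"
    using finite_lists_length_eq[of "UNIV :: bool set" "ell Q"] by simp
  from finite_lists_length_eq[OF this, of "qs_N Q"] show ?thesis
    by (simp add: signatures_def subset_iff conj_commute Ball_def)
qed

lemma finite_messages [simp]: "finite (messages Q)"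
  by (simp add: messages_def)

lemma private_keys_nonempty: "private_keys Q \<noteq> {}"
proof -
  have "replicate (qs_N Q) (replicate d False) \<in> private_keys Q"
    by (simp add: private_keys_def)
  then show ?thesis by auto
qed

lemma private_key_nth:
  assumes "k \<in> private_keys Q"
  shows "length k = qs_N Q" "\<And>i. i < qs_N Q \<Longrightarrow> length (k ! i) = d" "\<And>x. x \<in> set k \<Longrightarrow> length x = d"
  using assms by (auto simp: private_keys_def)

lemma flip_key_private_keys:
  assumes "k \<in> private_keys Q"
  shows "flip_key i H k \<in> private_keys Q"
proof -
  have "length (flip_key i H k ! j) = d" if "j < qs_N Q" for j
    using private_key_nth[OF assms] that by (simp add: nth_flip_key)
  then show ?thesis
    using private_key_nth[OF assms] by (auto simp: private_keys_def in_set_conv_nth)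
qed

text \<open>The flipped bits lie in the block that the signature omits. This keeps the effect
  \<open>adv_forge A m (sign Q k m)\<close> constant while hidden bits are averaged.\<close>

lemma sign_flip_key:
  assumes k: "k \<in> private_keys Q" and H: "H \<subseteq> hidden Q (qs_enc Q m ! i)"
  shows "sign Q (flip_key i H k) m = sign Q k m"
  unfolding sign_def using private_key_nth[OF k] H
  by (intro map_cong refl) (auto simp: nth_flip_key revealed_flip)

lemma sign_signatures:
  assumes k: "k \<in> private_keys Q" and enc: "qs_enc Q m \<in> words (qs_S Q) (qs_N Q)"
  shows "sign Q k m \<in> signatures Q"
proof -
  have "qs_enc Q m ! i < qs_S Q" if "i < qs_N Q" for i
    using enc that by (rule words_nth)
  then show ?thesis
    using private_key_nth[OF k] by (auto simp: sign_def signatures_def length_revealed)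
qed

lemma prod_list_key_lengths:
  assumes "k \<in> private_keys Q"
  shows "prod_list (map length k) = d ^ qs_N Q"
  using private_key_nth[OF assms] by (subst prod_list_const[where c = d]) auto

lemma public_key_copies_carrier:
  assumes "k \<in> private_keys Q"
  shows "public_key_copies T k \<in> carrier_vec ((d ^ qs_N Q) ^ T)"
  using prod_list_key_lengths[OF assms] by (intro carrier_vecI) (simp add: dim_public_key_copies)

text \<open>For a fixed key, the joint probability that \<open>m\<close> is signed and
  \<open>f\<close> is output: the state after a Kraus operator is not renormalized.\<close>

definition output_prob where
  "output_prob T A m f k = (\<Sum>B\<leftarrow>adv_choose A m.
     born (adv_forge A m (sign Q k m) f) (B *\<^sub>v public_key_copies T k))"

lemma adversary_effects:
  assumes A: "valid_adversary Q T A" and m: "m \<in> messages Q"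
    and enc: "qs_enc Q m \<in> words (qs_S Q) (qs_N Q)" and k: "k \<in> private_keys Q"
  shows "povm (adv_dim A) (messages Q \<times> signatures Q) (adv_forge A m (sign Q k m))"
    and "B \<in> set (adv_choose A m) \<Longrightarrow> B \<in> carrier_mat (adv_dim A) ((d ^ qs_N Q) ^ T)"
  using A m sign_signatures[OF k enc] by (auto simp: valid_adversary_def instrument_def)

lemma output_prob_nonneg:
  assumes A: "valid_adversary Q T A" and m: "m \<in> messages Q"
    and enc: "qs_enc Q m \<in> words (qs_S Q) (qs_N Q)" and k: "k \<in> private_keys Q"
    and f: "f \<in> messages Q \<times> signatures Q"
  shows "0 \<le> output_prob T A m f k"
proof -
  have "0 \<le> born (adv_forge A m (sign Q k m) f) (B *\<^sub>v public_key_copies T k)"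
    if B: "B \<in> set (adv_choose A m)" for B
  proof (rule born_nonneg)
    show "psd (adv_dim A) (adv_forge A m (sign Q k m) f)"
      using adversary_effects(1)[OF A m enc k] f unfolding povm_def by blast
    show "B *\<^sub>v public_key_copies T k \<in> carrier_vec (adv_dim A)"
      by (rule mult_mat_vec_carrier[OF adversary_effects(2)[OF A m enc k B]
            public_key_copies_carrier[OF k]])
  qed
  then show ?thesis
    unfolding output_prob_def by (intro sum_list_nonneg) auto
qed

text \<open>Invariance of the signature makes the effect the same for all flipped keys; the estimate
  for one Kraus operator is then summed.\<close>

lemma output_prob_le_average:
  assumes A: "valid_adversary Q T A" and m: "m \<in> messages Q"
    and enc: "qs_enc Q m \<in> words (qs_S Q) (qs_N Q)" and k: "k \<in> private_keys Q"
    and f: "f \<in> messages Q \<times> signatures Q" and i: "i < qs_N Q"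
  defines "I \<equiv> hidden Q (qs_enc Q m ! i)"
  shows "2 ^ n * output_prob T A m f k \<le>
    (1 + real n) ^ T * (\<Sum>H\<in>Pow I. output_prob T A m f (flip_key i H k))"
proof -
  let ?E = "adv_forge A m (sign Q k m) f"
  have "2 ^ n * born ?E (B *\<^sub>v public_key_copies T k) \<le>
      (1 + real n) ^ T * (\<Sum>H\<in>Pow I. born ?E (B *\<^sub>v public_key_copies T (flip_key i H k)))"
    if B: "B \<in> set (adv_choose A m)" for B
  proof -
    have psd: "psd (adv_dim A) ?E"
      using adversary_effects(1)[OF A m enc k] f unfolding povm_def by blast
    have "B \<in> carrier_mat (adv_dim A) (prod_list (map length k) ^ T)"
      using adversary_effects(2)[OF A m enc k B] by (simp add: prod_list_key_lengths[OF k])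
    from born_public_key_le_average[OF _ _ psd this, of i I] show ?thesis
      using i private_key_nth(1)[OF k] by (simp add: I_def)
  qed
  then have "(\<Sum>B\<leftarrow>adv_choose A m. 2 ^ n * born ?E (B *\<^sub>v public_key_copies T k)) \<le>
      (\<Sum>B\<leftarrow>adv_choose A m. (1 + real n) ^ T *
        (\<Sum>H\<in>Pow I. born ?E (B *\<^sub>v public_key_copies T (flip_key i H k))))"
    by (rule sum_list_mono)
  also have "\<dots> = (1 + real n) ^ T *
      (\<Sum>H\<in>Pow I. \<Sum>B\<leftarrow>adv_choose A m. born ?E (B *\<^sub>v public_key_copies T (flip_key i H k)))"
    unfolding sum_list_const_mult sum_list_sum_swap ..
  also have "(\<Sum>H\<in>Pow I. \<Sum>B\<leftarrow>adv_choose A m. born ?E (B *\<^sub>v public_key_copies T (flip_key i H k))) =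
      (\<Sum>H\<in>Pow I. output_prob T A m f (flip_key i H k))"
    unfolding output_prob_def I_def using sign_flip_key[OF k]
    by (intro sum.cong refl) auto
  finally show ?thesis
    unfolding sum_list_const_mult output_prob_def .
qed

text \<open>Completeness of the final measurement, then of the instrument, then the unit norm of the
  public key copies.\<close>

lemma sum_output_prob:
  assumes A: "valid_adversary Q T A"
    and enc: "\<And>m. m \<in> messages Q \<Longrightarrow> qs_enc Q m \<in> words (qs_S Q) (qs_N Q)"
    and k: "k \<in> private_keys Q"
  shows "(\<Sum>m\<in>messages Q. \<Sum>f\<in>messages Q \<times> signatures Q. output_prob T A m f k) = 1"
proof -
  let ?v = "public_key_copies T k"
  have v: "?v \<in> carrier_vec ((d ^ qs_N Q) ^ T)"
    by (rule public_key_copies_carrier[OF k])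
  have "(\<Sum>f\<in>messages Q \<times> signatures Q. output_prob T A m f k) =
      (\<Sum>B\<leftarrow>adv_choose A m. Re ((B *\<^sub>v ?v) \<bullet>c (B *\<^sub>v ?v)))" if m: "m \<in> messages Q" for m
  proof -
    have "(\<Sum>f\<in>messages Q \<times> signatures Q. born (adv_forge A m (sign Q k m) f) (B *\<^sub>v ?v)) =
        Re ((B *\<^sub>v ?v) \<bullet>c (B *\<^sub>v ?v))" if B: "B \<in> set (adv_choose A m)" for B
      by (rule sum_born_povm[OF adversary_effects(1)[OF A m enc[OF m] k]
            mult_mat_vec_carrier[OF adversary_effects(2)[OF A m enc[OF m] k B] v]])
    then show ?thesis
      unfolding output_prob_def sum_list_sum_swap[symmetric]
      by (intro arg_cong[of _ _ sum_list] map_cong refl)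
  qed
  then have "(\<Sum>m\<in>messages Q. \<Sum>f\<in>messages Q \<times> signatures Q. output_prob T A m f k) =
      (\<Sum>m\<in>messages Q. \<Sum>B\<leftarrow>adv_choose A m. Re ((B *\<^sub>v ?v) \<bullet>c (B *\<^sub>v ?v)))"
    by simp
  also have "\<dots> = Re (?v \<bullet>c ?v)"
    using A v by (intro sum_instrument) (auto simp: valid_adversary_def)
  also have "\<dots> = 1"
    using private_key_nth(3)[OF k] d_pos by (subst public_key_copies_norm) fastforce+
  finally show ?thesis .
qed

text \<open>At an attacked position the factor \<open>exp (- u \<mu>)\<close> is gained over an honest one; since there
  are at least \<open>2 \<theta> N\<close> of them, wherever they are, the exponents add up to the one claimed.\<close>

lemma accept_weight_le:
  assumes enc: "corrects_rate (qs_S Q) (qs_K Q) (qs_N Q) (qs_enc Q) \<theta>"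
    and m: "m \<in> messages Q" "m' \<in> messages Q" "m \<noteq> m'" and r': "r' \<in> signatures Q"
    and R: "0 < R" "R \<le> real n / 2" and Z: "Z > 1" and u: "0 \<le> u" "u < 1"
    and q0: "q0 = real (ell Q) / real d * (1 - 2 * R / real (ell Q))\<^sup>2"
    and \<mu>: "\<mu> = real (ell Q) / real d - q0" "\<mu> \<ge> 0"
    and K: "exp (u * (1 - q0)) \<le> K"
  defines "D \<equiv> {i. i < qs_N Q \<and> qs_enc Q m ! i \<noteq> qs_enc Q m' ! i}"
  obtains c where
    "\<And>i k. i \<in> D \<Longrightarrow> k \<in> private_keys Q \<Longrightarrow> 0 \<le> c i (k ! i)"
    "\<And>i k. i \<in> D \<Longrightarrow> k \<in> private_keys Q \<Longrightarrow>
      (\<Sum>H\<in>Pow (hidden Q (qs_enc Q m ! i)). c i (flip_key i H k ! i)) =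
      K * u * (real (ell Q) / real d * (4 / (exp 1 * real (ell Q) * ln Z)) * (2 * (Z powr R * (1 + 1 / Z) ^ n)))"
    "\<And>k. k \<in> private_keys Q \<Longrightarrow>
      (\<Prod>i<qs_N Q. 1 - u * (1 - pass_prob Q (qs_enc Q m' ! i) (r' ! i) (k ! i))) \<le>
      exp (- u * real (qs_N Q) * (1 - real (ell Q) / real d + 2 * \<theta> * \<mu>)) * (\<Prod>i\<in>D. 1 + c i (k ! i))"
proof -
  have sym: "qs_enc Q m ! i < qs_S Q" "qs_enc Q m' ! i < qs_S Q" if "i < qs_N Q" for i
    using enc m that by (auto simp: corrects_rate_def messages_def intro!: words_nth)
  have len: "length (r' ! i) = ell Q" if "i < qs_N Q" for i
    using r' that by (simp add: signatures_def)
  let ?s = "\<lambda>i. qs_enc Q m ! i" and ?s' = "\<lambda>i. qs_enc Q m' ! i"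
  let ?C = "real (ell Q) / real d * (4 / (exp 1 * real (ell Q) * ln Z)) * (2 * (Z powr R * (1 + 1 / Z) ^ n))"
  have "\<forall>i\<in>D. \<exists>c. (\<forall>x. length x = d \<longrightarrow> 0 \<le> c x \<and> pass_prob Q (?s' i) (r' ! i) x - q0 \<le> c x \<and>
      (\<Sum>H\<in>Pow (hidden Q (?s i)). c (flip H x)) = ?C)"
  proof
    fix i assume "i \<in> D"
    then have i: "i < qs_N Q" "?s i \<noteq> ?s' i"
      by (auto simp: D_def)
    show "\<exists>c. (\<forall>x. length x = d \<longrightarrow> 0 \<le> c x \<and> pass_prob Q (?s' i) (r' ! i) x - q0 \<le> c x \<and>
        (\<Sum>H\<in>Pow (hidden Q (?s i)). c (flip H x)) = ?C)"
    proof -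
      obtain c where "\<And>x. length x = d \<Longrightarrow> 0 \<le> c x"
        "\<And>x. length x = d \<Longrightarrow> pass_prob Q (?s' i) (r' ! i) x - q0 \<le> c x"
        "\<And>x. length x = d \<Longrightarrow> (\<Sum>H\<in>Pow (hidden Q (?s i)). c (flip H x)) = ?C"
        by (rule pass_prob_attacked[OF sym[OF i(1)] i(2) len[OF i(1)] R Z, folded q0]) (rule that)
      then show ?thesis
        by (intro exI[of _ c] allI impI conjI)
    qed
  qed
  from bchoice[OF this] obtain c where all: "\<forall>i\<in>D. \<forall>x. length x = d \<longrightarrow> 0 \<le> c i x \<and>
      pass_prob Q (?s' i) (r' ! i) x - q0 \<le> c i x \<and>
      (\<Sum>H\<in>Pow (hidden Q (?s i)). c i (flip H x)) = ?C" ..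
  have c: "0 \<le> c i x" "pass_prob Q (?s' i) (r' ! i) x - q0 \<le> c i x"
    "(\<Sum>H\<in>Pow (hidden Q (?s i)). c i (flip H x)) = ?C" if "i \<in> D" "length x = d" for i x
  proof -
    note c = all[rule_format, OF that]
    show "0 \<le> c i x"
      by (rule c[THEN conjunct1])
    show "pass_prob Q (?s' i) (r' ! i) x - q0 \<le> c i x"
      by (rule c[THEN conjunct2, THEN conjunct1])
    show "(\<Sum>H\<in>Pow (hidden Q (?s i)). c i (flip H x)) = ?C"
      by (rule c[THEN conjunct2, THEN conjunct2])
  qed
  have D: "D \<subseteq> {..<qs_N Q}" "finite D"
    by (auto simp: D_def)
  have K_pos: "K > 0"
    using K exp_gt_zero[of "u * (1 - q0)"] by linarith
  have card_D: "2 * \<theta> * real (qs_N Q) \<le> real (card D)"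
    using enc m unfolding corrects_rate_def D_def messages_def by blast
  show ?thesis
  proof (rule that[of "\<lambda>i x. K * u * c i x"])
    fix i k assume i: "i \<in> D" and k: "k \<in> private_keys Q"
    have len_k: "length (k ! i) = d"
      using private_key_nth[OF k] i D by auto
    show "0 \<le> K * u * c i (k ! i)"
      using c(1)[OF i len_k] K_pos u by simp
    have "(\<Sum>H\<in>Pow (hidden Q (?s i)). K * u * c i (flip_key i H k ! i)) =
        K * u * (\<Sum>H\<in>Pow (hidden Q (?s i)). c i (flip H (k ! i)))"
      using i D private_key_nth(1)[OF k]
      by (auto simp: sum_distrib_left nth_flip_key intro!: sum.cong)
    then show "(\<Sum>H\<in>Pow (hidden Q (?s i)). K * u * c i (flip_key i H k ! i)) = K * u * ?C"
      using c(3)[OF i len_k] by simp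
  next
    fix k assume k: "k \<in> private_keys Q"
    define \<alpha> where "\<alpha> = 1 - real (ell Q) / real d"
    have len_k: "length (k ! i) = d" if "i < qs_N Q" for i
      using private_key_nth[OF k] that by auto
    let ?p = "\<lambda>i. pass_prob Q (?s' i) (r' ! i) (k ! i)"
    let ?b = "\<lambda>i. if i \<in> D then exp (- u * (\<alpha> + \<mu>)) * (1 + K * u * c i (k ! i)) else exp (- u * \<alpha>)"
    have "(\<Prod>i<qs_N Q. 1 - u * (1 - ?p i)) \<le> (\<Prod>i<qs_N Q. ?b i)"
    proof (intro prod_mono conjI)
      fix i assume "i \<in> {..<qs_N Q}"
      then have i: "i < qs_N Q" by simp
      note p = pass_prob_bounds[OF len_k[OF i] len[OF i] sym(2)[OF i]]
      have "u * (1 - ?p i) \<le> 1 * 1"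
        using u p by (intro mult_mono) auto
      then show "0 \<le> 1 - u * (1 - ?p i)"
        by simp
      show "1 - u * (1 - ?p i) \<le> ?b i"
      proof (cases "i \<in> D")
        case True
        have "1 - q0 = \<alpha> + \<mu>"
          by (simp add: \<mu>(1) \<alpha>_def)
        then show ?thesis
          using True failure_weight_le[OF u(1) c(2)[OF True len_k[OF i]] c(1)[OF True len_k[OF i]] K]
          by simp
      next
        case False
        \<comment> \<open>Where the encodings agree, the string in \<open>r'\<close> may still be
          arbitrary; the ceiling \<open>ell / d\<close> on the pass probability is enough.\<close>
        have "1 - u * (1 - ?p i) \<le> 1 + (- u * \<alpha>)"
          using p(2) u(1) by (simp add: \<alpha>_def mult_left_mono)
        also have "\<dots> \<le> exp (- u * \<alpha>)"
          by (rule exp_ge_add_one_self)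
        finally show ?thesis
          using False by simp
      qed
    qed
    also have "\<dots> = (\<Prod>i\<in>D. ?b i) * (\<Prod>i\<in>{..<qs_N Q} - D. ?b i)"
      using D by (subst prod.subset_diff[OF D(1)]) (auto simp: mult.commute)
    also have "(\<Prod>i\<in>D. ?b i) = exp (- u * (\<alpha> + \<mu>)) ^ card D * (\<Prod>i\<in>D. 1 + K * u * c i (k ! i))"
      by (simp add: prod.distrib)
    also have "(\<Prod>i\<in>{..<qs_N Q} - D. ?b i) = exp (- u * \<alpha>) ^ (qs_N Q - card D)"
      using D by (simp add: card_Diff_subset)
    also have "exp (- u * (\<alpha> + \<mu>)) ^ card D * (\<Prod>i\<in>D. 1 + K * u * c i (k ! i)) *
        exp (- u * \<alpha>) ^ (qs_N Q - card D) =
        exp (real (card D) * (- u * (\<alpha> + \<mu>)) + real (qs_N Q - card D) * (- u * \<alpha>)) *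
        (\<Prod>i\<in>D. 1 + K * u * c i (k ! i))"
      by (simp only: exp_add exp_of_nat_mult) (simp only: mult_ac)
    also have "\<dots> \<le> exp (- u * real (qs_N Q) * (\<alpha> + 2 * \<theta> * \<mu>)) * (\<Prod>i\<in>D. 1 + K * u * c i (k ! i))"
    proof (rule mult_right_mono)
      have "card D \<le> qs_N Q"
        using card_mono[OF _ D(1)] by simp
      then have "real (card D) * (- u * (\<alpha> + \<mu>)) + real (qs_N Q - card D) * (- u * \<alpha>) =
          - u * real (qs_N Q) * \<alpha> - u * \<mu> * real (card D)"
        by (simp add: of_nat_diff algebra_simps)
      also have "\<dots> \<le> - u * real (qs_N Q) * \<alpha> - u * \<mu> * (2 * \<theta> * real (qs_N Q))"
        using card_D u(1) \<mu>(2) by (intro diff_left_mono mult_left_mono) auto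
      finally show "exp (real (card D) * (- u * (\<alpha> + \<mu>)) + real (qs_N Q - card D) * (- u * \<alpha>)) \<le>
          exp (- u * real (qs_N Q) * (\<alpha> + 2 * \<theta> * \<mu>))"
        by (simp add: algebra_simps)
      show "0 \<le> (\<Prod>i\<in>D. 1 + K * u * c i (k ! i))"
        using c(1) K_pos u D len_k by (intro prod_nonneg add_nonneg_nonneg mult_nonneg_nonneg) auto
    qed
    finally show "(\<Prod>i<qs_N Q. 1 - u * (1 - ?p i)) \<le>
        exp (- u * real (qs_N Q) * (1 - real (ell Q) / real d + 2 * \<theta> * \<mu>)) *
        (\<Prod>i\<in>D. 1 + K * u * c i (k ! i))"
      by (simp add: \<alpha>_def)
  qed
qed

text \<open>The lower tail with \<open>z = 1 - u\<close>. Since \<open>verdict_of\<close> tests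
  \<open>zacc\<close> first, it takes ordered thresholds to conclude that an outcome that is not
  rejected has at most \<open>zrej\<close> failures.\<close>

lemma verif_prob_not_rejected_le:
  assumes k: "k \<in> private_keys Q" and r': "r' \<in> signatures Q"
    and enc: "qs_enc Q m' \<in> words (qs_S Q) (qs_N Q)"
    and u: "0 \<le> u" "u < 1" and acc: "qs_zacc Q \<le> qs_zrej Q"
  shows "verif_prob Q (public_key k) m' r' (- {REJ}) \<le> (1 - u) powr (- qs_zrej Q) *
    (\<Prod>i<qs_N Q. 1 - u * (1 - pass_prob Q (qs_enc Q m' ! i) (r' ! i) (k ! i)))"
proof -
  let ?q = "\<lambda>i. pass_prob Q (qs_enc Q m' ! i) (r' ! i) (k ! i)"
  have q: "0 \<le> ?q i \<and> ?q i \<le> 1" if "i < qs_N Q" for i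
    using pass_prob_bounds[of "k ! i" "r' ! i" "qs_enc Q m' ! i"] private_key_nth[OF k] r' enc that
      words_nth[OF enc that] by (simp add: signatures_def)
  have "(\<Sum>bs \<in> {bs. length bs = qs_N Q \<and> verdict_of Q (count_list bs False) \<in> - {REJ}}.
      \<Prod>i<qs_N Q. if bs ! i then ?q i else 1 - ?q i) \<le>
      (1 - u) powr (- qs_zrej Q) * (\<Prod>i<qs_N Q. ?q i + (1 - u) * (1 - ?q i))"
  proof (rule sum_restricted_le)
    fix bs assume "bs \<in> {bs. length bs = qs_N Q \<and> verdict_of Q (count_list bs False) \<in> - {REJ}}"
    then have "real (count_list bs False) \<le> qs_zrej Q"
      using acc by (auto simp: verdict_of_def split: if_splits)
    then have "(1 - u) powr qs_zrej Q \<le> (1 - u) powr real (count_list bs False)"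
      using u by (intro powr_mono') auto
    then show "(1 - u) powr qs_zrej Q \<le> (1 - u) ^ count_list bs False"
      using u by (simp add: powr_realpow)
  qed (use q u in auto)
  then show ?thesis
    using private_key_nth[OF k] d_pos by (subst verif_prob_eq) (auto simp: algebra_simps)
qed

text \<open>Each output is bounded by \<open>B\<close> times its own probability. For every key
  these probabilities add up to 1, so the number of possible outputs does not enter.
  \<open>x\<close> is the admissible averaged attack advantage at one position.\<close>

lemma forgery_bound:
  assumes A: "valid_adversary Q T A"
    and enc: "corrects_rate (qs_S Q) (qs_K Q) (qs_N Q) (qs_enc Q) \<theta>"
    and acc: "qs_zacc Q \<le> qs_zrej Q"
    and R: "0 < R" "R \<le> real n / 2" and Z: "Z > 1" and u: "0 \<le> u" "u < 1"
    and q0: "q0 = real (ell Q) / real d * (1 - 2 * R / real (ell Q))\<^sup>2"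
    and \<mu>: "\<mu> = real (ell Q) / real d - q0" "\<mu> \<ge> 0"
    and K: "exp (u * (1 - q0)) \<le> K"
    and x: "(1 + real n) ^ T * (K * u * (real (ell Q) / real d * (4 / (exp 1 * real (ell Q) * ln Z)) *
      (2 * (Z powr R * (1 + 1 / Z) ^ n)))) / 2 ^ n \<le> x"
  shows "(\<Sum>k\<in>private_keys Q. forge_prob Q T A k) / real (card (private_keys Q)) \<le>
    (1 - u) powr (- qs_zrej Q) *
      exp (real (qs_N Q) * (x - u * (1 - real (ell Q) / real d + 2 * \<theta> * \<mu>)))"
proof -
  define w where "w = (1 - u) powr (- qs_zrej Q)"
  define e where "e = exp (- u * real (qs_N Q) * (1 - real (ell Q) / real d + 2 * \<theta> * \<mu>))"
  define C where "C = K * u * (real (ell Q) / real d * (4 / (exp 1 * real (ell Q) * ln Z)) *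
      (2 * (Z powr R * (1 + 1 / Z) ^ n)))"
  define B where "B = w * exp (real (qs_N Q) * (x - u * (1 - real (ell Q) / real d + 2 * \<theta> * \<mu>)))"
  have w: "0 \<le> w" and e: "0 \<le> e"
    by (simp_all add: w_def e_def)
  have K_pos: "K > 0"
    using K exp_gt_zero[of "u * (1 - q0)"] by linarith
  have C: "0 \<le> C"
    unfolding C_def using K_pos u Z by (intro mult_nonneg_nonneg) auto
  have enc': "qs_enc Q m \<in> words (qs_S Q) (qs_N Q)" if "m \<in> messages Q" for m
    using enc that by (auto simp: corrects_rate_def messages_def)
  have single: "(\<Sum>k\<in>private_keys Q. output_prob T A m (m', r') k *
        verif_prob Q (public_key k) m' r' (- {REJ})) \<le>
      B * (\<Sum>k\<in>private_keys Q. output_prob T A m (m', r') k)"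
    if m: "m \<in> messages Q" "m' \<in> messages Q" "m \<noteq> m'" and r': "r' \<in> signatures Q" for m m' r'
  proof -
    define D where "D = {i. i < qs_N Q \<and> qs_enc Q m ! i \<noteq> qs_enc Q m' ! i}"
    have D: "finite D" "i \<in> D \<Longrightarrow> i < qs_N Q" "card D \<le> qs_N Q" for i
      using card_mono[of "{..<qs_N Q}" D] by (auto simp: D_def)
    have f: "(m', r') \<in> messages Q \<times> signatures Q"
      using m r' by simp
    obtain c where c: "\<And>i k. i \<in> D \<Longrightarrow> k \<in> private_keys Q \<Longrightarrow> 0 \<le> c i (k ! i)"
      "\<And>i k. i \<in> D \<Longrightarrow> k \<in> private_keys Q \<Longrightarrow>
        (\<Sum>H\<in>Pow (hidden Q (qs_enc Q m ! i)). c i (flip_key i H k ! i)) = C"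
      "\<And>k. k \<in> private_keys Q \<Longrightarrow>
        (\<Prod>i<qs_N Q. 1 - u * (1 - pass_prob Q (qs_enc Q m' ! i) (r' ! i) (k ! i))) \<le>
        e * (\<Prod>i\<in>D. 1 + c i (k ! i))"
      by (rule accept_weight_le[OF enc m r' R Z u q0 \<mu> K, folded D_def C_def e_def]) (rule that)
    have "(\<Sum>k\<in>private_keys Q. output_prob T A m (m', r') k *
          verif_prob Q (public_key k) m' r' (- {REJ})) \<le>
        (\<Sum>k\<in>private_keys Q. output_prob T A m (m', r') k * (w * (e * (\<Prod>i\<in>D. 1 + c i (k ! i)))))"
    proof (intro sum_mono mult_left_mono)
      fix k assume k: "k \<in> private_keys Q"
      show "0 \<le> output_prob T A m (m', r') k"
        by (rule output_prob_nonneg[OF A m(1) enc'[OF m(1)] k f])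
      have "verif_prob Q (public_key k) m' r' (- {REJ}) \<le>
          w * (\<Prod>i<qs_N Q. 1 - u * (1 - pass_prob Q (qs_enc Q m' ! i) (r' ! i) (k ! i)))"
        unfolding w_def by (rule verif_prob_not_rejected_le[OF k r' enc'[OF m(2)] u acc])
      also have "\<dots> \<le> w * (e * (\<Prod>i\<in>D. 1 + c i (k ! i)))"
        by (rule mult_left_mono[OF c(3)[OF k] w])
      finally show "verif_prob Q (public_key k) m' r' (- {REJ}) \<le> w * (e * (\<Prod>i\<in>D. 1 + c i (k ! i)))" .
    qed
    also have "\<dots> = w * e * (\<Sum>k\<in>private_keys Q. output_prob T A m (m', r') k * (\<Prod>i\<in>D. 1 + c i (k ! i)))"
      by (simp add: sum_distrib_left mult_ac)
    also have "\<dots> \<le> w * e * ((1 + (1 + real n) ^ T * C / 2 ^ n) ^ card D *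
        (\<Sum>k\<in>private_keys Q. output_prob T A m (m', r') k))"
    proof (rule mult_left_mono)
      show "(\<Sum>k\<in>private_keys Q. output_prob T A m (m', r') k * (\<Prod>i\<in>D. 1 + c i (k ! i))) \<le>
          (1 + (1 + real n) ^ T * C / 2 ^ n) ^ card D *
          (\<Sum>k\<in>private_keys Q. output_prob T A m (m', r') k)"
      proof (rule sum_prod_flip_bound[where f = flip_key and G = "\<lambda>i. Pow (hidden Q (qs_enc Q m ! i))"])
        show "c i (flip_key j H k ! i) = c i (k ! i)"
          if "i \<in> D" "j \<in> D" "i \<noteq> j" "k \<in> private_keys Q" for i j H k
          using that D private_key_nth(1)[of k] by (simp add: nth_flip_key)
        show "2 ^ n * output_prob T A m (m', r') k \<le>
            (1 + real n) ^ T * (\<Sum>H\<in>Pow (hidden Q (qs_enc Q m ! i)). output_prob T A m (m', r') (flip_key i H k))"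
          if "i \<in> D" "k \<in> private_keys Q" for i k
          by (rule output_prob_le_average[OF A m(1) enc'[OF m(1)] that(2) f D(2)[OF that(1)]])
        show "0 \<le> output_prob T A m (m', r') k" if "k \<in> private_keys Q" for k
          by (rule output_prob_nonneg[OF A m(1) enc'[OF m(1)] that f])
      qed (use D(1) c flip_key_private_keys in auto)
      show "0 \<le> w * e"
        using w e by simp
    qed
    \<comment> \<open>\<open>card D\<close> varies with the output, so the cost is charged to all
      \<open>N\<close> positions to obtain a uniform factor.\<close>
    also have "\<dots> \<le> w * e * (exp (real (qs_N Q) * x) * (\<Sum>k\<in>private_keys Q. output_prob T A m (m', r') k))"
    proof (intro mult_left_mono mult_right_mono)
      have x0: "0 \<le> (1 + real n) ^ T * C / 2 ^ n"
        using C by simp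
      have "(1 + (1 + real n) ^ T * C / 2 ^ n) ^ card D \<le> (1 + (1 + real n) ^ T * C / 2 ^ n) ^ qs_N Q"
        using x0 D(3) by (intro power_increasing) auto
      also have "\<dots> \<le> exp x ^ qs_N Q"
      proof (rule power_mono)
        have "1 + (1 + real n) ^ T * C / 2 ^ n \<le> 1 + x"
          using x by (simp add: C_def)
        also have "\<dots> \<le> exp x"
          by (rule exp_ge_add_one_self)
        finally show "1 + (1 + real n) ^ T * C / 2 ^ n \<le> exp x" .
      qed (use x0 in auto)
      finally show "(1 + (1 + real n) ^ T * C / 2 ^ n) ^ card D \<le> exp (real (qs_N Q) * x)"
        by (simp add: exp_of_nat_mult)
      show "0 \<le> (\<Sum>k\<in>private_keys Q. output_prob T A m (m', r') k)"
        by (intro sum_nonneg output_prob_nonneg[OF A m(1) enc'[OF m(1)] _ f])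
      show "0 \<le> w * e"
        using w e by simp
    qed
    also have "w * e * (exp (real (qs_N Q) * x) * (\<Sum>k\<in>private_keys Q. output_prob T A m (m', r') k)) =
        w * (e * exp (real (qs_N Q) * x)) * (\<Sum>k\<in>private_keys Q. output_prob T A m (m', r') k)"
      by (simp add: mult_ac)
    also have "e * exp (real (qs_N Q) * x) =
        exp (real (qs_N Q) * (x - u * (1 - real (ell Q) / real d + 2 * \<theta> * \<mu>)))"
      unfolding e_def exp_add[symmetric] by (rule arg_cong[of _ _ exp]) (simp add: algebra_simps)
    finally show ?thesis
      by (simp add: B_def)
  qed
  have B: "0 \<le> B"
    using w by (simp add: B_def)
  let ?P = "\<lambda>m. {(m', r') \<in> messages Q \<times> signatures Q. m' \<noteq> m}"
  have fin: "finite (messages Q \<times> signatures Q)"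
    by simp
  have "(\<Sum>k\<in>private_keys Q. forge_prob Q T A k) =
      (\<Sum>k\<in>private_keys Q. \<Sum>m\<in>messages Q. \<Sum>f\<in>?P m. output_prob T A m f k *
        verif_prob Q (public_key k) (fst f) (snd f) (- {REJ}))"
    unfolding forge_prob_def output_prob_def by (simp add: case_prod_beta)
  also have "\<dots> = (\<Sum>m\<in>messages Q. \<Sum>f\<in>?P m. \<Sum>k\<in>private_keys Q. output_prob T A m f k *
        verif_prob Q (public_key k) (fst f) (snd f) (- {REJ}))"
    by (subst sum.swap, intro sum.cong refl, rule sum.swap)
  also have "\<dots> \<le> (\<Sum>m\<in>messages Q. \<Sum>f\<in>?P m. B * (\<Sum>k\<in>private_keys Q. output_prob T A m f k))"
    using single by (intro sum_mono) auto
  also have "\<dots> \<le> (\<Sum>m\<in>messages Q. \<Sum>f\<in>messages Q \<times> signatures Q. B * (\<Sum>k\<in>private_keys Q. output_prob T A m f k))"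
  proof (intro sum_mono sum_mono2[OF fin])
    fix m f assume m: "m \<in> messages Q" and "f \<in> messages Q \<times> signatures Q - ?P m"
    then show "0 \<le> B * (\<Sum>k\<in>private_keys Q. output_prob T A m f k)"
      by (intro mult_nonneg_nonneg B sum_nonneg output_prob_nonneg[OF A m enc'[OF m]]) auto
  qed auto
  also have "\<dots> = B * (\<Sum>k\<in>private_keys Q. \<Sum>m\<in>messages Q. \<Sum>f\<in>messages Q \<times> signatures Q. output_prob T A m f k)"
    unfolding sum_distrib_left[symmetric] by (subst sum_swap3[symmetric]) (rule refl)
  also have "\<dots> = B * real (card (private_keys Q))"
    using sum_output_prob[OF A enc'] by simp
  finally have "(\<Sum>k\<in>private_keys Q. forge_prob Q T A k) \<le> B * real (card (private_keys Q))" .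
  moreover have "0 < card (private_keys Q)"
    using private_keys_nonempty by (simp add: card_gt_0_iff)
  ultimately show ?thesis
    by (simp add: pos_divide_le_eq B_def w_def)
qed

text \<open>The upper tail with \<open>z = 1 + \<delta>\<close>: for an honest signature every
  position fails with the same probability \<open>1 - ell / d\<close>, independently of the
  others.\<close>

lemma correctness_bound:
  assumes k: "k \<in> private_keys Q" and enc: "qs_enc Q m \<in> words (qs_S Q) (qs_N Q)"
    and \<delta>: "0 \<le> \<delta>"
  shows "1 - (1 + \<delta>) powr (- qs_zacc Q) * exp (real (qs_N Q) * (1 - real (ell Q) / real d) * \<delta>) \<le>
    verif_prob Q (public_key k) m (sign Q k m) {ACC1}"
proof -
  let ?p = "real (ell Q) / real d"
  let ?pr = "\<lambda>bs. \<Prod>i<qs_N Q. if bs ! i then ?p else 1 - ?p"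
  let ?L = "{bs :: bool list. length bs = qs_N Q}"
  let ?good = "{bs. length bs = qs_N Q \<and> verdict_of Q (count_list bs False) \<in> {ACC1}}"
  have sym: "qs_enc Q m ! i < qs_S Q" if "i < qs_N Q" for i
    using enc that by (rule words_nth)
  have pass: "pass_prob Q (qs_enc Q m ! i) (sign Q k m ! i) (k ! i) = ?p" if "i < qs_N Q" for i
    using that private_key_nth[OF k] sym by (simp add: sign_def pass_prob_honest)
  have p: "0 \<le> ?p" "?p \<le> 1"
    using d_pos by (auto simp: ell_eq)
  have fin: "finite ?L"
    using finite_lists_length_eq[of "UNIV :: bool set" "qs_N Q"] by simp
  have verif: "verif_prob Q (public_key k) m (sign Q k m) {ACC1} = (\<Sum>bs\<in>?good. ?pr bs)"
    using private_key_nth[OF k] d_pos by (subst verif_prob_eq) (auto simp: pass intro!: sum.cong prod.cong)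
  have "(\<Sum>bs\<in>?L - ?good. ?pr bs) \<le> (1 + \<delta>) powr (- qs_zacc Q) * (\<Prod>i<qs_N Q. ?p + (1 + \<delta>) * (1 - ?p))"
  proof (rule sum_restricted_le)
    fix bs assume "bs \<in> ?L - ?good"
    then have "qs_zacc Q \<le> real (count_list bs False)"
      by (auto simp: verdict_of_def split: if_splits)
    then have "(1 + \<delta>) powr qs_zacc Q \<le> (1 + \<delta>) powr real (count_list bs False)"
      using \<delta> by (intro powr_mono) auto
    then show "(1 + \<delta>) powr qs_zacc Q \<le> (1 + \<delta>) ^ count_list bs False"
      using \<delta> by (simp add: powr_realpow)
  qed (use p \<delta> in auto)
  also have "\<dots> \<le> (1 + \<delta>) powr (- qs_zacc Q) * exp (real (qs_N Q) * (1 - ?p) * \<delta>)"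
  proof (rule mult_left_mono)
    have "p + (1 + \<delta>) * (1 - p) = 1 + (1 - p) * \<delta>" for p
      by (simp add: algebra_simps)
    then have "(\<Prod>i<qs_N Q. ?p + (1 + \<delta>) * (1 - ?p)) = (1 + (1 - ?p) * \<delta>) ^ qs_N Q"
      by (simp only: prod_constant card_lessThan)
    also have "\<dots> \<le> exp ((1 - ?p) * \<delta>) ^ qs_N Q"
      using p \<delta> by (intro power_mono exp_ge_add_one_self add_nonneg_nonneg) auto
    finally show "(\<Prod>i<qs_N Q. ?p + (1 + \<delta>) * (1 - ?p)) \<le> exp (real (qs_N Q) * (1 - ?p) * \<delta>)"
      by (simp add: exp_of_nat_mult mult.assoc)
  qed auto
  finally have bad: "(\<Sum>bs\<in>?L - ?good. ?pr bs) \<le>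
      (1 + \<delta>) powr (- qs_zacc Q) * exp (real (qs_N Q) * (1 - ?p) * \<delta>)" .
  have "(\<Sum>bs\<in>?L. ?pr bs) = (\<Sum>bs\<in>?L - ?good. ?pr bs) + (\<Sum>bs\<in>?good. ?pr bs)"
    by (rule sum.subset_diff[OF _ fin]) auto
  moreover have "(\<Sum>bs\<in>?L. ?pr bs) = 1"
    by (rule sum_lists_prod)
  ultimately show ?thesis
    using bad unfolding verif by linarith
qed

end

section \<open>The parameters of the scheme\<close>

lemma le_log2_of_power:
  assumes "(2::real) ^ a \<le> x ^ b" "0 < x" "0 < b"
  shows "real a / real b \<le> log 2 x"
proof -
  have "log 2 (2 ^ a) \<le> log 2 (x ^ b)"
    using assms by (subst log_le_cancel_iff) auto
  then have "real a \<le> real b * log 2 x"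
    using assms by (simp add: log_nat_power)
  then show ?thesis
    using assms by (simp add: field_simps)
qed

text \<open>The hypothesis \<open>gap\<close> amounts to
  \<open>2 * p * sqrt n > sqrt (8 / 3) / 2\<close>, which is at least \<open>4 / 5\<close>, while
  the parabola bound gives \<open>sqrt L \<le> sqrt n * (1 - 2 * p)\<close>.\<close>

lemma sqrt_gap:
  fixes n :: nat
  assumes n: "n \<ge> 1" and p: "0 < p" "p \<le> 1 / 2"
    and h: "L / real n \<le> 1 - bin_entropy p"
    and gap: "sqrt (8 / 3) * sqrt (real n) < 4 * (real n * p)"
  shows "sqrt L + 4 / 5 < sqrt (real n)"
proof -
  have sn: "sqrt (real n) > 0" "real n = sqrt (real n) * sqrt (real n)"
    using n by auto
  have "4 * p * sqrt (real n) * sqrt (real n) = 4 * p * (sqrt (real n) * sqrt (real n))"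
    by (simp only: mult.assoc)
  also have "\<dots> = 4 * (real n * p)"
    by simp
  finally have "sqrt (8 / 3) * sqrt (real n) < 4 * p * sqrt (real n) * sqrt (real n)"
    using gap by (simp only:)
  then have "sqrt (8 / 3) < 4 * p * sqrt (real n)"
    using sn(1) by simp
  moreover have "8 / 5 \<le> sqrt (8 / 3 :: real)"
    by (rule real_le_rsqrt) (simp add: power2_eq_square)
  ultimately have p': "4 / 5 < 2 * p * sqrt (real n)"
    by simp
  have "sqrt (L / real n) \<le> sqrt ((1 - 2 * p)\<^sup>2)"
    using h bin_entropy_ge_parabola[OF p] by (intro real_sqrt_le_mono) simp
  also have "\<dots> = 1 - 2 * p"
    using p by simp
  finally have "sqrt L \<le> sqrt (real n) * (1 - 2 * p)"
    using sn(1) by (simp add: real_sqrt_divide pos_divide_le_eq mult.commute)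
  with p' show ?thesis
    by (simp add: algebra_simps)
qed

text \<open>A bootstrap with \<open>d >= 2 * n\<close>: a bound on \<open>d\<close> bounds its
  logarithm, and \<open>sqrt_gap\<close> turns this into a larger \<open>n\<close>. From
  \<open>d >= 2\<close> comes \<open>n >= 4\<close>, and from \<open>d >= 8\<close> comes
  \<open>n >= 7\<close>.\<close>

lemma block_size_ge_7:
  fixes n S :: nat
  assumes n: "n \<ge> 1" and S: "S \<ge> 2" and p: "0 < p" "p \<le> 1 / 2"
    and h: "log 2 (real (n * S)) / real n \<le> 1 - bin_entropy p"
    and gap: "sqrt (8 / 3) * sqrt (real n) < 4 * (real n * p)"
  shows "7 \<le> n"
proof -
  let ?L = "log 2 (real (n * S))"
  note bound = sqrt_gap[OF n p h gap]
  have d: "2 * real n \<le> real (n * S)"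
    using of_nat_mono[OF mult_le_mono2[OF S, of n], where 'a = real] by simp
  have step: "n \<ge> k" if "(real k - 1) \<le> (sqrt ?L + 4 / 5)\<^sup>2" "0 \<le> ?L" for k :: nat
  proof -
    have "(sqrt ?L + 4 / 5)\<^sup>2 < (sqrt (real n))\<^sup>2"
      using bound that(2) by (intro power_strict_mono) auto
    then have "real k - 1 < real n"
      using that by simp
    then show ?thesis by simp
  qed
  have "2 \<le> real (n * S)"
    using d n by linarith
  then have "real 1 / real 1 \<le> ?L"
    by (intro le_log2_of_power) simp_all
  then have L1: "1 \<le> ?L" by simp
  then have "1 \<le> sqrt ?L"
    by simp
  then have "(9 / 5)\<^sup>2 \<le> (sqrt ?L + 4 / 5)\<^sup>2"
    by (intro power_mono) auto
  then have "n \<ge> 4"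
    using L1 by (intro step) (simp_all add: power2_eq_square)
  then have "4 \<le> real n"
    by simp
  then have "8 \<le> real (n * S)"
    using d by linarith
  then have "real 3 / real 1 \<le> ?L"
    by (intro le_log2_of_power) auto
  then have L3: "3 \<le> ?L" by simp
  have "17 / 10 \<le> sqrt ?L"
    using L3 by (intro real_le_rsqrt) (simp add: power2_eq_square)
  then have "(25 / 10)\<^sup>2 \<le> (sqrt ?L + 4 / 5)\<^sup>2"
    by (intro power_mono) auto
  then show ?thesis
    using L3 by (intro step) (simp_all add: power2_eq_square)
qed

text \<open>The tilted sum at \<open>p\<close> equals \<open>2 ^ n / d ^ T\<close>, which cancels
  \<open>2 ^ n\<close> and reduces the count of characters to \<open>((1 + n) / d) ^ T\<close>; this
  is at most \<open>(1 + n) / d\<close>, the origin of the factor \<open>1 / S\<close>. The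
  remaining numbers have to stay below \<open>sqrt (8 / 3)\<close>.\<close>

lemma attack_advantage_le:
  fixes n S T :: nat and l p :: real
  assumes n: "n \<ge> 1" and S: "S \<ge> 2" and T: "T \<ge> 1" and p: "0 < p" "p \<le> 1 / 2" and l: "l > 0"
    and h: "bin_entropy p = 1 - real T * log 2 (real (n * S)) / real n"
    and gap: "sqrt (8 / 3) * sqrt (real n) < 4 * (real n * p)"
  defines "Z \<equiv> (1 - p) / p"
  shows "(1 + real n) ^ T * (exp (27 / 50) * (4 / (exp 1 * l * ln Z) *
      (2 * (Z powr (real n * p) * (1 + 1 / Z) ^ n)))) / 2 ^ n
    \<le> 1 / real S * (sqrt (8 / 3) * (sqrt (real n) / l))" and "Z > 1"
proof -
  let ?d = "real (n * S)"
  let ?L = "log 2 ?d"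
  have d: "2 * real n \<le> ?d"
    using of_nat_mono[OF mult_le_mono2[OF S, of n], where 'a = real] by simp
  have "2 \<le> real (n * S)"
    using d n by linarith
  then have "real 1 / real 1 \<le> ?L"
    by (intro le_log2_of_power) simp_all
  then have "?L * 1 \<le> ?L * real T"
    using T by (intro mult_left_mono) auto
  then have h': "?L / real n \<le> 1 - bin_entropy p"
    using n by (simp add: h divide_right_mono mult.commute)
  have n7: "7 \<le> n"
    by (rule block_size_ge_7[OF n S p h' gap])
  then have "7 \<le> real n"
    by simp
  then have d14: "14 \<le> ?d"
    using d by linarith
  \<comment> \<open>\<open>14 ^ 2 = 196\<close> exceeds \<open>2 ^ 7 = 128\<close>; the bound
    \<open>7 / 2\<close> on the logarithm obtained from this makes its root at least
    \<open>9 / 5\<close>.\<close>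
  have "(2::real) ^ 7 \<le> ?d ^ 2"
    using power_mono[OF d14, of 2] by simp
  then have "real 7 / real 2 \<le> ?L"
    by (rule le_log2_of_power) (use d14 in auto)
  then have L7: "7 / 2 \<le> ?L"
    by simp
  have L: "9 / 5 \<le> sqrt ?L" "?L > 0"
    by (rule real_le_rsqrt, use L7 in \<open>simp add: power2_eq_square\<close>) (use L7 in linarith)
  have "2 * sqrt (?L / real n) \<le> 2 * sqrt (1 - bin_entropy p)"
    using h' by simp
  also have "\<dots> \<le> ln Z"
    unfolding Z_def by (rule log_odds_ge_bin_entropy[OF p])
  finally have lnZ: "2 * sqrt ?L / sqrt (real n) \<le> ln Z"
    by (simp add: real_sqrt_divide)
  have sn: "sqrt (real n) > 0"
    using n by simp
  have "0 < 2 * sqrt ?L / sqrt (real n)"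
    using L(2) sn by simp
  with lnZ have lnZ_pos: "ln Z > 0"
    by linarith
  have "Z > 0"
    using p by (simp add: Z_def)
  with lnZ_pos show "Z > 1"
    by simp
  have "Z powr (real n * p) * (1 + 1 / Z) ^ n = 2 powr (real n * bin_entropy p)"
    unfolding Z_def using p by (intro two_powr_bin_entropy[symmetric]) auto
  also have "real n * bin_entropy p = real n - real T * ?L"
    using n by (simp add: h field_simps)
  also have "2 powr (real n - real T * ?L) = 2 ^ n / ?d ^ T"
  proof -
    have "2 powr (real T * ?L) = (2 powr ?L) powr real T"
      by (simp add: powr_powr mult.commute)
    also have "\<dots> = ?d ^ T"
      using d14 by (simp add: powr_realpow)
    finally show ?thesis
      by (simp add: powr_diff powr_realpow)
  qed
  finally have vol: "Z powr (real n * p) * (1 + 1 / Z) ^ n = 2 ^ n / ?d ^ T" .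
  have "1 + real n \<le> ?d"
    using d \<open>7 \<le> real n\<close> by linarith
  then have "(1 + real n) / ?d \<le> 1" "0 \<le> (1 + real n) / ?d"
    using d14 by (simp_all only: divide_le_eq_1_pos) auto
  then have "((1 + real n) / ?d) ^ T \<le> ((1 + real n) / ?d) ^ 1"
    using T by (intro power_decreasing) auto
  then have ratio: "(1 + real n) ^ T / ?d ^ T \<le> (1 + real n) / ?d"
    by (simp add: power_divide)
  have exp_le: "exp (27 / 50) / exp 1 \<le> (16 / 25 :: real)"
  proof -
    \<comment> \<open>The quadratic Taylor polynomial at \<open>23 / 50 = 1 - 27 / 50\<close> is
      1.5658, just above \<open>25 / 16 = 1.5625\<close>.\<close>
    have "1 + 23 / 50 + (23 / 50)\<^sup>2 / 2 \<le> exp (23 / 50 :: real)"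
      by (rule exp_lower_Taylor_quadratic) simp
    then have "25 / 16 \<le> exp (23 / 50 :: real)"
      by (simp add: power2_eq_square)
    then have "inverse (exp (23 / 50)) \<le> (inverse (25 / 16) :: real)"
      by (intro le_imp_inverse_le) auto
    moreover have "exp (27 / 50) / exp 1 = inverse (exp (23 / 50 :: real))"
      by (simp add: exp_diff[symmetric] exp_minus[symmetric])
    ultimately show ?thesis
      by simp
  qed
  have lhs: "(1 + real n) ^ T * (exp (27 / 50) * (4 / (exp 1 * l * ln Z) *
      (2 * (2 ^ n / ?d ^ T)))) / 2 ^ n = (1 + real n) ^ T / ?d ^ T * (exp (27 / 50) / exp 1) * (8 / l) / ln Z"
    by (simp add: mult_ac)
  have "(1 + real n) ^ T / ?d ^ T * (exp (27 / 50) / exp 1) * (8 / l) / ln Z \<le>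
      (1 + real n) / ?d * (16 / 25) * (8 / l) / ln Z"
    using l lnZ_pos exp_le ratio by (intro divide_right_mono mult_right_mono mult_mono) auto
  also have "\<dots> \<le> (1 + real n) / ?d * (16 / 25) * (8 / l) / (2 * sqrt ?L / sqrt (real n))"
    using l lnZ L(2) sn lnZ_pos by (intro divide_left_mono mult_nonneg_nonneg mult_pos_pos) auto
  also have "\<dots> \<le> (1 + real n) / ?d * (16 / 25) * (8 / l) / (2 * (9 / 5) / sqrt (real n))"
    using l L sn by (intro divide_left_mono divide_right_mono mult_left_mono mult_nonneg_nonneg mult_pos_pos divide_pos_pos) auto
  also have "\<dots> = (1 + real n) / real n * (64 / 45) * (1 / real S * (sqrt (real n) / l))"
    using n S l by (simp add: field_simps)
  \<comment> \<open>\<open>8 / 7\<close> comes from \<open>n >= 7\<close>, and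
    \<open>64 / 45\<close> is \<open>16 / 25 * 8 / (18 / 5)\<close>. Their product
    \<open>512 / 315\<close>, about 1.625, is just below \<open>sqrt (8 / 3)\<close>, about 1.633;
    with \<open>n = 6\<close> it would be too large.\<close>
  also have "\<dots> \<le> 8 / 7 * (64 / 45) * (1 / real S * (sqrt (real n) / l))"
    using n7 l S by (intro mult_right_mono) (auto simp: field_simps)
  also have "\<dots> \<le> sqrt (8 / 3) * (1 / real S * (sqrt (real n) / l))"
    using l by (intro mult_right_mono real_le_rsqrt) (auto simp: power2_eq_square)
  finally show "(1 + real n) ^ T * (exp (27 / 50) * (4 / (exp 1 * l * ln Z) *
      (2 * (Z powr (real n * p) * (1 + 1 / Z) ^ n)))) / 2 ^ n
    \<le> 1 / real S * (sqrt (8 / 3) * (sqrt (real n) / l))"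
    unfolding vol lhs by (simp add: mult_ac)
qed

text \<open>For \<open>\<delta> = a / sqrt M\<close> one has
  \<open>M * \<delta>^2 = a^2 = 3 * ln (1 / \<epsilon>)\<close>, so the exponent bound gives
  precisely \<open>\<epsilon>\<close>. The hypothesis \<open>a \<le> sqrt M\<close> is its condition
  \<open>\<delta> \<le> 1\<close>.\<close>

lemma chernoff_upper:
  fixes M \<epsilon> :: real
  assumes M: "M > 0" and \<epsilon>: "0 < \<epsilon>" "\<epsilon> < 1"
  defines "a \<equiv> sqrt (3 * ln (1 / \<epsilon>))"
  assumes a: "a \<le> sqrt M"
  shows "(1 + a / sqrt M) powr (- (M + sqrt M * a)) * exp (M * (a / sqrt M)) \<le> \<epsilon>"
proof -
  define \<delta> where "\<delta> = a / sqrt M"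
  have sM: "sqrt M > 0" "M = sqrt M * sqrt M"
    using M by auto
  have a0: "0 \<le> a"
    using \<epsilon> by (simp add: a_def)
  have \<delta>: "0 \<le> \<delta>" "\<delta> \<le> 1"
    using a a0 sM by (auto simp: \<delta>_def)
  have "sqrt M * a = M * \<delta>"
    using sM by (simp add: \<delta>_def field_simps)
  then have "(1 + \<delta>) powr (- (M + sqrt M * a)) * exp (M * \<delta>) = exp (M * (\<delta> - (1 + \<delta>) * ln (1 + \<delta>)))"
    using \<delta> by (simp add: powr_def exp_add[symmetric] algebra_simps)
  also have "\<dots> \<le> exp (M * (- \<delta>\<^sup>2 / 3))"
    using chernoff_upper_exponent[OF \<delta>] M by (simp only: exp_le_cancel_iff mult_left_mono)
  also have "M * (- \<delta>\<^sup>2 / 3) = ln \<epsilon>"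
  proof -
    have "M * \<delta>\<^sup>2 = a\<^sup>2"
      using M by (simp add: \<delta>_def power_divide)
    also have "a\<^sup>2 = - 3 * ln \<epsilon>"
      using \<epsilon> by (simp add: a_def ln_div)
    finally show ?thesis by simp
  qed
  finally show ?thesis
    using \<epsilon> by (simp add: \<delta>_def)
qed

text \<open>The analogous computation for the lower tail: with \<open>u = b / sqrt E\<close> one has
  \<open>E * u^2 = 2 * ln (1 / \<epsilon>)\<close>.\<close>

lemma chernoff_lower:
  fixes E \<epsilon> :: real
  assumes E: "E > 0" and \<epsilon>: "0 < \<epsilon>" "\<epsilon> < 1"
  defines "b \<equiv> sqrt (2 * ln (1 / \<epsilon>))"
  assumes b: "b < sqrt E"
  shows "(1 - b / sqrt E) powr (- (E - sqrt E * b)) * exp (- (b / sqrt E) * E) \<le> \<epsilon>"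
proof -
  define u where "u = b / sqrt E"
  have sE: "sqrt E > 0" "E = sqrt E * sqrt E"
    using E by auto
  have b0: "0 \<le> b"
    using \<epsilon> by (simp add: b_def)
  have u: "0 \<le> u" "u < 1"
    using b b0 sE by (auto simp: u_def)
  have "sqrt E * b = E * u"
    using sE by (simp add: u_def field_simps)
  then have "(1 - u) powr (- (E - sqrt E * b)) * exp (- u * E) = exp (E * (- u - (1 - u) * ln (1 - u)))"
    using u by (simp add: powr_def exp_add[symmetric] algebra_simps)
  also have "\<dots> \<le> exp (E * (- u\<^sup>2 / 2))"
    using chernoff_lower_exponent[OF u] E by (simp only: exp_le_cancel_iff mult_left_mono)
  also have "E * (- u\<^sup>2 / 2) = ln \<epsilon>"
  proof -
    have "E * u\<^sup>2 = b\<^sup>2"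
      using E by (simp add: u_def power_divide)
    also have "b\<^sup>2 = - 2 * ln \<epsilon>"
      using \<epsilon> by (simp add: b_def ln_div)
    finally show ?thesis by simp
  qed
  finally show ?thesis
    using \<epsilon> by (simp add: u_def)
qed

text \<open>\<open>\<mu>\<close> increases with \<open>v\<close>. At the largest \<open>v\<close>,
  which belongs to \<open>p = 1 / 2\<close>, it is
  \<open>\<alpha> * (2 - 3 * \<alpha>) / (1 - \<alpha>)\<close>, whose maximum over
  \<open>\<alpha>\<close> is \<open>4 - 2 * sqrt 3\<close>, about 0.536; \<open>27 / 50\<close>
  rounds this up.\<close>

lemma overlap_loss_le:
  fixes \<alpha> v :: real
  assumes \<alpha>: "0 < \<alpha>" "\<alpha> \<le> 1 / 2" and v: "0 \<le> v" "v \<le> \<alpha> / (2 * (1 - \<alpha>))"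
  defines "\<mu> \<equiv> (1 - \<alpha>) * (1 - (1 - 2 * v)\<^sup>2)"
  shows "\<mu> \<le> 2 * \<alpha>" "\<mu> \<le> 27 / 50" "0 \<le> \<mu>"
proof -
  define w where "w = \<alpha> / (2 * (1 - \<alpha>))"
  have w: "w \<le> 1 / 2" "0 \<le> w" "2 * (1 - \<alpha>) * w = \<alpha>"
    using \<alpha> by (auto simp: w_def field_simps)
  have vw: "v \<le> w"
    using v by (simp add: w_def)
  have "(1 - 2 * w)\<^sup>2 \<le> (1 - 2 * v)\<^sup>2"
    using vw w by (intro power_mono) auto
  then have "\<mu> \<le> (1 - \<alpha>) * (1 - (1 - 2 * w)\<^sup>2)"
    unfolding \<mu>_def using \<alpha> by (intro mult_left_mono) auto
  also have "\<dots> = 2 * (2 * (1 - \<alpha>) * w) * (1 - w)"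
    by (simp add: power2_eq_square algebra_simps)
  finally have \<mu>: "\<mu> \<le> 2 * \<alpha> * (1 - w)"
    using w by simp
  also have "\<dots> \<le> 2 * \<alpha> * 1"
    using \<alpha> w by (intro mult_left_mono) auto
  finally show "\<mu> \<le> 2 * \<alpha>" by simp
  \<comment> \<open>\<open>127 / 300\<close> is the vertex of
    \<open>3 * \<alpha>^2 - 127 / 50 * \<alpha> + 27 / 50\<close>, whose nonnegativity is claimed
    next.\<close>
  have "0 \<le> 3 * (\<alpha> - 127 / 300)\<^sup>2"
    by simp
  then have "\<alpha> * (2 - 3 * \<alpha>) \<le> 27 / 50 * (1 - \<alpha>)"
    by (simp add: power2_eq_square algebra_simps)
  moreover have "2 * \<alpha> * (1 - w) = \<alpha> * (2 - 3 * \<alpha>) / (1 - \<alpha>)"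
    using \<alpha> by (simp add: w_def field_simps)
  ultimately have "2 * \<alpha> * (1 - w) \<le> 27 / 50"
    using \<alpha> by (simp add: pos_divide_le_eq)
  with \<mu> show "\<mu> \<le> 27 / 50" by linarith
  have "(1 - 2 * v)\<^sup>2 \<le> 1\<^sup>2"
    using v vw w by (intro power_mono) auto
  then show "0 \<le> \<mu>"
    unfolding \<mu>_def using \<alpha> by simp
qed

text \<open>The thresholds are ordered because the gap is at most \<open>2 \<alpha>\<close>, so that
  \<open>1 + (1 + \<nu>) gap \<le> 1 + 4 \<theta>\<close>.\<close>

lemma thresholds_ordered:
  fixes M \<nu> \<alpha> \<theta> gap a b :: real
  assumes M: "sqrt M * gap = a + sqrt (1 + 4 * \<theta>) * b" and M0: "0 \<le> M"
    and gap: "0 < gap" "gap \<le> 2 * \<alpha>" and \<nu>: "0 \<le> \<nu>" and \<theta>: "\<theta> = \<alpha> / 2 * (1 + \<nu>)"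
    and ab: "0 \<le> a" "0 \<le> b"
  defines "E \<equiv> M * (1 + (1 + \<nu>) * gap)"
  shows "M + sqrt M * a \<le> E - sqrt E * b"
proof -
  have "(1 + \<nu>) * gap \<le> (1 + \<nu>) * (2 * \<alpha>)"
    using gap \<nu> by (intro mult_left_mono) auto
  also have "\<dots> = 4 * \<theta>"
    by (simp add: \<theta> algebra_simps)
  finally have "sqrt (1 + (1 + \<nu>) * gap) \<le> sqrt (1 + 4 * \<theta>)"
    by simp
  then have le: "a + sqrt (1 + (1 + \<nu>) * gap) * b \<le> sqrt M * gap"
    unfolding M using ab by (intro add_left_mono mult_right_mono)
  have "sqrt E = sqrt M * sqrt (1 + (1 + \<nu>) * gap)"
    unfolding E_def by (rule real_sqrt_mult)
  then have "sqrt M * a + sqrt E * b = sqrt M * (a + sqrt (1 + (1 + \<nu>) * gap) * b)"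
    by (simp add: algebra_simps)
  also have "\<dots> \<le> sqrt M * (sqrt M * gap)"
    using le M0 by (intro mult_left_mono) auto
  also have "\<dots> = M * gap"
    using M0 by (simp flip: mult.assoc)
  also have "\<dots> \<le> M * ((1 + \<nu>) * gap)"
    using gap \<nu> M0 by (intro mult_left_mono) (auto simp: algebra_simps)
  finally show ?thesis
    by (simp add: E_def algebra_simps)
qed

theorem proposition6p6:
  fixes S d T K N l :: nat
    and \<alpha> \<phi> p1 \<nu> \<theta> \<epsilon>c \<epsilon>f zacc zrej :: real
    and enc :: "nat list \<Rightarrow> nat list"
  assumes conjecture: "\<forall>x \<ge> 1. antimono_on {r. 1 \<le> r \<and> real r \<le> real x / 2} (ball_ratio x)"
    and "S \<ge> 2" and "d \<ge> 2" and "T \<ge> 1" and "S dvd d"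
    and "\<alpha> = 1 / real S"
    and "l = d - d div S"
    and "\<phi> = real T * (log 2 (real d) / real d)"
    and "\<phi> \<le> \<alpha>"
    and "p1 = (1 - \<alpha>) * ((1 - \<alpha> / (1 - \<alpha>) * (2 * bin_entropy_inv (1 - \<phi> / \<alpha>))) ^ 2
                        + sqrt (8 / 3) * (sqrt (real (d - l)) / real l))"
    and "1 - p1 > \<alpha>"
    and "0 < \<epsilon>c" and "\<epsilon>c < 1" and "0 < \<epsilon>f" and "\<epsilon>f < 1"
    and "\<nu> > \<alpha>"
    and "\<theta> = \<alpha> / 2 * (1 + \<nu>)"
    and "N > 0"
    and "real N = 1 / \<alpha> ^ 3 *
           ((sqrt (3 * ln (1 / \<epsilon>c)) + sqrt (1 + 4 * \<theta>) * sqrt (2 * ln (1 / \<epsilon>f)))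
            / ((1 - p1 - \<alpha>) / \<alpha>)) ^ 2"
    and "zacc = real N * \<alpha> + sqrt (real N * \<alpha>) * sqrt (3 * ln (1 / \<epsilon>c))"
    and "zrej = (1 - 2 * \<theta>) * real N * \<alpha> + 2 * \<theta> * real N * (1 - p1)
           - sqrt ((1 - 2 * \<theta>) * real N * \<alpha> + 2 * \<theta> * real N * (1 - p1))
             * sqrt (2 * ln (1 / \<epsilon>f))"
    and "corrects_rate S K N enc \<theta>"
  defines "Q \<equiv> \<lparr>qs_d = d, qs_S = S, qs_K = K, qs_N = N, qs_enc = enc,
                 qs_zacc = zacc, qs_zrej = zrej\<rparr>"
  shows "correct Q \<epsilon>c \<and> secure_forgery Q T \<epsilon>f"
proof -
  note S = assms(2) and d = assms(3) and T = assms(4) and dvd = assms(5)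
    and \<alpha>_eq = assms(6) and l_eq = assms(7) and \<phi>_eq = assms(8) and \<phi>_le = assms(9)
    and p1_eq = assms(10) and p1_less = assms(11) and \<epsilon>c = assms(12,13) and \<epsilon>f = assms(14,15)
    and \<nu> = assms(16) and \<theta>_eq = assms(17) and N_pos = assms(18) and N_eq = assms(19)
    and zacc_eq = assms(20) and zrej_eq = assms(21) and enc = assms(22)
  have Q: "qs_d Q = d" "qs_S Q = S" "qs_K Q = K" "qs_N Q = N" "qs_enc Q = enc"
    "qs_zacc Q = zacc" "qs_zrej Q = zrej"
    by (simp_all add: Q_def)
  interpret signature_scheme Q
    by unfold_locales (use S d dvd in \<open>auto simp: Q\<close>)
  define n where "n = d div S"
  have n: "n \<ge> 1" and d_eq: "d = n * S" and l: "ell Q = l"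
    using n_pos n_mult_S by (simp_all add: n_def l_eq Q ell_def)
  have real_d: "real d = real n * real S"
    by (simp add: d_eq)
  have l_real: "real l = real d - real n" and d_l: "d - l = n"
    using n_less_d by (simp_all add: l_eq n_def Q of_nat_diff)
  have l_pos: "0 < real l"
    using ell_pos l by simp
  have \<alpha>: "0 < \<alpha>" "\<alpha> \<le> 1 / 2"
    using S by (auto simp: \<alpha>_eq field_simps)
  have S_real: "real S = 1 / \<alpha>"
    using S by (simp add: \<alpha>_eq)
  have l_d: "real l / real d = 1 - \<alpha>"
    unfolding l_real real_d using n S by (simp add: \<alpha>_eq field_simps)
  have n_l: "real n / real l = \<alpha> / (1 - \<alpha>)"
  proof -
    have "real n = \<alpha> * real d"
      using S by (simp add: real_d \<alpha>_eq)
    moreover have "real l = (1 - \<alpha>) * real d"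
      using l_d d by (simp add: field_simps)
    ultimately show ?thesis
      using d by simp
  qed
  have ratio: "\<phi> / \<alpha> = real T * log 2 (real (n * S)) / real n"
    unfolding \<phi>_eq \<alpha>_eq d_eq using n S by simp
  have \<phi>: "0 \<le> \<phi>"
    using d T by (simp add: \<phi>_eq)
  define p where "p = bin_entropy_inv (1 - \<phi> / \<alpha>)"
  have "0 \<le> 1 - \<phi> / \<alpha>" "1 - \<phi> / \<alpha> \<le> 1"
    using \<phi> \<phi>_le \<alpha> by auto
  from bin_entropy_inv_properties[OF this]
  have p: "bin_entropy p = 1 - \<phi> / \<alpha>" "0 \<le> p" "p \<le> 1 / 2"
    by (auto simp: p_def)
  \<comment> \<open>\<open>p1\<close> splits into \<open>q0\<close>, the pass probability when a
    fraction \<open>p\<close> of the block is guessed wrong, and the slack \<open>\<Delta>\<close>.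
    As \<open>\<mu>\<close> is the loss of \<open>q0\<close> against the honest value
    \<open>1 - \<alpha>\<close>, this gives \<open>gap = \<mu> - \<Delta>\<close>.\<close>
  define v where "v = real n * p / real l"
  define \<Delta> where "\<Delta> = (1 - \<alpha>) * (sqrt (8 / 3) * (sqrt (real n) / real l))"
  define q0 where "q0 = (1 - \<alpha>) * (1 - 2 * v)\<^sup>2"
  define \<mu> where "\<mu> = (1 - \<alpha>) * (1 - (1 - 2 * v)\<^sup>2)"
  define gap where "gap = 1 - p1 - \<alpha>"
  have gap_pos: "0 < gap"
    using p1_less by (simp add: gap_def)
  have v_eq: "v = \<alpha> / (1 - \<alpha>) * p"
    unfolding v_def n_l[symmetric] by simp
  have p1_eq': "p1 = q0 + \<Delta>"
    unfolding p1_eq q0_def \<Delta>_def v_eq d_l p_def by (simp add: algebra_simps)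
  have gap_eq: "gap = \<mu> - \<Delta>"
    unfolding gap_def p1_eq' by (simp add: q0_def \<mu>_def algebra_simps)
  have \<mu>_q0: "1 - q0 = \<alpha> + \<mu>"
    by (simp add: q0_def \<mu>_def algebra_simps)
  have \<Delta>: "0 \<le> \<Delta>"
    using \<alpha> by (simp add: \<Delta>_def)
  have v: "0 \<le> v" "v \<le> \<alpha> / (2 * (1 - \<alpha>))"
  proof -
    have "0 \<le> \<alpha> / (1 - \<alpha>)"
      using \<alpha> by simp
    from mult_left_mono[OF p(3) this] show "v \<le> \<alpha> / (2 * (1 - \<alpha>))"
      by (simp add: v_eq mult.commute)
    show "0 \<le> v"
      using p by (simp add: v_def)
  qed
  note \<mu> = overlap_loss_le[OF \<alpha> v, folded \<mu>_def]
  have gap_le: "gap \<le> \<mu>"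
    using \<Delta> by (simp add: gap_eq)
  \<comment> \<open>A positive gap means \<open>\<Delta> < \<mu>\<close>, and \<open>\<mu>\<close>
    is at most \<open>(1 - \<alpha>) * 4 * v\<close>. The result also excludes \<open>p = 0\<close>,
    where the tilt \<open>Z\<close> would be meaningless.\<close>
  have large: "sqrt (8 / 3) * sqrt (real n) < 4 * (real n * p)"
  proof -
    have "\<mu> = (1 - \<alpha>) * (4 * v * (1 - v))"
      by (simp add: \<mu>_def power2_eq_square algebra_simps)
    also have "\<dots> \<le> (1 - \<alpha>) * (4 * v * 1)"
      using \<alpha> v by (intro mult_left_mono) auto
    finally have "(1 - \<alpha>) * (sqrt (8 / 3) * (sqrt (real n) / real l)) < (1 - \<alpha>) * (4 * v)"
      using gap_pos unfolding gap_eq \<Delta>_def by simp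
    then have "sqrt (8 / 3) * (sqrt (real n) / real l) < 4 * v"
      by (rule mult_left_less_imp_less) (use \<alpha> in simp)
    then show ?thesis
      using l_pos by (simp add: v_def divide_less_cancel mult.assoc)
  qed
  have "0 \<le> sqrt (8 / 3) * sqrt (real n)"
    by simp
  with large have "0 < real n * p"
    by linarith
  then have p_pos: "0 < p"
    using n by (simp add: zero_less_mult_iff)
  define Z where "Z = (1 - p) / p"
  have h: "bin_entropy p = 1 - real T * log 2 (real (n * S)) / real n"
    unfolding p(1) ratio ..
  note advantage = attack_advantage_le[OF n S T p_pos p(3) l_pos h large, folded Z_def]

  \<comment> \<open>Failure means, thresholds and the choice of the tilt\<close>
  define a where "a = sqrt (3 * ln (1 / \<epsilon>c))"
  define b where "b = sqrt (2 * ln (1 / \<epsilon>f))"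
  \<comment> \<open>\<open>M\<close> is the mean number of failures of an honest signature.
    \<open>E\<close> is the reference mean for a forgery, with failure probability
    \<open>1 - p1\<close> at \<open>2 * \<theta> * N\<close> positions and \<open>\<alpha>\<close>
    at the others; \<open>2 * \<theta> = \<alpha> * (1 + \<nu>)\<close> brings it to this
    form.\<close>
  define M where "M = real N * \<alpha>"
  define E where "E = M * (1 + (1 + \<nu>) * gap)"
  have a0: "0 < a" and b0: "0 < b"
    using \<epsilon>c \<epsilon>f by (auto simp: a_def b_def)
  have \<theta>0: "0 \<le> \<theta>"
    using \<alpha> \<nu> by (simp add: \<theta>_eq)
  have two_\<theta>: "2 * \<theta> = \<alpha> * (1 + \<nu>)"
    by (simp add: \<theta>_eq)
  have M_pos: "0 < M"
    using N_pos \<alpha> by (simp add: M_def)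
  \<comment> \<open>The choice of \<open>N\<close> solved for the gap: it says that
    \<open>N * \<alpha>\<close> is the square of \<open>c / gap\<close>.\<close>
  have sqrt_M: "sqrt M * gap = a + sqrt (1 + 4 * \<theta>) * b"
  proof -
    define c where "c = a + sqrt (1 + 4 * \<theta>) * b"
    have c: "0 \<le> c"
      using a0 b0 \<theta>0 by (simp add: c_def)
    have "real N = 1 / \<alpha> ^ 3 * (c / (gap / \<alpha>))\<^sup>2"
      unfolding N_eq c_def a_def b_def gap_def ..
    then have "M = (c / gap)\<^sup>2"
      using \<alpha> gap_pos by (simp add: M_def field_simps power2_eq_square power3_eq_cube)
    then have "sqrt M = c / gap"
      using c gap_pos by simp
    then show ?thesis
      using gap_pos by (simp add: c_def)
  qed
  have sM: "0 < sqrt M"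
    using M_pos by simp
  have root: "1 \<le> sqrt (1 + 4 * \<theta>)"
    using \<theta>0 by simp
  have gap1: "gap \<le> 1"
    using gap_le \<mu>(2) by simp
  have a_le: "a \<le> sqrt M"
  proof -
    have "a \<le> sqrt M * gap"
      unfolding sqrt_M using b0 \<theta>0 by simp
    also have "\<dots> \<le> sqrt M"
      using sM gap1 by (simp add: mult_left_le)
    finally show ?thesis .
  qed
  have E_eq: "(1 - 2 * \<theta>) * real N * \<alpha> + 2 * \<theta> * real N * (1 - p1) = E"
    unfolding E_def M_def gap_def two_\<theta> by (simp add: algebra_simps)
  have zacc: "zacc = M + sqrt M * a"
    unfolding zacc_eq M_def a_def ..
  have zrej: "zrej = E - sqrt E * b"
    unfolding zrej_eq E_eq b_def ..
  have E_ge: "M \<le> E"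
    unfolding E_def using M_pos gap_pos \<nu> \<alpha> by simp
  have b_le: "b \<le> sqrt M * gap"
  proof -
    have "1 * b \<le> sqrt (1 + 4 * \<theta>) * b"
      using root b0 by (intro mult_right_mono) auto
    then show ?thesis
      unfolding sqrt_M using a0 by simp
  qed
  have E_pos: "0 < E"
    using E_ge M_pos by simp
  \<comment> \<open>The tilt of the lower Chernoff bound at \<open>E\<close>. The chain
    \<open>u \<le> gap \<le> \<mu> \<le> 27 / 50\<close> is what permits the constant
    \<open>K = exp (27 / 50)\<close>.\<close>
  define u where "u = b / sqrt E"
  have u: "0 \<le> u" "u \<le> gap"
  proof -
    show "0 \<le> u"
      using b0 E_pos by (simp add: u_def)
    have "sqrt M * gap \<le> sqrt E * gap"
      using E_ge gap_pos by (intro mult_right_mono) auto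
    with b_le have "b \<le> gap * sqrt E"
      by (simp add: mult.commute)
    then show "u \<le> gap"
      using E_pos by (simp add: u_def pos_divide_le_eq)
  qed
  have u1: "u < 1"
    using u gap_le \<mu>(2) by simp

  \<comment> \<open>Correctness: the upper tail of the honest failure count\<close>
  have "correct Q \<epsilon>c"
    unfolding correct_def
  proof (intro ballI)
    fix k m assume k: "k \<in> private_keys Q" and m: "m \<in> messages Q"
    have "qs_enc Q m \<in> words (qs_S Q) (qs_N Q)"
      using enc m by (auto simp: corrects_rate_def messages_def Q)
    from correctness_bound[OF k this, of "a / sqrt M"]
    have "1 - (1 + a / sqrt M) powr (- zacc) * exp (M * (a / sqrt M)) \<le>
        verif_prob Q (public_key k) m (Defs.sign Q k m) {ACC1}"
      using a0 sM by (simp add: Q l l_d M_def)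
    moreover have "(1 + a / sqrt M) powr (- zacc) * exp (M * (a / sqrt M)) \<le> \<epsilon>c"
      unfolding zacc a_def by (rule chernoff_upper[OF M_pos \<epsilon>c]) (use a_le in \<open>simp add: a_def\<close>)
    ultimately show "1 - \<epsilon>c \<le> verif_prob Q (public_key k) m (Defs.sign Q k m) {ACC1}"
      by linarith
  qed

  \<comment> \<open>Security: the lower tail of the failure count of a forgery\<close>
  moreover have "secure_forgery Q T \<epsilon>f"
    unfolding secure_forgery_def
  proof (intro allI impI)
    fix A assume A: "valid_adversary Q T A"
    have enc': "corrects_rate (qs_S Q) (qs_K Q) (qs_N Q) (qs_enc Q) \<theta>"
      using enc by (simp add: Q)
    have acc: "qs_zacc Q \<le> qs_zrej Q"
      unfolding Q zacc zrej E_def using M_pos gap_pos gap_le \<mu>(1) \<nu> \<alpha> a0 b0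
      by (intro thresholds_ordered[OF sqrt_M _ _ _ _ \<theta>_eq]) auto
    have R: "0 < real n * p" "real n * p \<le> real (qs_d Q div qs_S Q) / 2"
      using \<open>0 < real n * p\<close> p(3) n by (simp_all add: Q n_def)
    have q0: "q0 = real (ell Q) / real (qs_d Q) * (1 - 2 * (real n * p) / real (ell Q))\<^sup>2"
      by (simp add: Q l l_d q0_def v_def)
    have \<mu>_eq: "\<mu> = real (ell Q) / real (qs_d Q) - q0"
      by (simp add: Q l l_d q0_def \<mu>_def algebra_simps)
    have q0_nonneg: "0 \<le> q0"
      using \<alpha> by (simp add: q0_def)
    have "u * (1 - q0) \<le> u * 1"
      using u q0_nonneg by (intro mult_left_mono) auto
    then have K: "exp (u * (1 - q0)) \<le> exp (27 / 50)"
      using u gap_le \<mu>(2) by simp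
    have x: "(1 + real (qs_d Q div qs_S Q)) ^ T * (exp (27 / 50) * u *
        (real (ell Q) / real (qs_d Q) * (4 / (exp 1 * real (ell Q) * ln Z)) *
        (2 * (Z powr (real n * p) * (1 + 1 / Z) ^ (qs_d Q div qs_S Q))))) / 2 ^ (qs_d Q div qs_S Q)
        \<le> 2 * \<theta> * u * \<Delta>"
    proof -
      let ?A = "(1 + real n) ^ T * (exp (27 / 50) * (4 / (exp 1 * real l * ln Z) *
        (2 * (Z powr (real n * p) * (1 + 1 / Z) ^ n)))) / 2 ^ n"
      have "(1 + real n) ^ T * (exp (27 / 50) * u * ((1 - \<alpha>) * (4 / (exp 1 * real l * ln Z)) *
          (2 * (Z powr (real n * p) * (1 + 1 / Z) ^ n)))) / 2 ^ n = u * (1 - \<alpha>) * ?A"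
        by simp
      also have "\<dots> \<le> u * (1 - \<alpha>) * (1 / real S * (sqrt (8 / 3) * (sqrt (real n) / real l)))"
        using u \<alpha> advantage(1) by (intro mult_left_mono) auto
      \<comment> \<open>The factor \<open>1 / S\<close> of the advantage is \<open>\<alpha>\<close>,
        and \<open>\<alpha> \<le> 2 * \<theta>\<close>. So the cost at all \<open>N\<close>
        positions is covered by the part \<open>\<Delta>\<close> of the gain \<open>\<mu>\<close> at
        \<open>2 * \<theta> * N\<close> of them.\<close>
      also have "\<dots> = \<alpha> * (u * \<Delta>)"
        by (simp add: \<Delta>_def \<alpha>_eq)
      also have "\<dots> \<le> 2 * \<theta> * (u * \<Delta>)"
      proof (rule mult_right_mono)
        have "\<alpha> * 1 \<le> \<alpha> * (1 + \<nu>)"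
          using \<alpha> \<nu> by (intro mult_left_mono) auto
        then show "\<alpha> \<le> 2 * \<theta>"
          by (simp add: \<theta>_eq)
        show "0 \<le> u * \<Delta>"
          using u \<Delta> by simp
      qed
      finally show ?thesis
        unfolding Q l l_d n_def[symmetric] by (simp only: mult.assoc)
    qed
    have "(\<Sum>k\<in>private_keys Q. forge_prob Q T A k) / real (card (private_keys Q)) \<le>
        (1 - u) powr (- qs_zrej Q) *
        exp (real (qs_N Q) * (2 * \<theta> * u * \<Delta> - u * (1 - real (ell Q) / real (qs_d Q) + 2 * \<theta> * \<mu>)))"
      by (rule forgery_bound[OF A enc' acc R advantage(2) u(1) u1 q0 \<mu>_eq \<mu>(3) K x])
    \<comment> \<open>The loss \<open>\<Delta>\<close> turns \<open>\<mu>\<close> into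
      \<open>gap\<close>, so the exponent is exactly \<open>- u * E\<close> with the
      \<open>E\<close> that defines \<open>zrej\<close>.\<close>
    also have "real (qs_N Q) * (2 * \<theta> * u * \<Delta> - u * (1 - real (ell Q) / real (qs_d Q) + 2 * \<theta> * \<mu>)) =
        - u * E"
      unfolding Q l l_d E_def M_def gap_eq two_\<theta> by (simp add: algebra_simps)
    also have "(1 - u) powr (- qs_zrej Q) * exp (- u * E) \<le> \<epsilon>f"
    proof -
      have "b < sqrt E"
        using u1 E_pos by (simp add: u_def)
      then show ?thesis
        unfolding Q zrej u_def b_def by (intro chernoff_lower[OF E_pos \<epsilon>f])
    qed
    finally show "(\<Sum>k\<in>private_keys Q. forge_prob Q T A k) / real (card (private_keys Q)) \<le> \<epsilon>f" .
  qed
  ultimately show ?thesis ..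
qed

end
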